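(* Let $\hat{\mathbf q}=(\hat q_1,\hat q_2,\ldots)$ be an admissible sequence of non-negative weights with $\hat q_k>0$ for some odd $k\ge3$. Then $\hat{\mathbf q}$ is $\bullet$-admissible.
   Context: A planar map is a finite connected graph (loops and multiple edges allowed) properly embedded in the sphere, rooted at an oriented edge, modulo (orientation- and root-preserving) homeomorphisms. The face to the right of the root edge is the root face, all other faces are inner; the perimeter is the degree of the root face. A pointed map has an additional distinguished vertex. For a weight sequence $\hat{\mathbf q}$, the weight of a map of perimeter $p$ is $\prod_f\hat q_{\deg f}$, the product being over inner faces. $W^{(p)}(\hat{\mathbf q})$ (resp. $W^{(p)}_\bullet(\hat{\mathbf q})$) is the total weight of all rooted (resp. pointed rooted) planar maps of perimeter $p$. The sequence $\hat{\mathbf q}$ is admissible iff $W^{(p)}(\hat{\mathbf q})<\infty$ for all $p\ge1$, and $\bullet$-admissible iff $W^{(2)}_\bullet(\hat{\mathbf q})<\infty$, which is equivalent to $W_\bullet^{(p)}(\hat{\mathbf q})<\infty$ for all $p\ge1$. *)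

theory Defs
  imports
    "HOL-Analysis.Analysis"
    "HOL-Combinatorics.Orbits"
    "Graph_Theory.Digraph_Component"
begin

text \<open>
  A map with at least one edge is encoded by its oriented edges (darts), with labels in
  \<^typ>\<open>nat\<close>; labels are forgotten later by passing to isomorphism classes. The permutation \<open>opp\<close>
  reverses a dart, and \<open>rot\<close> sends a dart to the next dart in counterclockwise order around its
  origin. Up to orientation-preserving homeomorphism, this rotation system determines a connected
  graph properly embedded in a closed oriented surface. The one-vertex map has no oriented edge
  that could serve as a root, and so is not represented (it would have perimeter 0).
\<close>

record rooted_map =
  darts :: "nat set"
  rot :: "nat \<Rightarrow> nat"
  opp :: "nat \<Rightarrow> nat"
  root_dart :: nat

definition origin :: "rooted_map \<Rightarrow> nat \<Rightarrow> nat set" where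
  "origin m d = orbit (rot m) d"

text \<open>
  Follow a dart \<open>d\<close> with the face on its right; at its end, the next dart along this face is the one
  that comes just after \<open>opp m d\<close> in counterclockwise order.
\<close>

definition right_face :: "rooted_map \<Rightarrow> nat \<Rightarrow> nat set" where
  "right_face m d = orbit (rot m \<circ> opp m) d"

definition map_vertices :: "rooted_map \<Rightarrow> nat set set" where
  "map_vertices m = origin m ` darts m"

definition map_edges :: "rooted_map \<Rightarrow> nat set set" where
  "map_edges m = (\<lambda>d. {d, opp m d}) ` darts m"

definition map_faces :: "rooted_map \<Rightarrow> nat set set" where
  "map_faces m = right_face m ` darts m"

definition map_graph :: "rooted_map \<Rightarrow> (nat set, nat) pre_digraph" where
  "map_graph m = \<lparr>verts = map_vertices m, arcs = darts m,
     tail = origin m, head = (\<lambda>d. origin m (opp m d))\<rparr>"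

text \<open>The last condition is Euler's relation: the surface carrying the map is the sphere.\<close>

definition planar_map :: "rooted_map \<Rightarrow> bool" where
  "planar_map m \<longleftrightarrow>
     finite (darts m) \<and> root_dart m \<in> darts m \<and>
     rot m permutes darts m \<and> opp m permutes darts m \<and>
     (\<forall>d\<in>darts m. opp m d \<noteq> d \<and> opp m (opp m d) = d) \<and>
     Digraph_Component.connected (map_graph m) \<and>
     card (map_vertices m) + card (map_faces m) = card (map_edges m) + 2"

text \<open>
  As a face is the set of darts having it on their right, its degree is its cardinality; in
  particular an edge with the same face on both sides counts twice.
\<close>

definition root_face :: "rooted_map \<Rightarrow> nat set" where
  "root_face m = right_face m (root_dart m)"

definition perimeter :: "rooted_map \<Rightarrow> nat" where
  "perimeter m = card (root_face m)"

definition map_weight :: "(nat \<Rightarrow> real) \<Rightarrow> rooted_map \<Rightarrow> real" where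
  "map_weight q m = (\<Prod>f\<in>map_faces m - {root_face m}. q (card f))"

definition map_iso :: "(nat \<Rightarrow> nat) \<Rightarrow> rooted_map \<Rightarrow> rooted_map \<Rightarrow> bool" where
  "map_iso h m m' \<longleftrightarrow> bij_betw h (darts m) (darts m') \<and>
     (\<forall>d\<in>darts m. h (rot m d) = rot m' (h d) \<and> h (opp m d) = opp m' (h d)) \<and>
     h (root_dart m) = root_dart m'"

definition map_iso_rel :: "rooted_map rel" where
  "map_iso_rel = {(m, m'). planar_map m \<and> planar_map m' \<and> (\<exists>h. map_iso h m m')}"

definition pointed_map :: "rooted_map \<times> nat set \<Rightarrow> bool" where
  "pointed_map = (\<lambda>(m, v). planar_map m \<and> v \<in> map_vertices m)"

definition pointed_iso_rel :: "(rooted_map \<times> nat set) rel" where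
  "pointed_iso_rel = {((m, v), (m', v')). pointed_map (m, v) \<and> pointed_map (m', v') \<and>
     (\<exists>h. map_iso h m m' \<and> h ` v = v')}"

text \<open>
  The totals range over isomorphism classes. \<^const>\<open>the_elem\<close> extracts the common weight of the
  members of a class, see \<open>class_weight\<close> and \<open>pointed_class_weight\<close> below. Faces have degree at
  least 1, so the value of \<open>q\<close> at 0 is irrelevant.
\<close>

definition W :: "(nat \<Rightarrow> real) \<Rightarrow> nat \<Rightarrow> ennreal" where
  "W q p = (\<Sum>\<^sub>\<infinity>X \<in> {m. planar_map m \<and> perimeter m = p} // map_iso_rel.
     ennreal (the_elem (map_weight q ` X)))"

definition W_ptd :: "(nat \<Rightarrow> real) \<Rightarrow> nat \<Rightarrow> ennreal" where
  "W_ptd q p = (\<Sum>\<^sub>\<infinity>X \<in> {(m, v). pointed_map (m, v) \<and> perimeter m = p} // pointed_iso_rel.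
     ennreal (the_elem ((\<lambda>(m, v). map_weight q m) ` X)))"

definition admissible :: "(nat \<Rightarrow> real) \<Rightarrow> bool" where
  "admissible q \<longleftrightarrow> (\<forall>p\<ge>1. W q p < \<infinity>)"

definition ptd_admissible :: "(nat \<Rightarrow> real) \<Rightarrow> bool" where
  "ptd_admissible q \<longleftrightarrow> W_ptd q 2 < \<infinity>"

lemma planar_map_closed:
  assumes "planar_map m" "d \<in> darts m"
  shows "rot m d \<in> darts m" "opp m d \<in> darts m"
  using assms unfolding planar_map_def by (auto simp: permutes_in_image)

lemma orbit_image_conj:
  assumes "\<And>x. x \<in> D \<Longrightarrow> f x \<in> D" "\<And>x. x \<in> D \<Longrightarrow> h (f x) = g (h x)" "d \<in> D"
  shows "orbit f d \<subseteq> D" and "h ` orbit f d = orbit g (h d)"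
proof -
  have sub: "y \<in> D \<and> h y \<in> orbit g (h d)" if "y \<in> orbit f d" for y
    using that by induction (use assms in \<open>auto intro: orbit.intros\<close>)
  then show "orbit f d \<subseteq> D" by blast
  have "z \<in> h ` orbit f d" if "z \<in> orbit g (h d)" for z
    using that
  proof induction
    case base
    then show ?case using assms by (metis imageI orbit.base)
  next
    case (step y)
    then obtain x where "x \<in> orbit f d" "y = h x" by blast
    moreover have "x \<in> D" using sub calculation by blast
    ultimately show ?case using assms(2) by (metis imageI orbit.step)
  qed
  with sub show "h ` orbit f d = orbit g (h d)" by blast
qed

lemma right_face_iso:
  assumes "planar_map m" "map_iso h m m'" "d \<in> darts m"
  shows "right_face m d \<subseteq> darts m" "h ` right_face m d = right_face m' (h d)"
  unfolding right_face_def
  by (rule orbit_image_conj[where D = "darts m"];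
      use assms planar_map_closed[OF assms(1)] in \<open>simp add: map_iso_def\<close>)+

lemma origin_iso:
  assumes "planar_map m" "map_iso h m m'" "d \<in> darts m"
  shows "origin m d \<subseteq> darts m" "h ` origin m d = origin m' (h d)"
  unfolding origin_def
  by (rule orbit_image_conj[where D = "darts m"];
      use assms planar_map_closed[OF assms(1)] in \<open>simp add: map_iso_def\<close>)+

lemma map_iso_refl: "map_iso id m m"
  by (simp add: map_iso_def)

lemma map_iso_trans: "map_iso h m m' \<Longrightarrow> map_iso k m' m'' \<Longrightarrow> map_iso (k \<circ> h) m m''"
  unfolding map_iso_def by (auto intro: bij_betw_trans dest: bij_betwE)

lemma map_iso_sym:
  assumes "planar_map m" "map_iso h m m'"
  shows "map_iso (inv_into (darts m) h) m' m"
proof -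
  let ?k = "inv_into (darts m) h"
  have b: "bij_betw h (darts m) (darts m')" using assms by (simp add: map_iso_def)
  have "?k (rot m' d') = rot m (?k d') \<and> ?k (opp m' d') = opp m (?k d')" if "d' \<in> darts m'" for d'
  proof -
    obtain d where d: "d \<in> darts m" "d' = h d" using b \<open>d' \<in> darts m'\<close> by (auto simp: bij_betw_def)
    have inj: "inj_on h (darts m)" using b by (simp add: bij_betw_def)
    have "rot m' d' = h (rot m d)" "opp m' d' = h (opp m d)"
      using assms d by (auto simp: map_iso_def)
    then show ?thesis
      using d planar_map_closed[OF assms(1) d(1)] inj by (simp add: inv_into_f_f)
  qed
  moreover have "?k (root_dart m') = root_dart m"
    using assms b unfolding map_iso_def planar_map_def bij_betw_def by (metis inv_into_f_f)
  ultimately show ?thesis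
    unfolding map_iso_def using bij_betw_inv_into[OF b] by blast
qed

lemma equiv_map_iso_rel: "equiv {m. planar_map m} map_iso_rel"
proof (rule equivI)
  show "map_iso_rel \<subseteq> {m. planar_map m} \<times> {m. planar_map m}"
    by (auto simp: map_iso_rel_def)
  show "refl_on {m. planar_map m} map_iso_rel"
    using map_iso_refl by (auto simp: refl_on_def map_iso_rel_def)
  show "sym map_iso_rel"
    unfolding map_iso_rel_def by (rule symI) (use map_iso_sym in blast)
  show "trans map_iso_rel"
    unfolding map_iso_rel_def by (rule transI) (use map_iso_trans in blast)
qed

lemma map_vertices_subset:
  assumes "planar_map m" "v \<in> map_vertices m"
  shows "v \<subseteq> darts m"
  using assms origin_iso(1)[OF assms(1) map_iso_refl] by (auto simp: map_vertices_def)

lemma equiv_pointed_iso_rel: "equiv {x. pointed_map x} pointed_iso_rel"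
proof (rule equivI)
  show "pointed_iso_rel \<subseteq> {x. pointed_map x} \<times> {x. pointed_map x}"
    by (auto simp: pointed_iso_rel_def)
  show "refl_on {x. pointed_map x} pointed_iso_rel"
    using map_iso_refl by (auto simp: refl_on_def pointed_iso_rel_def intro!: exI[of _ id])
  show "sym pointed_iso_rel"
  proof (rule symI, clarify)
    fix m v m' v' assume "((m, v), (m', v')) \<in> pointed_iso_rel"
    then obtain h where h: "pointed_map (m, v)" "pointed_map (m', v')" "map_iso h m m'" "h ` v = v'"
      by (auto simp: pointed_iso_rel_def)
    have "planar_map m" "v \<subseteq> darts m"
      using h map_vertices_subset by (auto simp: pointed_map_def)
    then have "map_iso (inv_into (darts m) h) m' m" "inv_into (darts m) h ` v' = v"
      using h map_iso_sym by (auto simp: map_iso_def bij_betw_def inv_into_image_cancel)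
    then show "((m', v'), (m, v)) \<in> pointed_iso_rel"
      using h by (auto simp: pointed_iso_rel_def)
  qed
  show "trans pointed_iso_rel"
  proof (rule transI, clarify)
    fix m v m' v' m'' v''
    assume "((m, v), (m', v')) \<in> pointed_iso_rel" "((m', v'), (m'', v'')) \<in> pointed_iso_rel"
    then obtain h k where "pointed_map (m, v)" "pointed_map (m'', v'')"
      "map_iso h m m'" "map_iso k m' m''" "h ` v = v'" "k ` v' = v''"
      by (auto simp: pointed_iso_rel_def)
    moreover from this have "map_iso (k \<circ> h) m m''" "(k \<circ> h) ` v = v''"
      by (auto intro: map_iso_trans)
    ultimately show "((m, v), (m'', v'')) \<in> pointed_iso_rel"
      unfolding pointed_iso_rel_def by blast
  qed
qed

lemma map_iso_invariants:
  assumes m: "planar_map m" and h: "map_iso h m m'"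
  shows "perimeter m' = perimeter m" and "map_weight q m' = map_weight q m"
proof -
  have inj: "inj_on h (darts m)" and im: "h ` darts m = darts m'"
    using h by (auto simp: map_iso_def bij_betw_def)
  have r: "root_dart m \<in> darts m" using m by (simp add: planar_map_def)
  have sub: "f \<subseteq> darts m" if "f \<in> map_faces m" for f
    using that right_face_iso(1)[OF m h] by (auto simp: map_faces_def)
  have card: "card (h ` f) = card f" if "f \<in> map_faces m" for f
    using card_image inj_on_subset[OF inj sub[OF that]] by blast
  have rf: "root_face m \<in> map_faces m" using r by (simp add: map_faces_def root_face_def)
  have rh: "root_face m' = h ` root_face m"
    using right_face_iso(2)[OF m h r] h by (simp add: root_face_def map_iso_def)
  show "perimeter m' = perimeter m"
    using card[OF rf] rh by (simp add: perimeter_def)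
  have fh: "map_faces m' = (`) h ` map_faces m"
    using right_face_iso(2)[OF m h] im by (force simp: map_faces_def image_image)
  have injf: "inj_on ((`) h) (map_faces m)"
    by (rule inj_onI) (use inj_on_image_eq_iff[OF inj sub sub] in simp)
  have "map_faces m' - {root_face m'} = (`) h ` (map_faces m - {root_face m})"
    using inj_on_image_set_diff[OF injf, of "map_faces m" "{root_face m}"] rf
    unfolding fh rh by simp
  then have "map_weight q m' = (\<Prod>f\<in>map_faces m - {root_face m}. q (card (h ` f)))"
    using prod.reindex[of "(`) h" "map_faces m - {root_face m}" "\<lambda>f. q (card f)"]
      inj_on_subset[OF injf] by (simp add: map_weight_def)
  then show "map_weight q m' = map_weight q m"
    using card by (simp add: map_weight_def)
qed

lemma class_weight:
  assumes "planar_map m"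
  shows "the_elem (map_weight q ` (map_iso_rel `` {m})) = map_weight q m"
proof -
  have "(m, m) \<in> map_iso_rel" using assms equiv_map_iso_rel by (simp add: equiv_def refl_on_def)
  then have "map_weight q ` (map_iso_rel `` {m}) = {map_weight q m}"
    using map_iso_invariants(2)[of m] by (auto simp: map_iso_rel_def)
  then show ?thesis by simp
qed

lemma pointed_class_weight:
  assumes "pointed_map (m, v)"
  shows "the_elem ((\<lambda>(m, v). map_weight q m) ` (pointed_iso_rel `` {(m, v)})) = map_weight q m"
proof -
  have "((m, v), (m, v)) \<in> pointed_iso_rel"
    using assms equiv_pointed_iso_rel by (simp add: equiv_def refl_on_def)
  moreover have "map_weight q m' = map_weight q m" if "((m, v), (m', v')) \<in> pointed_iso_rel" for m' v'
    using that map_iso_invariants(2)[of m] by (auto simp: pointed_iso_rel_def pointed_map_def)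
  ultimately have "(\<lambda>(m, v). map_weight q m) ` (pointed_iso_rel `` {(m, v)}) = {map_weight q m}"
    by (fastforce simp: image_def)
  then show ?thesis by simp
qed

end

theory Submission
  imports Defs
begin

text \<open>
  Deleting the root edge repeatedly encodes rooted planar maps by trees; Euler's inequality
  \<open>V + F \<le> E + 2\<close> for connected maps of any genus shows that both parts are planar when the root
  edge is a bridge. Give each vertex a weight \<open>u < 1\<close>, and let \<open>Y p\<close> be the weight of pointed maps
  of perimeter \<open>p\<close>. The deletion recursion for \<open>Y\<close> is linear and invariant under translations of
  \<open>p\<close>, so that \<open>Y p * Y p' \<le> u * Y (p + p')\<close> by first-passage decomposition; in particular
  \<open>Y 2 ^ n \<le> Y (2 * n)\<close>. Since \<open>n * u ^ n \<le> 1 / (1 - u)\<close>, also \<open>Y p \<le> W p / (1 - u)\<close>. Finally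
  \<open>W (p + k - 2) \<le> W p / q k\<close>, as an edge can be drawn in the root face to cut off a face of
  degree \<open>k\<close>. As \<open>k \<ge> 3\<close>, this bounds \<open>W p\<close> geometrically along \<open>p = 2 + j * (k - 2)\<close>, and letting
  \<open>j\<close> tend to infinity gives \<open>Y 2 \<le> max 1 (1 / q k ^ 2)\<close> uniformly in \<open>u\<close>.
\<close>

section \<open>Cycles of permutations\<close>

text \<open>The recursion behind the translation invariance is \<open>Y p = (sum over k of q k * Y
  (p + k - 2)) + 2 * (sum over i of W i * Y (p - 2 - i))\<close> with \<open>Y 0 = u\<close>, where
  \<open>W\<close> also carries the vertex weights. Formally, \<open>Y p / u\<close> is the weight
  of walks from \<open>p\<close> stopped at 0, with steps \<open>k - 2\<close> of weight
  \<open>q k\<close> and steps \<open>- (i + 2)\<close> of weight \<open>2 * W i\<close>, neither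
  depending on the height. A walk from \<open>p + p'\<close> that stays above \<open>p'\<close>
  until it hits \<open>p'\<close>, followed by one from \<open>p'\<close> to 0, is a walk from
  \<open>p + p'\<close> to 0. The obstacle is that the comparison of \<open>Y\<close> with
  \<open>W\<close> costs a factor \<open>1 / (1 - u)\<close>, useless as \<open>u\<close> tends to
  1. Supermultiplicativity removes it: with \<open>y = Y 2\<close> and
  \<open>n = 1 + i * (k - 2)\<close> the estimates combine to
  \<open>(q k ^ 2 * y ^ (k - 2)) ^ i * y \<le> B / (1 - u)\<close> for all \<open>i\<close>, where
  \<open>B\<close> bounds \<open>W 2\<close>. For fixed \<open>u\<close> this forces
  \<open>q k ^ 2 * y ^ (k - 2) \<le> 1\<close> once \<open>y > 1\<close>, a condition free of
  \<open>u\<close> and \<open>B\<close>. On the map side two comparisons suffice: distinct trees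
  give distinct classes of rooted maps, and every pointed class comes from a tree with a marked
  vertex.\<close>

text \<open>Takes \<open>x\<close> out of its cycle: \<open>x\<close> becomes fixed and its
  predecessor is sent to \<open>f x\<close>. This is what the removal of a dart does to the
  rotation.\<close>

definition perm_skip :: "'a \<Rightarrow> ('a \<Rightarrow> 'a) \<Rightarrow> 'a \<Rightarrow> 'a" where
  "perm_skip x f = Transposition.transpose x (f x) \<circ> f"

lemma perm_skip_self [simp]: "perm_skip x f x = x"
  by (simp add: perm_skip_def)

lemma perm_skip_apply:
  assumes "inj f" "d \<noteq> x"
  shows "perm_skip x f d = (if f d = x then f x else f d)"
  using assms by (auto simp: perm_skip_def Transposition.transpose_def dest: injD)

lemma perm_skip_permutes:
  assumes "f permutes D" "x \<in> D"
  shows "perm_skip x f permutes D - {x}"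
proof -
  have "perm_skip x f permutes D"
    unfolding perm_skip_def using assms
    by (intro permutes_compose[OF assms(1)] permutes_swap_id) (auto simp: permutes_in_image)
  then show ?thesis by (rule permutes_superset) auto
qed

lemma orbit_skip:
  assumes inj: "inj f" and "d \<noteq> x"
  shows "orbit (perm_skip x f) d = orbit f d - {x}"
proof
  have nx: "perm_skip x f e \<noteq> x" if "e \<noteq> x" for e
    using that inj_eq[OF inj] by (auto simp: perm_skip_apply[OF inj])
  show "orbit (perm_skip x f) d \<subseteq> orbit f d - {x}"
  proof
    fix e assume "e \<in> orbit (perm_skip x f) d"
    then show "e \<in> orbit f d - {x}"
    proof induction
      case base
      then show ?case using assms nx[of d]
        by (auto simp: perm_skip_apply) (metis orbit.base orbit.step, metis orbit.base)
    next
      case (step y)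
      then show ?case using assms nx[of y]
        by (auto simp: perm_skip_apply) (metis orbit.step, metis orbit.step)
    qed
  qed
  have "(e \<noteq> x \<longrightarrow> e \<in> orbit (perm_skip x f) d) \<and> (e = x \<longrightarrow> f x \<in> orbit (perm_skip x f) d)"
    if "e \<in> orbit f d" for e
    using that
  proof induction
    case base
    show ?case
      using orbit.base[of "perm_skip x f" d] assms by (auto simp: perm_skip_apply split: if_splits)
  next
    case (step y)
    show ?case
    proof (cases "y = x")
      case True
      then have "f x \<in> orbit (perm_skip x f) d" using step by simp
      then show ?thesis using True by auto
    next
      case False
      then have "perm_skip x f y \<in> orbit (perm_skip x f) d" using step by (auto intro: orbit.step)
      then show ?thesis using False inj by (auto simp: perm_skip_apply split: if_splits)
    qed
  qed
  then show "orbit f d - {x} \<subseteq> orbit (perm_skip x f) d" by blast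
qed

definition cyc :: "('a \<Rightarrow> 'a) \<Rightarrow> 'a set \<Rightarrow> 'a set set" where
  "cyc f D = orbit f ` D"

lemma finite_cyc [simp]: "finite D \<Longrightarrow> finite (cyc f D)"
  by (simp add: cyc_def)

lemma self_in_orbit:
  assumes "finite D" "f permutes D"
  shows "x \<in> orbit f x"
  using assms permutation_permutes permutation_self_in_orbit by metis

lemma orbit_eq:
  assumes "finite D" "f permutes D" "y \<in> orbit f x"
  shows "orbit f y = orbit f x"
proof -
  have "cyclic_on f (orbit f x)" by (rule cyclic_on_orbit[OF assms(2,1)])
  then show ?thesis using assms(3) orbit_cyclic_eq3 by metis
qed

lemma orbit_sub:
  assumes "\<And>e. e \<in> A \<Longrightarrow> f e \<in> A" "d \<in> A"
  shows "orbit f d \<subseteq> A"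
proof
  fix y assume "y \<in> orbit f d"
  then show "y \<in> A" by induction (use assms in auto)
qed

lemma cyc_disjoint:
  assumes "finite D" "f permutes D" "A \<in> cyc f D" "B \<in> cyc f D" "x \<in> A" "x \<in> B"
  shows "A = B"
  using assms orbit_eq[OF assms(1,2)] by (metis cyc_def imageE)

lemma cyc_sub:
  assumes "f permutes D" "A \<in> cyc f D" shows "A \<subseteq> D"
  using assms permutes_orbit_subset by (fastforce simp: cyc_def)

lemma cyc_iff_orbit:
  assumes "finite D" "f permutes D" "A \<in> cyc f D" "x \<in> A"
  shows "A = orbit f x"
  using assms orbit_eq[OF assms(1,2)] by (auto simp: cyc_def)

lemma cyc_skip:
  assumes "finite D" "f permutes D" "x \<in> D"
  shows "cyc (perm_skip x f) (D - {x}) = (\<lambda>A. A - {x}) ` cyc f D - {{}}"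
proof -
  have inj: "inj f" using assms permutes_inj by blast
  have "cyc (perm_skip x f) (D - {x}) = (\<lambda>d. orbit f d - {x}) ` (D - {x})"
    unfolding cyc_def by (intro image_cong refl orbit_skip inj) auto
  also have "\<dots> = (\<lambda>A. A - {x}) ` cyc f D - {{}}"
  proof (intro equalityI subsetI)
    fix A assume "A \<in> (\<lambda>d. orbit f d - {x}) ` (D - {x})"
    then show "A \<in> (\<lambda>A. A - {x}) ` cyc f D - {{}}"
      using self_in_orbit[OF assms(1,2)] by (auto simp: cyc_def)
  next
    fix A assume "A \<in> (\<lambda>A. A - {x}) ` cyc f D - {{}}"
    then obtain d where d: "d \<in> D" "A = orbit f d - {x}" "A \<noteq> {}" by (auto simp: cyc_def)
    then obtain e where e: "e \<in> orbit f d" "e \<noteq> x" by blast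
    then have "e \<in> D" "orbit f e = orbit f d"
      using d permutes_orbit_subset[OF assms(2)] orbit_eq[OF assms(1,2)] by auto
    then show "A \<in> (\<lambda>d. orbit f d - {x}) ` (D - {x})" using d e by auto
  qed
  finally show ?thesis .
qed

text \<open>The transposition exchanges the images of \<open>a\<close> and \<open>b\<close>, so from
  \<open>a\<close> the new permutation runs through the cycle of \<open>b\<close> and from
  \<open>b\<close> through that of \<open>a\<close>. For face permutations this merges two
  faces.\<close>

lemma orbit_merge:
  assumes "finite D" "f permutes D" "b \<notin> orbit f a"
  shows "orbit (f \<circ> Transposition.transpose a b) a = orbit f a \<union> orbit f b"
    and "orbit (f \<circ> Transposition.transpose a b) b = orbit f a \<union> orbit f b"
proof -
  let ?g = "f \<circ> Transposition.transpose a b"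
  have ab: "a \<noteq> b" using assms self_in_orbit by metis
  have a: "a \<notin> orbit f b" using assms orbit_eq self_in_orbit by metis
  have ga: "?g a = f b" and gb: "?g b = f a" by simp_all
  have g: "?g e = f e" if "e \<noteq> a" "e \<noteq> b" for e using that by simp
  have 1: "orbit f b \<subseteq> orbit ?g a"
  proof
    fix y assume "y \<in> orbit f b"
    then show "y \<in> orbit ?g a"
    proof induction
      case base then show ?case using ga orbit.base[of ?g a] by metis
    next
      case (step y)
      then show ?case using a ga g orbit.base[of ?g a] by (metis orbit.step)
    qed
  qed
  have 2: "orbit f a \<subseteq> orbit ?g b"
  proof
    fix y assume "y \<in> orbit f a"
    then show "y \<in> orbit ?g b"
    proof induction
      case base then show ?case using gb orbit.base[of ?g b] by metis
    next
      case (step y)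
      then show ?case using assms(3) gb g orbit.base[of ?g b] by (metis orbit.step)
    qed
  qed
  have "b \<in> orbit ?g a" "a \<in> orbit ?g b" using 1 2 self_in_orbit[OF assms(1,2)] by auto
  then have 3: "orbit ?g a = orbit ?g b" by (meson orbit_trans subsetI subset_antisym)
  have 4: "orbit ?g d \<subseteq> orbit f a \<union> orbit f b" if "d \<in> orbit f a \<union> orbit f b" for d
    by (rule orbit_sub[OF _ that], case_tac "e = a"; case_tac "e = b")
      (auto simp: g orbit.intros simp del: comp_apply simp: ga gb)
  show "orbit ?g a = orbit f a \<union> orbit f b" "orbit ?g b = orbit f a \<union> orbit f b"
    using 1 2 3 4[of a] 4[of b] self_in_orbit[OF assms(1,2)] by auto
qed

lemma orbit_comp_transpose_other:
  assumes "finite D" "f permutes D" "d \<notin> orbit f a" "d \<notin> orbit f b"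
  shows "orbit (f \<circ> Transposition.transpose a b) d = orbit f d"
proof (rule orbit_cong)
  show "d \<in> orbit f d" using self_in_orbit assms by metis
  fix s assume "s \<in> orbit f d"
  then have "s \<noteq> a" "s \<noteq> b"
    using orbit_eq[OF assms(1,2)] self_in_orbit[OF assms(1,2)] assms(3,4) by metis+
  then show "(f \<circ> Transposition.transpose a b) s = f s" by simp
qed

text \<open>Converse effect when \<open>a\<close> and \<open>b\<close> share a cycle: it breaks into
  the stretch after \<open>a\<close> up to \<open>b\<close> and the stretch after \<open>b\<close>
  up to \<open>a\<close>. The length \<open>n\<close> of the first stretch later appears as the
  degree of a face.\<close>

lemma orbit_split:
  assumes "finite D" "f permutes D" "b \<in> orbit f a" "a \<noteq> b"
  defines "n \<equiv> funpow_dist1 f a b"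
  shows "orbit (f \<circ> Transposition.transpose a b) b = (\<lambda>i. (f ^^ i) a) ` {1..n}"
    and "a \<notin> orbit (f \<circ> Transposition.transpose a b) b"
    and "card (orbit (f \<circ> Transposition.transpose a b) b) = n"
proof -
  let ?g = "f \<circ> Transposition.transpose a b"
  let ?A = "(\<lambda>i. (f ^^ i) a) ` {1..n}"
  have fn: "(f ^^ n) a = b" unfolding n_def using assms by (intro funpow_dist1_prop)
  have n: "n \<ge> 1" by (simp add: n_def)
  have least: "(f ^^ i) a \<noteq> b" if "0 < i" "i < n" for i
    using that funpow_dist1_least n_def by metis
  have injf: "inj (f ^^ i)" for i using assms(2) permutes_inj inj_fn by metis
  \<comment> \<open>A repetition would give the period \<open>j - i\<close> to \<open>a\<close>, so
    \<open>b\<close> would be reached already after \<open>n - (j - i)\<close> steps, against the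
    minimality of \<open>n\<close>.\<close>
  have neq: "(f ^^ i) a \<noteq> (f ^^ j) a" if "i < j" "j \<le> n" for i j
  proof
    assume e: "(f ^^ i) a = (f ^^ j) a"
    have "(f ^^ i) ((f ^^ (j - i)) a) = (f ^^ i) a"
      using e that funpow_add[of i "j - i" f] by simp
    then have p: "(f ^^ (j - i)) a = a" using injf by (meson injD)
    have "(f ^^ (n - (j - i))) ((f ^^ (j - i)) a) = b"
      using that fn funpow_add[of "n - (j - i)" "j - i" f] by simp
    then have "(f ^^ (n - (j - i))) a = b" using p by simp
    moreover have "n - (j - i) < n" using that by linarith
    ultimately show False using least[of "n - (j - i)"] \<open>a \<noteq> b\<close>
      by (cases "n - (j - i) = 0") (metis funpow_0, metis neq0_conv)
  qed
  show an: "a \<notin> orbit ?g b"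
    and eq: "orbit ?g b = ?A"
  proof -
    have "?g e \<in> ?A" if eA: "e \<in> ?A" for e
    proof -
      obtain i where i: "1 \<le> i" "i \<le> n" "e = (f ^^ i) a" using eA by auto
      show ?thesis
      proof (cases "i = n")
        case True
        then show ?thesis using i fn n by (auto intro!: image_eqI[of _ _ 1])
      next
        case False
        have "e \<noteq> a" using neq[of 0 i] i by auto
        moreover have "e \<noteq> b" using least i False by auto
        ultimately have "?g e = (f ^^ Suc i) a" using i by simp
        then show ?thesis using i False by (auto intro!: image_eqI[of _ _ "Suc i"])
      qed
    qed
    moreover have "b \<in> ?A" using fn n by (auto intro!: image_eqI[of _ _ n])
    ultimately have s: "orbit ?g b \<subseteq> ?A" by (intro orbit_sub)
    have "a \<notin> ?A" using neq[of 0] by fastforce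
    then show "a \<notin> orbit ?g b" using s by auto
    have "(f ^^ i) a \<in> orbit ?g b" if "1 \<le> i" "i \<le> n" for i
      using that
    proof (induction i rule: dec_induct)
      case base
      have "?g b = f a" by simp
      then show ?case using orbit.base[of ?g b] by (simp add: comp_def)
    next
      case (step i)
      have "(f ^^ i) a \<noteq> a" using neq[of 0 i] step by auto
      moreover have "(f ^^ i) a \<noteq> b" using least step by auto
      ultimately have "?g ((f ^^ i) a) = (f ^^ Suc i) a" by simp
      then show ?case using step by (metis orbit.step Suc_leD)
    qed
    then show "orbit ?g b = ?A" using s by auto
  qed
  have "inj_on (\<lambda>i. (f ^^ i) a) {1..n}"
  proof (rule inj_onI)
    fix i j assume "i \<in> {1..n}" "j \<in> {1..n}" "(f ^^ i) a = (f ^^ j) a"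
    then show "i = j" using neq[of i j] neq[of j i] by (cases i j rule: linorder_cases) auto
  qed
  then show "card (orbit ?g b) = n" using eq by (simp add: card_image)
qed

lemma cyc_skip2:
  assumes "finite D" "f permutes D" "x \<in> D" "y \<in> D" "x \<noteq> y"
  shows "cyc (perm_skip y (perm_skip x f)) (D - {x, y}) = (\<lambda>A. A - {x, y}) ` cyc f D - {{}}"
proof -
  have DD: "A - {x} - {y} = A - {x, y}" for A by blast
  have "cyc (perm_skip y (perm_skip x f)) (D - {x} - {y}) = (\<lambda>A. A - {y}) ` cyc (perm_skip x f) (D - {x}) - {{}}"
    using assms by (intro cyc_skip perm_skip_permutes) auto
  also have "\<dots> = (\<lambda>A. A - {x, y}) ` cyc f D - {{}}"
    unfolding cyc_skip[OF assms(1-3)]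
  proof (intro equalityI subsetI)
    fix B assume "B \<in> (\<lambda>A. A - {y}) ` ((\<lambda>A. A - {x}) ` cyc f D - {{}}) - {{}}"
    then obtain A where "A \<in> cyc f D" "B = A - {x} - {y}" "B \<noteq> {}" by auto
    then show "B \<in> (\<lambda>A. A - {x, y}) ` cyc f D - {{}}" by (simp add: DD imageI)
  next
    fix B assume "B \<in> (\<lambda>A. A - {x, y}) ` cyc f D - {{}}"
    then obtain A where A: "A \<in> cyc f D" "B = A - {x, y}" "B \<noteq> {}" by auto
    then have "A - {x} \<noteq> {}" by blast
    then have "A - {x} \<in> (\<lambda>A. A - {x}) ` cyc f D - {{}}" using A(1) by (simp add: imageI)
    moreover have "B = (A - {x}) - {y}" using A(2) by (simp add: DD)
    ultimately show "B \<in> (\<lambda>A. A - {y}) ` ((\<lambda>A. A - {x}) ` cyc f D - {{}}) - {{}}"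
      using A(3) by (simp add: imageI)
  qed
  finally show ?thesis by (simp add: DD)
qed

lemma orbit_skip2:
  assumes "f permutes D" "d \<noteq> x" "d \<noteq> y"
  shows "orbit (perm_skip y (perm_skip x f)) d = orbit f d - {x, y}"
proof -
  have "inj f" "inj (perm_skip x f)"
    using assms permutes_inj unfolding perm_skip_def by (auto intro!: inj_compose)
  then show ?thesis using assms by (auto simp: orbit_skip)
qed

lemma inj_on_cyc_Diff:
  assumes "finite D" "f permutes D"
  shows "inj_on (\<lambda>A. A - C) {A \<in> cyc f D. \<not> A \<subseteq> C}"
proof (rule inj_onI)
  fix A B assume A: "A \<in> {A \<in> cyc f D. \<not> A \<subseteq> C}" and B: "B \<in> {A \<in> cyc f D. \<not> A \<subseteq> C}"
    and eq: "A - C = B - C"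
  then obtain z where "z \<in> A - C" by auto
  moreover have "z \<in> B" using calculation eq by auto
  ultimately show "A = B" using A B cyc_disjoint[OF assms] by auto
qed

text \<open>Cycles inside \<open>{x, y}\<close> disappear; all others are merely shortened and stay
  distinct, since they are disjoint and nonempty after the removal.\<close>

lemma card_cyc_skip2:
  assumes "finite D" "f permutes D" "x \<in> D" "y \<in> D" "x \<noteq> y"
  shows "card (cyc f D) = card (cyc (perm_skip y (perm_skip x f)) (D - {x, y})) + card {A \<in> cyc f D. A \<subseteq> {x, y}}"
proof -
  let ?T = "{A \<in> cyc f D. \<not> A \<subseteq> {x, y}}"
  have "(\<lambda>A. A - {x, y}) ` cyc f D - {{}} = (\<lambda>A. A - {x, y}) ` ?T" by auto
  then have "card (cyc (perm_skip y (perm_skip x f)) (D - {x, y})) = card ?T"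
    using cyc_skip2[OF assms] inj_on_cyc_Diff[OF assms(1,2)] by (simp add: card_image)
  moreover have "cyc f D = ?T \<union> {A \<in> cyc f D. A \<subseteq> {x, y}}" by auto
  moreover have "card (?T \<union> {A \<in> cyc f D. A \<subseteq> {x, y}}) = card ?T + card {A \<in> cyc f D. A \<subseteq> {x, y}}"
    using assms(1) by (intro card_Un_disjoint) auto
  ultimately show ?thesis by metis
qed

lemma cyc_merge:
  assumes "finite D" "f permutes D" "a \<in> D" "b \<in> D" "b \<notin> orbit f a"
  shows "cyc (f \<circ> Transposition.transpose a b) D
    = insert (orbit f a \<union> orbit f b) (cyc f D - {orbit f a, orbit f b})"
proof (intro equalityI subsetI)
  let ?g = "f \<circ> Transposition.transpose a b"
  have g: "?g permutes D" using assms by (intro permutes_compose permutes_swap_id)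
  fix A assume "A \<in> cyc ?g D"
  then obtain d where d: "d \<in> D" "A = orbit ?g d" by (auto simp: cyc_def)
  show "A \<in> insert (orbit f a \<union> orbit f b) (cyc f D - {orbit f a, orbit f b})"
  proof (cases "d \<in> orbit f a \<union> orbit f b")
    case True
    then have "A = orbit f a \<union> orbit f b"
      using orbit_merge[OF assms(1,2,5)] orbit_eq[OF assms(1) g] d by metis
    then show ?thesis by simp
  next
    case False
    then have "A = orbit f d" using orbit_comp_transpose_other[OF assms(1,2)] d by auto
    moreover have "d \<in> orbit f d" by (rule self_in_orbit[OF assms(1,2)])
    ultimately show ?thesis using False d by (auto simp: cyc_def)
  qed
next
  let ?g = "f \<circ> Transposition.transpose a b"
  fix A assume A: "A \<in> insert (orbit f a \<union> orbit f b) (cyc f D - {orbit f a, orbit f b})"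
  show "A \<in> cyc ?g D"
  proof (cases "A = orbit f a \<union> orbit f b")
    case True
    then show ?thesis using orbit_merge[OF assms(1,2,5)] assms(3) by (auto simp: cyc_def)
  next
    case False
    then obtain d where d: "d \<in> D" "A = orbit f d" "A \<noteq> orbit f a" "A \<noteq> orbit f b"
      using A by (auto simp: cyc_def)
    then have "d \<notin> orbit f a" "d \<notin> orbit f b" using orbit_eq[OF assms(1,2)] by metis+
    then have "A = orbit ?g d" using orbit_comp_transpose_other[OF assms(1,2)] d by metis
    then show ?thesis using d by (auto simp: cyc_def)
  qed
qed

section \<open>Deleting the root edge\<close>

text \<open>A rotation system of any genus, possibly disconnected: the class that is stable under
  deletion of an edge.\<close>

definition premap :: "rooted_map \<Rightarrow> bool" where
  "premap m \<longleftrightarrow> finite (darts m) \<and> rot m permutes darts m \<and> opp m permutes darts m \<and>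
     (\<forall>d\<in>darts m. opp m d \<noteq> d \<and> opp m (opp m d) = d)"

definition closed_in :: "rooted_map \<Rightarrow> nat set \<Rightarrow> bool" where
  "closed_in m A \<longleftrightarrow> A \<subseteq> darts m \<and> (\<forall>d\<in>A. rot m d \<in> A \<and> opp m d \<in> A)"

text \<open>Connectedness in terms of invariant sets of darts, which are easier than paths to follow
  through deletions and gluings; \<open>connected_iff_conn\<close> identifies it with connectedness
  of the graph.\<close>

definition connected_map :: "rooted_map \<Rightarrow> bool" where
  "connected_map m \<longleftrightarrow> (\<forall>A. closed_in m A \<longrightarrow> A = {} \<or> A = darts m)"

definition rooted :: "rooted_map \<Rightarrow> bool" where
  "rooted m \<longleftrightarrow> (darts m \<noteq> {} \<longrightarrow> root_dart m \<in> darts m)"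

definition face_perm :: "rooted_map \<Rightarrow> nat \<Rightarrow> nat" where
  "face_perm m = rot m \<circ> opp m"

definition inner_faces :: "rooted_map \<Rightarrow> nat set set" where
  "inner_faces m = map_faces m - {root_face m}"

text \<open>A map without darts stands for the one-vertex map, which has one vertex, one face and
  perimeter 0.\<close>

definition num_vertices :: "rooted_map \<Rightarrow> nat" where
  "num_vertices m = (if darts m = {} then 1 else card (map_vertices m))"

definition num_faces :: "rooted_map \<Rightarrow> nat" where
  "num_faces m = card (inner_faces m) + 1"

definition perim :: "rooted_map \<Rightarrow> nat" where
  "perim m = (if darts m = {} then 0 else perimeter m)"

definition cmap :: "rooted_map \<Rightarrow> bool" where
  "cmap m \<longleftrightarrow> premap m \<and> rooted m \<and> connected_map m"

text \<open>Euler's relation, doubled so that darts replace edges. Unlike \<open>planar_map\<close>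
  it admits the one-vertex map, without which the deletion of edges would leave the class.\<close>

definition sphere :: "rooted_map \<Rightarrow> bool" where
  "sphere m \<longleftrightarrow> cmap m \<and> 2 * (num_vertices m + num_faces m) = card (darts m) + 4"

lemma map_vertices_cyc: "map_vertices m = cyc (rot m) (darts m)"
  by (auto simp: map_vertices_def cyc_def origin_def)

lemma map_faces_cyc: "map_faces m = cyc (face_perm m) (darts m)"
  by (auto simp: map_faces_def cyc_def right_face_def face_perm_def)

lemma root_face_orbit: "root_face m = orbit (face_perm m) (root_dart m)"
  by (simp add: root_face_def right_face_def face_perm_def)

lemma map_weight_inner: "map_weight q m = (\<Prod>f\<in>inner_faces m. q (card f))"
  by (simp add: map_weight_def inner_faces_def)

lemma premap_phi: "premap m \<Longrightarrow> face_perm m permutes darts m"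
  unfolding premap_def face_perm_def by (intro permutes_compose) auto

text \<open>On darts \<open>rot m\<close> is \<open>face_perm m \<circ> opp m\<close>, so invariance
  can be tested on faces instead of vertices.\<close>

lemma closed_in_phi:
  assumes "premap m"
  shows "closed_in m A \<longleftrightarrow> A \<subseteq> darts m \<and> (\<forall>d\<in>A. face_perm m d \<in> A \<and> opp m d \<in> A)"
proof -
  have "opp m (opp m d) = d" if "d \<in> darts m" for d using assms that by (simp add: premap_def)
  then have "rot m d = face_perm m (opp m d)" if "d \<in> darts m" for d using that by (simp add: face_perm_def)
  then show ?thesis unfolding closed_in_def by (auto simp: face_perm_def subset_iff)
qed

lemma permutes_closed_back:
  assumes "finite D" "f permutes D" "A \<subseteq> D" "\<And>d. d \<in> A \<Longrightarrow> f d \<in> A" "f d \<in> A"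
  shows "d \<in> A"
proof -
  have "finite A" using assms finite_subset by blast
  moreover have "f ` A \<subseteq> A" using assms by auto
  moreover have "inj f" using assms permutes_inj by blast
  ultimately have "f ` A = A" by (meson endo_inj_surj inj_on_subset subset_UNIV)
  then show ?thesis using assms(5) \<open>inj f\<close> by (metis imageE injD)
qed

lemma closed_in_back:
  assumes "premap m" "closed_in m A"
  shows "rot m d \<in> A \<Longrightarrow> d \<in> A" and "opp m d \<in> A \<Longrightarrow> d \<in> A" and "face_perm m d \<in> A \<Longrightarrow> d \<in> A"
proof -
  have "d \<in> A" if "f permutes darts m" "\<And>d. d \<in> A \<Longrightarrow> f d \<in> A" "f d \<in> A" for f
    using permutes_closed_back[of "darts m" f A d] that assms by (auto simp: premap_def closed_in_def)
  note * = this
  have A: "\<And>d. d \<in> A \<Longrightarrow> rot m d \<in> A" "\<And>d. d \<in> A \<Longrightarrow> opp m d \<in> A" "\<And>d. d \<in> A \<Longrightarrow> face_perm m d \<in> A"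
    using assms closed_in_phi[OF assms(1), of A] by (auto simp: closed_in_def)
  show "rot m d \<in> A \<Longrightarrow> d \<in> A" by (rule *[OF _ A(1)]) (use assms in \<open>simp_all add: premap_def\<close>)
  show "opp m d \<in> A \<Longrightarrow> d \<in> A" by (rule *[OF _ A(2)]) (use assms in \<open>simp_all add: premap_def\<close>)
  show "face_perm m d \<in> A \<Longrightarrow> d \<in> A" by (rule *[OF premap_phi[OF assms(1)] A(3)])
qed

lemma closed_in_Diff:
  assumes "premap m" "closed_in m A" "closed_in m B"
  shows "closed_in m (A - B)"
  using assms closed_in_back[OF assms(1,3)] unfolding closed_in_def by blast

lemma closed_in_darts: "premap m \<Longrightarrow> closed_in m (darts m)"
  by (auto simp: premap_def closed_in_def permutes_in_image)

lemma closed_in_orbit: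
  assumes "premap m" "closed_in m A" "d \<in> A"
  shows "orbit (face_perm m) d \<subseteq> A" and "orbit (rot m) d \<subseteq> A"
  using assms(2,3) closed_in_phi[OF assms(1), of A]
    orbit_sub[of A "face_perm m" d] orbit_sub[of A "rot m" d] by (auto simp: closed_in_def)

text \<open>The new root is the dart after \<open>s\<close> around its origin once \<open>r\<close>
  is gone. If no such dart is left, it is \<open>s\<close> itself, which is no dart of the new
  map.\<close>

definition del :: "rooted_map \<Rightarrow> rooted_map" where
  "del m = (let r = root_dart m; s = opp m r in
     \<lparr>darts = darts m - {r, s}, rot = perm_skip s (perm_skip r (rot m)),
      opp = Transposition.transpose r s \<circ> opp m, root_dart = perm_skip r (rot m) s\<rparr>)"

text \<open>Neither planarity nor connectedness is assumed: Euler's inequality concerns all genera,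
  and the results are also applied to glued maps before their connectedness is known.\<close>

locale root_edge =
  fixes m :: rooted_map
  assumes pm: "premap m" and rD: "root_dart m \<in> darts m"
begin

abbreviation "D \<equiv> darts m"
abbreviation "r \<equiv> root_dart m"
abbreviation "s \<equiv> opp m r"
text \<open>The face permutation after cutting the root edge into two half-edges \<open>r\<close> and \<open>s\<close>: it differs
  from that of \<open>m\<close> by a transposition, which merges two faces or splits one.\<close>

definition "cut_perm = rot m \<circ> opp (del m)"
abbreviation "E \<equiv> D - {r, s}"

lemma fin: "finite D" and rot: "rot m permutes D" and opp: "opp m permutes D"
  and sD: "s \<in> D" and rs: "r \<noteq> s" and opps: "opp m s = r"
  and oppopp: "d \<in> D \<Longrightarrow> opp m (opp m d) = d" and oppD: "d \<in> D \<Longrightarrow> opp m d \<in> D"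
  and oppneq: "d \<in> D \<Longrightarrow> opp m d \<noteq> d"
  using pm rD by (auto simp: premap_def permutes_in_image)

lemma del_simps [simp]:
  "darts (del m) = E" "rot (del m) = perm_skip s (perm_skip r (rot m))"
  "opp (del m) = Transposition.transpose r s \<circ> opp m" "root_dart (del m) = perm_skip r (rot m) s"
  by (simp_all add: del_def Let_def)

lemma opp_E: "d \<in> E \<Longrightarrow> opp m d \<in> E"
  using oppD oppopp opps by fastforce

lemma opp_del: "d \<in> E \<Longrightarrow> opp (del m) d = opp m d"
  using opp_E by auto

lemma opp_del_rs: "opp (del m) r = r" "opp (del m) s = s"
  using opps by simp_all

lemma premap_del: "premap (del m)"
proof -
  have "perm_skip s (perm_skip r (rot m)) permutes D - {r} - {s}"
    using rs rD sD rot by (intro perm_skip_permutes) auto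
  moreover have "D - {r} - {s} = E" by auto
  moreover have "Transposition.transpose r s \<circ> opp m permutes D"
    using opp rD sD by (intro permutes_compose permutes_swap_id)
  then have "Transposition.transpose r s \<circ> opp m permutes E"
    by (rule permutes_superset) (use opp_del_rs in auto)
  ultimately show ?thesis
    using fin opp_del opp_E oppneq oppopp by (auto simp: premap_def simp del: comp_apply)
qed

lemma face_perm: "face_perm m permutes D" using pm premap_phi by blast

lemma psi_phi: "cut_perm = face_perm m \<circ> Transposition.transpose r s"
proof
  fix d
  show "cut_perm d = (face_perm m \<circ> Transposition.transpose r s) d"
  proof (cases "d \<in> {r, s}")
    case True
    then show ?thesis using opps by (auto simp: cut_perm_def face_perm_def)
  next
    case False
    then have "opp m d \<notin> {r, s}" using rs opp opps permutes_inj by (metis injD insert_iff singletonD)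
    then show ?thesis using False by (auto simp: cut_perm_def face_perm_def)
  qed
qed

lemma phi_psi: "face_perm m = cut_perm \<circ> Transposition.transpose r s"
  by (simp add: psi_phi comp_assoc)

lemma cut_perm: "cut_perm permutes D"
  unfolding psi_phi using face_perm rD sD by (intro permutes_compose permutes_swap_id)

lemma psi_rs: "cut_perm r = rot m r" "cut_perm s = rot m s"
  using opp_del_rs by (simp_all add: cut_perm_def)

lemma phi_rs: "face_perm m r = rot m s" "face_perm m s = rot m r"
  using opps by (simp_all add: face_perm_def)

text \<open>The left side is the face permutation of the intermediate stage in which
  \<open>r\<close> is removed while \<open>s\<close> is kept as a half-edge. The place of
  \<open>r\<close> will be found by walking along it.\<close>

lemma leg_psi: "perm_skip r (rot m) \<circ> opp (del m) = perm_skip r cut_perm"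
  using opp_del_rs psi_rs by (simp add: perm_skip_def cut_perm_def comp_assoc)

text \<open>As \<open>opp (del m)\<close> fixes \<open>r\<close> and \<open>s\<close>, removing them
  from the rotation amounts to removing them from the faces of the cut map.\<close>

lemma phi_del: "face_perm (del m) = perm_skip s (perm_skip r cut_perm)"
proof -
  note 1 = leg_psi
  have "face_perm (del m) = Transposition.transpose s (perm_skip r (rot m) s) \<circ> (perm_skip r (rot m) \<circ> opp (del m))"
    unfolding face_perm_def by (simp add: perm_skip_def[of s] comp_assoc del: comp_apply)
  moreover have "perm_skip r (rot m) s = perm_skip r cut_perm s"
    using 1 opp_del_rs by (metis comp_apply)
  ultimately show ?thesis by (simp only: 1 perm_skip_def[of s "perm_skip r cut_perm"])
qed

lemma orbit_phi_del: "d \<in> E \<Longrightarrow> orbit (face_perm (del m)) d = orbit cut_perm d - {r, s}"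
  unfolding phi_del using cut_perm by (intro orbit_skip2) auto

lemma cyc_phi_del: "cyc (face_perm (del m)) E = (\<lambda>A. A - {r, s}) ` cyc cut_perm D - {{}}"
  unfolding phi_del using fin cut_perm rD sD rs by (rule cyc_skip2)

lemma card_D: "card D = card E + 2"
proof -
  have "card {r, s} = 2" using rs by simp
  then show ?thesis using card_Diff_subset[of "{r, s}" D] fin rD sD card_mono[OF fin, of "{r, s}"] by simp
qed

lemma vertices_del:
  "card (map_vertices m) = card (map_vertices (del m)) + card {A \<in> map_vertices m. A \<subseteq> {r, s}}"
  unfolding map_vertices_cyc using card_cyc_skip2[OF fin rot rD sD rs] by simp

lemma closed_in_del:
  assumes "closed_in m A"
  shows "closed_in (del m) (A - {r, s})"
proof -
  have inj: "inj (rot m)" "inj (perm_skip r (rot m))"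
    using rot permutes_inj unfolding perm_skip_def by (auto intro!: inj_compose)
  have "perm_skip r (rot m) d \<in> A" if "d \<in> A" for d
    using assms that by (cases "d = r") (simp_all add: perm_skip_apply[OF inj(1)] closed_in_def, metis)
  then have "perm_skip s (perm_skip r (rot m)) d \<in> A" if "d \<in> A" for d
    using that by (cases "d = s") (simp_all add: perm_skip_apply[OF inj(2)], metis)
  moreover have "perm_skip s (perm_skip r (rot m)) d \<in> E" if "d \<in> E" for d
    using premap_del that permutes_in_image[of "rot (del m)" "darts (del m)"] by (simp add: premap_def)
  moreover have "opp (del m) d \<in> A - {r, s}" if "d \<in> A - {r, s}" for d
  proof -
    have "d \<in> E" using that assms by (auto simp: closed_in_def)
    then have "opp (del m) d = opp m d" "opp m d \<in> E" using opp_del opp_E by blast+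
    then show ?thesis using that assms by (auto simp: closed_in_def)
  qed
  ultimately show ?thesis using assms
    unfolding closed_in_def del_simps(1,2) by blast
qed

lemma vertex_small:
  assumes "A \<in> map_vertices m" "A \<subseteq> {r, s}"
  shows "A = {r} \<and> rot m r = r \<or> A = {s} \<and> rot m s = s \<or> rot m r = s \<and> rot m s = r"
proof -
  have A: "A = orbit (rot m) x" if "x \<in> A" for x
    using assms that cyc_iff_orbit[OF fin rot] by (simp add: map_vertices_cyc)
  have "A \<noteq> {}" using assms orbit_nonempty by (fastforce simp: map_vertices_def origin_def)
  then consider "A = {r}" | "A = {s}" | "A = {r, s}" using assms(2) by blast
  then show ?thesis
  proof cases
    case 1 then show ?thesis using A[of r] orbit_eq_singleton_iff[of "rot m" r] by auto
  next
    case 2 then show ?thesis using A[of s] orbit_eq_singleton_iff[of "rot m" s] by auto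
  next
    case 3
    then have "A = orbit (rot m) r" "A = orbit (rot m) s" using A by auto
    then have "rot m r \<in> {r, s}" "rot m s \<in> {r, s}" "rot m r \<noteq> r" "rot m s \<noteq> s"
      using 3 orbit.base[of "rot m"] orbit_eq_singleton_iff[of "rot m"] rs
      by (metis, metis, metis insertI1 insert_commute singletonD, metis insertI1 insert_commute singletonD)
    then show ?thesis by auto
  qed
qed

end

section \<open>Root edge separating two faces (chord case)\<close>

context root_edge
begin

abbreviation "Or \<equiv> orbit (face_perm m) r"
abbreviation "Os \<equiv> orbit (face_perm m) s"
definition "rest = cyc (face_perm m) D - {Or, Os}"

lemma self_phi: "x \<in> orbit (face_perm m) x" and self_psi: "x \<in> orbit cut_perm x"
  using self_in_orbit[OF fin face_perm] self_in_orbit[OF fin cut_perm] by auto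

lemma finite_rest [simp]: "finite rest"
  using fin by (simp add: rest_def)

lemma rest_disj: "A \<in> rest \<Longrightarrow> r \<notin> A \<and> s \<notin> A"
  using cyc_iff_orbit[OF fin face_perm] by (auto simp: rest_def)

lemma rest_nonempty: "A \<in> rest \<Longrightarrow> A \<noteq> {}"
  using orbit_nonempty by (fastforce simp: rest_def cyc_def)

lemma rest_Diff: "(\<lambda>A. A - {r, s}) ` rest = rest"
proof -
  have "(\<lambda>A. A - {r, s}) ` rest = id ` rest"
    using rest_disj by (intro image_cong) auto
  then show ?thesis by simp
qed

lemma cyc_split: "cyc (face_perm m) D = rest \<union> {Or, Os}"
  using rD sD by (auto simp: rest_def cyc_def)

lemma chord_psi:
  assumes "s \<notin> Or"
  shows "orbit cut_perm r = Or \<union> Os" "orbit cut_perm s = Or \<union> Os"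
    and "cyc cut_perm D = insert (Or \<union> Os) rest"
  unfolding psi_phi using orbit_merge[OF fin face_perm assms] cyc_merge[OF fin face_perm rD sD assms]
  by (auto simp: rest_def)

lemma chord_disj: "s \<notin> Or \<Longrightarrow> Or \<inter> Os = {}"
  using orbit_eq[OF fin face_perm] self_phi by blast

lemma orbit_D: "Or \<subseteq> D" "Os \<subseteq> D"
  using permutes_orbit_subset[OF face_perm] rD sD by auto

lemma orbit_rest:
  assumes "d \<in> A" "A \<in> rest" shows "A = orbit (face_perm m) d"
  using assms cyc_iff_orbit[OF fin face_perm] by (auto simp: rest_def)

lemma not_merged_notin_rest: "(Or \<union> Os) - {r, s} \<notin> rest"
proof
  assume a: "(Or \<union> Os) - {r, s} \<in> rest"
  obtain z where z: "z \<in> (Or \<union> Os) - {r, s}" using rest_nonempty[OF a] by blast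
  then have "(Or \<union> Os) - {r, s} = orbit (face_perm m) z" using a by (rule orbit_rest)
  moreover have "orbit (face_perm m) z \<in> {Or, Os}"
    using z orbit_eq[OF fin face_perm, of z r] orbit_eq[OF fin face_perm, of z s] by auto
  ultimately show False using self_phi[of r] self_phi[of s] by auto
qed

lemma skip_rot_s: "perm_skip r (rot m) s = perm_skip r cut_perm s"
  using psi_rs by (simp add: perm_skip_def)

lemma root_del_orbit:
  assumes "perm_skip r (rot m) s \<noteq> s"
  shows "perm_skip r (rot m) s \<in> E" "perm_skip r (rot m) s \<in> orbit cut_perm s"
proof -
  have "perm_skip r cut_perm s \<in> orbit (perm_skip r cut_perm) s" by (rule orbit.base)
  moreover have "orbit (perm_skip r cut_perm) s = orbit cut_perm s - {r}"
    using cut_perm permutes_inj rs by (intro orbit_skip) auto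
  moreover have "orbit cut_perm s \<subseteq> D" using cut_perm sD by (rule permutes_orbit_subset)
  ultimately show "perm_skip r (rot m) s \<in> E" "perm_skip r (rot m) s \<in> orbit cut_perm s"
    using assms skip_rot_s by auto
qed

text \<open>The single loop: the only map with a separating root edge whose deletion leaves no
  dart.\<close>

lemma chord_empty:
  assumes "s \<notin> Or" "E = {}"
  shows "Or = {r}" "Os = {s}" "rest = {}" "rot m r = s" "rot m s = r"
proof -
  have D: "D = {r, s}" using assms rD sD by blast
  have r: "r \<in> Or" and s: "s \<in> Os" by (rule self_phi)+
  have "Or \<subseteq> {r, s}" using orbit_D(1) D by simp
  then show 1: "Or = {r}" using assms(1) r by auto
  have "r \<notin> Os" using chord_disj[OF assms(1)] r by auto
  moreover have "Os \<subseteq> {r, s}" using orbit_D(2) D by simp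
  ultimately show 2: "Os = {s}" using s by auto
  have "A \<notin> rest" for A
  proof
    assume A: "A \<in> rest"
    then have "A \<subseteq> {r, s}" using cyc_sub[OF face_perm, of A] D by (simp add: rest_def)
    then show False using rest_disj[OF A] rest_nonempty[OF A] by auto
  qed
  then show "rest = {}" by auto
  show "rot m r = s" "rot m s = r" using 1 2 phi_rs by (auto simp: orbit_eq_singleton_iff)
qed

lemma root_face_del:
  assumes "s \<notin> Or" "perm_skip r (rot m) s \<noteq> s"
  shows "root_face (del m) = (Or \<union> Os) - {r, s}"
proof -
  have "orbit cut_perm (perm_skip r (rot m) s) = orbit cut_perm s"
    using root_del_orbit[OF assms(2)] orbit_eq[OF fin cut_perm] by blast
  then show ?thesis
    using chord_psi(2)[OF assms(1)] orbit_phi_del[OF root_del_orbit(1)[OF assms(2)]]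
    by (metis root_face_orbit del_simps(4))
qed

lemma faces_del_chord:
  assumes "s \<notin> Or"
  shows "map_faces (del m) = insert ((Or \<union> Os) - {r, s}) rest - {{}}"
  using cyc_phi_del chord_psi(3)[OF assms] rest_Diff by (simp add: map_faces_cyc)

lemma inner_faces_chord:
  assumes nb: "s \<notin> Or" and ne: "E = {} \<or> perm_skip r (rot m) s \<noteq> s"
  shows "inner_faces (del m) = rest" "inner_faces m = insert Os rest" "Os \<notin> rest"
proof -
  show "Os \<notin> rest" by (simp add: rest_def)
  have "Or \<noteq> Os" using nb self_phi by blast
  then show "inner_faces m = insert Os rest"
    using cyc_split by (auto simp: inner_faces_def map_faces_cyc root_face_orbit rest_def)
  show "inner_faces (del m) = rest"
  proof (cases "E = {}")
    case True
    then have "map_faces (del m) = {}" by (simp only: map_faces_cyc cyc_def del_simps(1) image_empty)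
    then show ?thesis using chord_empty(3)[OF nb True]
      by (simp add: inner_faces_def)
  next
    case False
    then have "perm_skip r (rot m) s \<noteq> s" using ne by simp
    then have *: "root_face (del m) = (Or \<union> Os) - {r, s}" by (rule root_face_del[OF nb])
    have "(Or \<union> Os) - {r, s} \<noteq> {}" using * orbit_nonempty by (metis root_face_orbit)
    then show ?thesis
      using faces_del_chord[OF nb] not_merged_notin_rest * rest_nonempty
      by (auto simp: inner_faces_def)
  qed
qed

text \<open>Merging faces of degrees \<open>perimeter m\<close> and \<open>card Os\<close> loses the
  two darts \<open>r\<close> and \<open>s\<close>, hence the degree
  \<open>perim (del m) + 2 - perimeter m\<close> of the face across the root edge. Condition
  \<open>ne\<close> follows from connectedness by \<open>chord_root_del\<close>, but is stated
  separately because a glued map is only later shown to be connected.\<close>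

lemma chord:
  assumes nb: "s \<notin> root_face m" and ne: "E = {} \<or> perm_skip r (rot m) s \<noteq> s"
  shows "rooted (del m)" "num_faces m = num_faces (del m) + 1"
    "map_weight q m = q (perim (del m) + 2 - perimeter m) * map_weight q (del m)"
    "perim (del m) + 2 = perimeter m + card Os" "card Os \<ge> 1"
    "1 \<le> perimeter m" "perimeter m \<le> perim (del m) + 1"
proof -
  have nb': "s \<notin> Or" using nb by (simp add: root_face_orbit)
  show "rooted (del m)" using ne root_del_orbit(1) by (auto simp: rooted_def)
  have fO: "finite Or" "finite Os" using orbit_D fin finite_subset by blast+
  have nO: "card Or \<ge> 1" "card Os \<ge> 1" using fO orbit_nonempty
    by (metis card_0_eq less_one not_le)+
  show "card Os \<ge> 1" by fact
  have p: "perimeter m = card Or" by (simp add: perimeter_def root_face_orbit)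
  show "1 \<le> perimeter m" using p nO by simp
  show *: "perim (del m) + 2 = perimeter m + card Os"
  proof (cases "E = {}")
    case True
    then show ?thesis using chord_empty[OF nb' True] p by (simp add: perim_def)
  next
    case False
    then have "root_face (del m) = (Or \<union> Os) - {r, s}" using ne root_face_del[OF nb'] by simp
    moreover have "card ((Or \<union> Os) - {r, s}) = card (Or \<union> Os) - card {r, s}"
      using self_phi by (intro card_Diff_subset) auto
    moreover have "card (Or \<union> Os) = card Or + card Os"
      using fO chord_disj[OF nb'] by (rule card_Un_disjoint)
    ultimately show ?thesis using False p rs nO by (simp add: perim_def perimeter_def)
  qed
  then show "perimeter m \<le> perim (del m) + 1" using nO by simp
  have f: "inner_faces (del m) = rest" "inner_faces m = insert Os rest" "Os \<notin> rest"
    using inner_faces_chord[OF nb' ne] .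
  then show "num_faces m = num_faces (del m) + 1" by (simp add: num_faces_def)
  show "map_weight q m = q (perim (del m) + 2 - perimeter m) * map_weight q (del m)"
    using f * by (simp add: map_weight_inner)
qed

text \<open>An end of degree one would put \<open>r\<close> and \<open>s\<close> on the same face,
  because \<open>face_perm m r = rot m s\<close> and \<open>face_perm m s = rot m r\<close>.\<close>

lemma chord_num_vertices:
  assumes nb: "s \<notin> root_face m" and ne: "E = {} \<or> perm_skip r (rot m) s \<noteq> s"
  shows "num_vertices m = num_vertices (del m)"
proof (cases "E = {}")
  case True
  have nb': "s \<notin> Or" using nb by (simp add: root_face_orbit)
  have D: "D = {r, s}" using True rD sD by blast
  have "orbit (rot m) r = orbit (rot m) s"
    using chord_empty(4,5)[OF nb' True] orbit_eq[OF fin rot] orbit.base by metis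
  then have "map_vertices m = {orbit (rot m) r}"
    unfolding map_vertices_cyc cyc_def D by auto
  then show ?thesis using True rD by (auto simp: num_vertices_def)
next
  case False
  have nb': "s \<notin> Or" using nb by (simp add: root_face_orbit)
  have "{A \<in> map_vertices m. A \<subseteq> {r, s}} = {}"
  proof -
    have "rot m r \<noteq> r"
      using phi_rs nb' self_phi orbit.base orbit_eq[OF fin face_perm] by metis
    moreover have "rot m s \<noteq> s"
      using phi_rs nb' orbit.base by metis
    moreover have "\<not> (rot m r = s \<and> rot m s = r)"
    proof
      assume "rot m r = s \<and> rot m s = r"
      then have "perm_skip r (rot m) s = s" using rs by (simp add: perm_skip_def)
      then show False using ne False by simp
    qed
    ultimately show ?thesis using vertex_small by blast
  qed
  then have "card (map_vertices m) = card (map_vertices (del m))"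
    using vertices_del by simp
  then show ?thesis using False rD by (auto simp: num_vertices_def)
qed

lemma chord_phi_rest:
  assumes "s \<notin> Or" "d \<in> E" "d \<notin> Or \<union> Os"
  shows "face_perm (del m) d = face_perm m d" "face_perm m d \<notin> Or \<union> Os"
proof -
  show 1: "face_perm m d \<notin> Or \<union> Os"
    using assms(3) orbit_eq[OF fin face_perm] self_phi orbit.base by (metis Un_iff)
  then have 2: "face_perm m d \<noteq> r" "face_perm m d \<noteq> s" using self_phi[of r] self_phi[of s] by auto
  have d: "d \<noteq> r" "d \<noteq> s" using assms(2) by auto
  then have "cut_perm d = face_perm m d" by (simp add: psi_phi)
  moreover have "inj cut_perm" "inj (perm_skip r cut_perm)"
    using cut_perm permutes_inj unfolding perm_skip_def by (auto intro!: inj_compose)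
  ultimately show "face_perm (del m) d = face_perm m d"
    using d 2 by (simp add: phi_del perm_skip_apply)
qed

text \<open>An invariant set of \<open>del m\<close> that misses the merged face is invariant in
  \<open>m\<close>, hence empty. One that meets this face contains all of it, so that its complement
  misses it.\<close>

lemma chord_conn_del:
  assumes nb: "s \<notin> Or" and c: "connected_map m"
  shows "connected_map (del m)"
  unfolding connected_map_def
proof (intro allI impI)
  have no: "B = {}" if B: "closed_in (del m) B" "B \<inter> (Or \<union> Os) = {}" for B
  proof -
    have BE: "B \<subseteq> E" using B by (simp add: closed_in_def)
    have "face_perm m d \<in> B \<and> opp m d \<in> B" if "d \<in> B" for d
    proof -
      have "face_perm (del m) d \<in> B" "opp (del m) d \<in> B"
        using B(1) that closed_in_phi[OF premap_del, of B] by (auto simp del: del_simps)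
      moreover have "face_perm (del m) d = face_perm m d"
        using that BE B(2) by (intro chord_phi_rest[OF nb]) auto
      moreover have "opp (del m) d = opp m d" using opp_del that BE by blast
      ultimately show ?thesis by simp
    qed
    then have "closed_in m B" using BE closed_in_phi[OF pm] by auto
    then show ?thesis using c BE rD unfolding connected_map_def by blast
  qed
  fix A assume A: "closed_in (del m) A"
  show "A = {} \<or> A = darts (del m)"
  proof (cases "A \<inter> (Or \<union> Os) = {}")
    case True
    then show ?thesis using no A by blast
  next
    case False
    then obtain z where z: "z \<in> A" "z \<in> Or \<union> Os" by blast
    have zE: "z \<in> E" using z A by (auto simp: closed_in_def)
    have "orbit cut_perm z = Or \<union> Os" using z chord_psi[OF nb] orbit_eq[OF fin cut_perm] by blast
    then have "(Or \<union> Os) - {r, s} \<subseteq> A"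
      using orbit_phi_del[OF zE] closed_in_orbit(1)[OF premap_del A z(1)] by simp
    then have "(darts (del m) - A) \<inter> (Or \<union> Os) = {}" by auto
    then have "darts (del m) - A = {}"
      by (rule no[OF closed_in_Diff[OF premap_del closed_in_darts[OF premap_del] A]])
    then show ?thesis using A by (auto simp: closed_in_def)
  qed
qed

text \<open>If the new root were \<open>s\<close>, the merged face would lie in
  \<open>{r, s}\<close>, and the root edge would be a component of its own.\<close>

lemma chord_root_del:
  assumes nb: "s \<notin> Or" and c: "connected_map m"
  shows "E = {} \<or> perm_skip r (rot m) s \<noteq> s"
proof (rule disjCI)
  assume "\<not> perm_skip r (rot m) s \<noteq> s"
  then have "perm_skip r cut_perm s = s" using skip_rot_s by simp
  then have "orbit (perm_skip r cut_perm) s = {s}" by (simp add: orbit_eq_singleton_iff)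
  moreover have "orbit (perm_skip r cut_perm) s = orbit cut_perm s - {r}"
    using cut_perm permutes_inj rs by (intro orbit_skip) auto
  ultimately have "Or \<union> Os \<subseteq> {r, s}" using chord_psi[OF nb] by blast
  then have "face_perm m r \<in> {r, s}" "face_perm m s \<in> {r, s}" using orbit.base[of "face_perm m"] by blast+
  then have "closed_in m {r, s}" using closed_in_phi[OF pm] rD sD opps by auto
  then show "E = {}" using c unfolding connected_map_def by blast
qed

lemma chord_conn:
  assumes nb: "s \<notin> Or" and ne: "E = {} \<or> perm_skip r (rot m) s \<noteq> s" and c: "connected_map (del m)"
  shows "connected_map m"
  unfolding connected_map_def
proof (intro allI impI)
  fix A assume A: "closed_in m A"
  have AD: "A \<subseteq> D" using A by (simp add: closed_in_def)
  have rs': "r \<in> A \<longleftrightarrow> s \<in> A" using A opps by (auto simp: closed_in_def)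
  show "A = {} \<or> A = D"
  proof (cases "E = {}")
    case True
    then have DE: "D = {r, s}" using rD sD by blast
    show ?thesis
    proof (cases "r \<in> A")
      case True
      then have "D \<subseteq> A" using rs' DE by simp
      then show ?thesis using AD by simp
    next
      case False
      then have "A \<subseteq> {}" using rs' AD DE by auto
      then show ?thesis by simp
    qed
  next
    case False
    \<comment> \<open>The new root lies on one of the two faces along the root edge, so an invariant
      set of \<open>m\<close> contains it exactly when it contains the root edge.\<close>
    define z where "z = perm_skip r (rot m) s"
    have z: "z \<in> E" "z \<in> Or \<union> Os"
      using ne False root_del_orbit chord_psi(2)[OF nb] by (auto simp: z_def)
    have zA: "z \<in> A \<Longrightarrow> r \<in> A"
    proof -
      assume "z \<in> A"
      then have "orbit (face_perm m) z \<subseteq> A" using closed_in_orbit[OF pm A] by blast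
      moreover have "orbit (face_perm m) z = Or \<or> orbit (face_perm m) z = Os"
        using z(2) orbit_eq[OF fin face_perm] by blast
      ultimately show "r \<in> A" using self_phi rs' by blast
    qed
    have Az: "r \<in> A \<Longrightarrow> z \<in> A"
      using z(2) closed_in_orbit(1)[OF pm A] rs' by blast
    have "closed_in (del m) (A - {r, s})" using A by (rule closed_in_del)
    then have "A - {r, s} = {} \<or> A - {r, s} = E"
      using c unfolding connected_map_def del_simps(1) by blast
    then show ?thesis
    proof
      assume "A - {r, s} = {}"
      then show ?thesis using z zA Az rs' by blast
    next
      assume "A - {r, s} = E"
      then show ?thesis using z zA rs' AD rD sD by blast
    qed
  qed
qed

end

section \<open>Submaps carried by unions of components\<close>

definition sub :: "rooted_map \<Rightarrow> nat set \<Rightarrow> nat \<Rightarrow> rooted_map" where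
  "sub m A x = \<lparr>darts = A, rot = perm_restrict (rot m) A, opp = perm_restrict (opp m) A, root_dart = x\<rparr>"

lemma sub_simps [simp]:
  "darts (sub m A x) = A" "rot (sub m A x) = perm_restrict (rot m) A"
  "opp (sub m A x) = perm_restrict (opp m) A" "root_dart (sub m A x) = x"
  by (simp_all add: sub_def)

lemma perm_restrict_permutes:
  assumes "finite A" "f permutes D" "\<And>d. d \<in> A \<Longrightarrow> f d \<in> A"
  shows "perm_restrict f A permutes A"
proof (rule bij_imp_permutes)
  have "inj_on f A" using assms(2) permutes_inj inj_on_subset by blast
  moreover have "f ` A \<subseteq> A" using assms(3) by auto
  ultimately have "bij_betw f A A" using assms(1) endo_inj_surj[of A f] by (auto simp: bij_betw_def)
  then show "bij_betw (perm_restrict f A) A A"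
    by (rule bij_betw_cong[THEN iffD1, rotated]) (simp add: perm_restrict_def)
qed (simp add: perm_restrict_def)

lemma premap_sub:
  assumes "premap m" "closed_in m A"
  shows "premap (sub m A x)"
proof -
  have A: "A \<subseteq> darts m" "\<And>d. d \<in> A \<Longrightarrow> rot m d \<in> A" "\<And>d. d \<in> A \<Longrightarrow> opp m d \<in> A"
    using assms(2) by (auto simp: closed_in_def)
  then have fA: "finite A" using assms(1) finite_subset by (auto simp: premap_def)
  then have "perm_restrict (rot m) A permutes A" "perm_restrict (opp m) A permutes A"
    using A assms(1) by (auto simp: premap_def intro!: perm_restrict_permutes)
  then show ?thesis using A assms(1) fA by (auto simp: premap_def perm_restrict_def)
qed

lemma closed_in_sub: "closed_in (sub m A x) B \<longleftrightarrow> B \<subseteq> A \<and> (\<forall>d\<in>B. rot m d \<in> B \<and> opp m d \<in> B)"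
  by (auto simp: closed_in_def perm_restrict_def subset_iff)

lemma sub_phi:
  assumes "closed_in m A" "d \<in> A"
  shows "face_perm (sub m A x) d = face_perm m d" "face_perm m d \<in> A"
  using assms by (auto simp: face_perm_def perm_restrict_def closed_in_def)

lemma orbit_sub_phi:
  assumes "closed_in m A" "d \<in> A"
  shows "orbit (face_perm (sub m A x)) d = orbit (face_perm m) d"
  using assms by (intro orbit_cong0[of d A]) (auto simp: sub_phi)

lemma map_faces_sub: "closed_in m A \<Longrightarrow> map_faces (sub m A x) = cyc (face_perm m) A"
  by (simp add: map_faces_cyc cyc_def orbit_sub_phi)

lemma map_vertices_sub:
  assumes "closed_in m A"
  shows "map_vertices (sub m A x) = cyc (rot m) A"
proof -
  have "orbit (perm_restrict (rot m) A) d = orbit (rot m) d" if "d \<in> A" for d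
    using assms that by (intro orbit_cong0[of d A]) (auto simp: closed_in_def perm_restrict_def)
  then show ?thesis by (simp add: map_vertices_cyc cyc_def)
qed

lemma root_face_sub: "closed_in m A \<Longrightarrow> x \<in> A \<Longrightarrow> root_face (sub m A x) = orbit (face_perm m) x"
  by (simp add: root_face_orbit orbit_sub_phi)

text \<open>For \<open>x\<close> outside the darts this is empty, so that the part hanging at a leaf
  of the root edge becomes the one-vertex map.\<close>

definition component :: "rooted_map \<Rightarrow> nat \<Rightarrow> nat set" where
  "component m x = {d \<in> darts m. x \<in> darts m \<and> (\<forall>A. closed_in m A \<longrightarrow> x \<in> A \<longrightarrow> d \<in> A)}"

lemma component_minimal: "closed_in m A \<Longrightarrow> x \<in> A \<Longrightarrow> component m x \<subseteq> A"
  by (auto simp: component_def)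

lemma in_component: "x \<in> darts m \<Longrightarrow> x \<in> component m x"
  by (auto simp: component_def)

lemma component_empty: "x \<notin> darts m \<Longrightarrow> component m x = {}"
  by (auto simp: component_def)

lemma closed_in_component: "premap m \<Longrightarrow> closed_in m (component m x)"
  using closed_in_darts[of m] by (auto simp: component_def closed_in_def)

lemma conn_sub_component:
  assumes "premap m"
  shows "connected_map (sub m (component m x) y)"
  unfolding connected_map_def
proof (intro allI impI)
  fix B assume "closed_in (sub m (component m x) y) B"
  then have B: "B \<subseteq> component m x" "closed_in m B"
    using closed_in_component[OF assms, of x] unfolding closed_in_sub by (auto simp: closed_in_def)
  show "B = {} \<or> B = darts (sub m (component m x) y)"
  proof (cases "x \<in> darts m \<and> x \<notin> B")
    case True
    then have "component m x \<subseteq> component m x - B"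
      using closed_in_Diff[OF assms closed_in_component[OF assms] B(2)] in_component by (intro component_minimal) auto
    then show ?thesis using B by auto
  next
    case False
    then show ?thesis using B component_minimal[OF B(2)] component_empty by fastforce
  qed
qed

lemma component_disjoint_or_eq:
  assumes "premap m" "component m x \<inter> component m y \<noteq> {}"
  shows "component m x \<subseteq> component m y"
proof -
  let ?I = "component m x \<inter> component m y"
  have "closed_in m ?I"
    using closed_in_component[OF assms(1), of x] closed_in_component[OF assms(1), of y] by (auto simp: closed_in_def)
  then have "closed_in (sub m (component m x) x) ?I"
    unfolding closed_in_sub by (auto simp: closed_in_def)
  then show ?thesis using conn_sub_component[OF assms(1), of x x] assms(2) unfolding connected_map_def by auto
qed

lemma cyc_Un: "cyc f (A \<union> B) = cyc f A \<union> cyc f B"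
  by (simp add: cyc_def image_Un)

lemma cyc_closed_sub:
  assumes "\<And>d. d \<in> A \<Longrightarrow> f d \<in> A" "C \<in> cyc f A"
  shows "C \<subseteq> A" "C \<noteq> {}"
  using assms orbit_sub[of A f] orbit_nonempty by (fastforce simp: cyc_def)+

lemma cyc_disjoint_closed:
  assumes "\<And>d. d \<in> A \<Longrightarrow> f d \<in> A" "\<And>d. d \<in> B \<Longrightarrow> f d \<in> B" "A \<inter> B = {}"
  shows "cyc f A \<inter> cyc f B = {}"
proof -
  have False if "C \<in> cyc f A" "C \<in> cyc f B" for C
    using cyc_closed_sub[OF assms(1) that(1)] cyc_closed_sub(1)[OF assms(2) that(2)] assms(3) by blast
  then show ?thesis by blast
qed

section \<open>Root edge with the root face on both sides (bridge case)\<close>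

context root_edge
begin

text \<open>The two arcs into which the root edge divides its face: \<open>F1\<close> starts at the
  origin of \<open>s\<close>, \<open>F2\<close> at the origin of \<open>r\<close>. They become the
  root faces of the two parts, and an arc is empty at a leaf.\<close>

abbreviation "F1 \<equiv> orbit cut_perm s - {s}"
abbreviation "F2 \<equiv> orbit cut_perm r - {r}"

text \<open>Here \<open>r\<close> and \<open>s\<close> share a face of \<open>m\<close>, so the
  transposition that relates \<open>cut_perm\<close> to \<open>face_perm m\<close> splits
  it.\<close>

lemma bridge_psi:
  assumes br: "s \<in> Or"
  shows "s \<notin> orbit cut_perm r" "r \<notin> orbit cut_perm s" "Or = orbit cut_perm r \<union> orbit cut_perm s"
    "cyc (face_perm m) D = insert Or (cyc cut_perm D - {orbit cut_perm r, orbit cut_perm s})"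
    "rot m s \<noteq> r" "rot m r \<noteq> s"
proof -
  show r: "r \<notin> orbit cut_perm s" unfolding psi_phi by (rule orbit_split(2)[OF fin face_perm br rs])
  show s: "s \<notin> orbit cut_perm r"
  proof
    assume "s \<in> orbit cut_perm r"
    then have "orbit cut_perm s = orbit cut_perm r" by (rule orbit_eq[OF fin cut_perm])
    then show False using r self_psi by auto
  qed
  show O: "Or = orbit cut_perm r \<union> orbit cut_perm s"
    using orbit_merge(1)[OF fin cut_perm s] by (simp flip: phi_psi)
  show "cyc (face_perm m) D = insert Or (cyc cut_perm D - {orbit cut_perm r, orbit cut_perm s})"
    using cyc_merge[OF fin cut_perm rD sD s] O by (simp flip: phi_psi)
  show "rot m s \<noteq> r"
  proof
    assume "rot m s = r"
    then have "orbit cut_perm r = orbit cut_perm s"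
      using psi_rs(2) orbit_eq[OF fin cut_perm, of r s] orbit.base[of cut_perm s] by simp
    then show False using r self_psi by auto
  qed
  show "rot m r \<noteq> s"
  proof
    assume "rot m r = s"
    then have "orbit cut_perm s = orbit cut_perm r"
      using psi_rs(1) orbit_eq[OF fin cut_perm, of s r] orbit.base[of cut_perm r] by simp
    then show False using s self_psi by auto
  qed
qed

lemma rot_D: "d \<in> D \<Longrightarrow> rot m d \<in> D"
  using rot by (simp add: permutes_in_image)

lemma bridge_F:
  assumes br: "s \<in> Or"
  shows "rot m s \<noteq> s \<Longrightarrow> rot m s \<in> E \<and> rot m s \<in> F1 \<and> orbit (face_perm (del m)) (rot m s) = F1"
    and "rot m s = s \<Longrightarrow> F1 = {}"
    and "rot m r \<noteq> r \<Longrightarrow> rot m r \<in> E \<and> rot m r \<in> F2 \<and> orbit (face_perm (del m)) (rot m r) = F2"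
    and "rot m r = r \<Longrightarrow> F2 = {}"
proof -
  show "rot m s = s \<Longrightarrow> F1 = {}" "rot m r = r \<Longrightarrow> F2 = {}"
    using psi_rs orbit_eq_singleton_iff[of cut_perm s] orbit_eq_singleton_iff[of cut_perm r] by simp_all
  show "rot m s \<in> E \<and> rot m s \<in> F1 \<and> orbit (face_perm (del m)) (rot m s) = F1" if n: "rot m s \<noteq> s"
  proof -
    have E: "rot m s \<in> E" using n bridge_psi(5)[OF br] rot_D[OF sD] by simp
    have o: "rot m s \<in> orbit cut_perm s" using psi_rs(2) orbit.base[of cut_perm s] by simp
    have "orbit (face_perm (del m)) (rot m s) = orbit cut_perm s - {r, s}"
      using orbit_phi_del[OF E] orbit_eq[OF fin cut_perm o] by simp
    then show ?thesis using E o n bridge_psi(2)[OF br] by auto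
  qed
  show "rot m r \<in> E \<and> rot m r \<in> F2 \<and> orbit (face_perm (del m)) (rot m r) = F2" if n: "rot m r \<noteq> r"
  proof -
    have E: "rot m r \<in> E" using n bridge_psi(6)[OF br] rot_D[OF rD] by simp
    have o: "rot m r \<in> orbit cut_perm r" using psi_rs(1) orbit.base[of cut_perm r] by simp
    have "orbit (face_perm (del m)) (rot m r) = orbit cut_perm r - {r, s}"
      using orbit_phi_del[OF E] orbit_eq[OF fin cut_perm o] by simp
    then show ?thesis using E o n bridge_psi(1)[OF br] by auto
  qed
qed

lemma bridge_skip:
  assumes br: "s \<in> Or"
  shows "perm_skip r (rot m) s = rot m s"
proof -
  have "inj (rot m)" using rot permutes_inj by blast
  then show ?thesis using bridge_psi(5)[OF br] rs by (simp add: perm_skip_apply)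
qed

lemma bridge_inner:
  assumes br: "s \<in> Or"
  shows "inner_faces m = cyc (face_perm (del m)) E - {F1, F2}" "F1 \<noteq> {} \<Longrightarrow> F1 \<noteq> F2"
    "F1 \<noteq> {} \<Longrightarrow> F1 \<in> cyc (face_perm (del m)) E" "F2 \<noteq> {} \<Longrightarrow> F2 \<in> cyc (face_perm (del m)) E"
proof -
  define R where "R = cyc cut_perm D - {orbit cut_perm r, orbit cut_perm s}"
  have d: "orbit cut_perm r \<inter> orbit cut_perm s = {}"
    using bridge_psi(1)[OF br] orbit_eq[OF fin cut_perm] self_psi by (metis disjoint_iff)
  have R: "r \<notin> A \<and> s \<notin> A \<and> A \<noteq> {}" if "A \<in> R" for A
    using that cyc_iff_orbit[OF fin cut_perm, of A r] cyc_iff_orbit[OF fin cut_perm, of A s]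
    by (auto simp: R_def cyc_def orbit_nonempty)
  have RF: "A \<noteq> F1 \<and> A \<noteq> F2" if "A \<in> R" for A
  proof -
    obtain z where "z \<in> A" using R[OF \<open>A \<in> R\<close>] by blast
    then have "A = orbit cut_perm z" using that cyc_iff_orbit[OF fin cut_perm, of A z] by (simp add: R_def)
    moreover have "z \<notin> orbit cut_perm r" "z \<notin> orbit cut_perm s"
      using calculation that orbit_eq[OF fin cut_perm, of z] by (auto simp: R_def)
    ultimately show ?thesis using \<open>z \<in> A\<close> by auto
  qed
  have "(\<lambda>A. A - {r, s}) ` R = id ` R" using R by (intro image_cong) auto
  then have im: "(\<lambda>A. A - {r, s}) ` R = R" by simp
  have "cyc cut_perm D = R \<union> {orbit cut_perm r, orbit cut_perm s}" using rD sD by (auto simp: R_def cyc_def)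
  then have "cyc (face_perm (del m)) E = (R \<union> {orbit cut_perm r - {r, s}, orbit cut_perm s - {r, s}}) - {{}}"
    unfolding cyc_phi_del using im by (simp add: image_Un)
  moreover have "orbit cut_perm r - {r, s} = F2" "orbit cut_perm s - {r, s} = F1"
    using bridge_psi(1,2)[OF br] by auto
  ultimately have c: "cyc (face_perm (del m)) E = (R \<union> {F2, F1}) - {{}}" by simp
  have "Or \<notin> R" using R[of Or] self_phi[of r] by argo
  then have "inner_faces m = R"
    using bridge_psi(4)[OF br] by (simp add: R_def inner_faces_def map_faces_cyc root_face_orbit)
  moreover have "R = (R \<union> {F2, F1}) - {{}} - {F1, F2}"
  proof (intro equalityI subsetI)
    fix A assume "A \<in> R"
    then show "A \<in> (R \<union> {F2, F1}) - {{}} - {F1, F2}" using R RF by simp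
  qed auto
  ultimately show "inner_faces m = cyc (face_perm (del m)) E - {F1, F2}" using c by simp
  show "F1 \<noteq> {} \<Longrightarrow> F1 \<noteq> F2" using d by blast
  show "F1 \<noteq> {} \<Longrightarrow> F1 \<in> cyc (face_perm (del m)) E" "F2 \<noteq> {} \<Longrightarrow> F2 \<in> cyc (face_perm (del m)) E"
    using c by auto
qed

text \<open>Only leaves vanish together with the edge. In \<open>bridge\<close> they are counted
  again, as the vertex of a part without darts.\<close>

lemma bridge_vertices:
  assumes br: "s \<in> Or"
  shows "card (map_vertices m) = card (map_vertices (del m)) +
    (if rot m r = r then 1 else 0) + (if rot m s = s then 1 else 0)"
proof -
  have "{A \<in> map_vertices m. A \<subseteq> {r, s}}
    = (if rot m r = r then {{r}} else {}) \<union> (if rot m s = s then {{s}} else {})" (is "?L = ?R")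
  proof (intro equalityI subsetI)
    fix A assume "A \<in> ?L"
    then show "A \<in> ?R" using vertex_small[of A] bridge_psi(5)[OF br] by auto
  next
    fix A assume "A \<in> ?R"
    then have "A = {r} \<and> A = orbit (rot m) r \<or> A = {s} \<and> A = orbit (rot m) s"
      using orbit_eq_singleton_iff[of "rot m" r] orbit_eq_singleton_iff[of "rot m" s]
      by (auto split: if_splits)
    then show "A \<in> ?L" using rD sD by (auto simp: map_vertices_cyc cyc_def)
  qed
  then have "card {A \<in> map_vertices m. A \<subseteq> {r, s}}
    = (if rot m r = r then 1 else 0) + (if rot m s = s then 1 else 0)"
    using rs by auto
  then show ?thesis using vertices_del by simp
qed

lemma del_closed_phi:
  assumes "closed_in (del m) A" "d \<in> A"
  shows "face_perm (del m) d \<in> A" "rot (del m) d \<in> A"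
  using assms closed_in_phi[OF premap_del, of A] unfolding closed_in_def by auto

text \<open>Formulated for arbitrary invariant sets instead of components, so that
  \<open>bridge\<close> serves both for taking a map apart and for gluing two maps, where the two
  sides are given.\<close>

definition "splits D1 D2 \<longleftrightarrow> closed_in (del m) D1 \<and> closed_in (del m) D2 \<and> D1 \<inter> D2 = {} \<and>
  D1 \<union> D2 = E \<and> (if rot m s = s then D1 = {} else rot m s \<in> D1) \<and>
  (if rot m r = r then D2 = {} else rot m r \<in> D2)"

text \<open>The root faces of the two parts become one, hence \<open>num_faces m + 1\<close>; both
  darts of the root edge lie on it, hence \<open>+ 2\<close> in the perimeter.\<close>

lemma bridge:
  assumes br: "s \<in> root_face m" and sp: "splits D1 D2"
  defines "m1 \<equiv> sub (del m) D1 (rot m s)" and "m2 \<equiv> sub (del m) D2 (rot m r)"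
  shows "premap m1" "premap m2" "rooted m1" "rooted m2"
    "num_vertices m = num_vertices m1 + num_vertices m2" "num_faces m + 1 = num_faces m1 + num_faces m2" "card D = card D1 + card D2 + 2"
    "perimeter m = perim m1 + perim m2 + 2" "map_weight q m = map_weight q m1 * map_weight q m2"
    "connected_map m1 \<Longrightarrow> connected_map m2 \<Longrightarrow> connected_map m"
proof -
  have br': "s \<in> Or" using br by (simp add: root_face_orbit)
  have c1: "closed_in (del m) D1" and c2: "closed_in (del m) D2" and dj: "D1 \<inter> D2 = {}"
    and un: "D1 \<union> D2 = E" and x: "if rot m s = s then D1 = {} else rot m s \<in> D1"
    and y: "if rot m r = r then D2 = {} else rot m r \<in> D2"
    using sp unfolding splits_def by blast+
  show "premap m1" "premap m2" using premap_sub[OF premap_del] c1 c2 by (simp_all add: m1_def m2_def)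
  show "rooted m1" "rooted m2" using x y by (auto simp: m1_def m2_def rooted_def split: if_splits)
  have fD: "finite D1" "finite D2" using un fin by (metis finite_Diff finite_Un)+
  show "card D = card D1 + card D2 + 2"
    using card_D card_Un_disjoint[OF fD dj] un by simp
  have rf1: "root_face m1 = F1" if "D1 \<noteq> {}"
    using that x bridge_F(1)[OF br'] root_face_sub[OF c1] by (auto simp: m1_def split: if_splits)
  have rf2: "root_face m2 = F2" if "D2 \<noteq> {}"
    using that y bridge_F(3)[OF br'] root_face_sub[OF c2] by (auto simp: m2_def split: if_splits)
  have i1: "inner_faces m1 = cyc (face_perm (del m)) D1 - {F1}"
    using rf1 map_faces_sub[OF c1] by (cases "D1 = {}") (auto simp: inner_faces_def m1_def cyc_def)
  have i2: "inner_faces m2 = cyc (face_perm (del m)) D2 - {F2}"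
    using rf2 map_faces_sub[OF c2] by (cases "D2 = {}") (auto simp: inner_faces_def m2_def cyc_def)
  have p1: "perim m1 = card F1"
  proof (cases "D1 = {}")
    case True
    then have "rot m s = s" using x by (auto split: if_splits)
    then have "card F1 = 0" using bridge_F(2)[OF br'] by (metis card.empty)
    then show ?thesis using True by (simp add: perim_def m1_def)
  next
    case False
    then show ?thesis using rf1 by (simp add: perim_def perimeter_def m1_def)
  qed
  have p2: "perim m2 = card F2"
  proof (cases "D2 = {}")
    case True
    then have "rot m r = r" using y by (auto split: if_splits)
    then have "card F2 = 0" using bridge_F(4)[OF br'] by (metis card.empty)
    then show ?thesis using True by (simp add: perim_def m2_def)
  next
    case False
    then show ?thesis using rf2 by (simp add: perim_def perimeter_def m2_def)
  qed
  have fP: "finite (orbit cut_perm r)" "finite (orbit cut_perm s)"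
    by (rule finite_orbit[OF self_psi])+
  have "orbit cut_perm r \<inter> orbit cut_perm s = {}"
    using bridge_psi(1)[OF br'] orbit_eq[OF fin cut_perm] self_psi by (metis disjoint_iff)
  then have "card Or = card (orbit cut_perm r) + card (orbit cut_perm s)"
    using card_Un_disjoint[OF fP] bridge_psi(3)[OF br'] by simp
  moreover have "card (orbit cut_perm r) = card F2 + 1" "card (orbit cut_perm s) = card F1 + 1"
    using card_Suc_Diff1[OF fP(1) self_psi] card_Suc_Diff1[OF fP(2) self_psi] by simp_all
  ultimately show "perimeter m = perim m1 + perim m2 + 2"
    using p1 p2 by (simp add: perimeter_def root_face_orbit)
  have F1D: "F1 \<notin> cyc (face_perm (del m)) D2"
  proof
    assume a: "F1 \<in> cyc (face_perm (del m)) D2"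
    have ss: "F1 \<subseteq> D2" "F1 \<noteq> {}"
      using cyc_closed_sub[OF del_closed_phi(1)[OF c2] a] by simp_all
    then have "rot m s \<noteq> s" using bridge_F(2)[OF br'] by metis
    then show False using x bridge_F(1)[OF br'] ss dj by auto
  qed
  have F2D: "F2 \<notin> cyc (face_perm (del m)) D1"
  proof
    assume a: "F2 \<in> cyc (face_perm (del m)) D1"
    have ss: "F2 \<subseteq> D1" "F2 \<noteq> {}"
      using cyc_closed_sub[OF del_closed_phi(1)[OF c1] a] by simp_all
    then have "rot m r \<noteq> r" using bridge_F(4)[OF br'] by metis
    then show False using y bridge_F(3)[OF br'] ss dj by auto
  qed
  have in_eq: "inner_faces m = inner_faces m1 \<union> inner_faces m2"
    unfolding bridge_inner(1)[OF br'] i1 i2 un[symmetric] cyc_Un using F1D F2D by blast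
  have in_dj: "inner_faces m1 \<inter> inner_faces m2 = {}"
    using cyc_disjoint_closed[where f = "face_perm (del m)", OF del_closed_phi(1)[OF c1] del_closed_phi(1)[OF c2] dj]
    unfolding i1 i2 by blast
  have fi: "finite (inner_faces m1)" "finite (inner_faces m2)"
    using fD unfolding i1 i2 by simp_all
  show "num_faces m + 1 = num_faces m1 + num_faces m2"
    unfolding num_faces_def in_eq using card_Un_disjoint[OF fi in_dj] by simp
  show "map_weight q m = map_weight q m1 * map_weight q m2"
    unfolding map_weight_inner in_eq using prod.union_disjoint[OF fi in_dj] by simp
  have "map_vertices (del m) = map_vertices m1 \<union> map_vertices m2"
    using map_vertices_sub[OF c1] map_vertices_sub[OF c2] un
    by (simp only: m1_def m2_def map_vertices_cyc del_simps(1) flip: cyc_Un)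
  moreover have "map_vertices m1 \<inter> map_vertices m2 = {}"
    using cyc_disjoint_closed[where f = "rot (del m)", OF del_closed_phi(2)[OF c1] del_closed_phi(2)[OF c2] dj]
    by (simp only: m1_def m2_def map_vertices_sub[OF c1] map_vertices_sub[OF c2])
  moreover have "finite (map_vertices m1)" "finite (map_vertices m2)"
    using fD by (simp_all add: m1_def m2_def map_vertices_cyc)
  ultimately have v: "card (map_vertices (del m)) = card (map_vertices m1) + card (map_vertices m2)"
    by (simp add: card_Un_disjoint)
  have e1: "D1 = {} \<longleftrightarrow> rot m s = s" and e2: "D2 = {} \<longleftrightarrow> rot m r = r"
    using x y by (auto split: if_splits)
  have n1: "num_vertices m1 = card (map_vertices m1) + (if rot m s = s then 1 else 0)"
    using e1 by (auto simp: num_vertices_def m1_def map_vertices_cyc cyc_def)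
  have n2: "num_vertices m2 = card (map_vertices m2) + (if rot m r = r then 1 else 0)"
    using e2 by (auto simp: num_vertices_def m2_def map_vertices_cyc cyc_def)
  have "num_vertices m = card (map_vertices m)" using rD by (auto simp: num_vertices_def)
  then show "num_vertices m = num_vertices m1 + num_vertices m2" using bridge_vertices[OF br'] v n1 n2 by simp
  show "connected_map m" if "connected_map m1" "connected_map m2"
    unfolding connected_map_def
  proof (intro allI impI)
    fix A assume A: "closed_in m A"
    have AD: "A \<subseteq> D" and rs': "r \<in> A \<longleftrightarrow> s \<in> A" using A opps by (auto simp: closed_in_def)
    have AE: "closed_in (del m) (A - {r, s})" using A by (rule closed_in_del)
    have "closed_in m1 ((A - {r, s}) \<inter> D1)" "closed_in m2 ((A - {r, s}) \<inter> D2)"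
      using AE c1 c2 unfolding m1_def m2_def closed_in_sub
      by (auto simp: closed_in_def simp del: del_simps)
    then have A1: "(A - {r, s}) \<inter> D1 = {} \<or> (A - {r, s}) \<inter> D1 = D1"
      and A2: "(A - {r, s}) \<inter> D2 = {} \<or> (A - {r, s}) \<inter> D2 = D2"
      using that by (simp_all add: connected_map_def m1_def m2_def)
    have ys: "s \<in> A \<longleftrightarrow> rot m s \<in> A" and yr: "r \<in> A \<longleftrightarrow> rot m r \<in> A"
      using closed_in_back(1)[OF pm A, of s] closed_in_back(1)[OF pm A, of r] A
      by (auto simp: closed_in_def)
    have E12: "D1 \<subseteq> E" "D2 \<subseteq> E" using un by auto
    show "A = {} \<or> A = D"
    proof (cases "r \<in> A")
      case True
      then have "rot m s \<in> A" "rot m r \<in> A" using ys yr rs' by auto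
      then have "D1 \<subseteq> A" "D2 \<subseteq> A" using A1 A2 x y E12 by (auto split: if_splits)
      then have "E \<subseteq> A" using un by auto
      then show ?thesis using True rs' AD by auto
    next
      case False
      then have "rot m s \<notin> A" "rot m r \<notin> A" "s \<notin> A" using ys yr rs' by auto
      then have "A \<inter> D1 = {}" "A \<inter> D2 = {}" using A1 A2 x y False by (auto split: if_splits)
      then have "A \<inter> E = {}" using un by auto
      then show ?thesis using False \<open>s \<notin> A\<close> AD by auto
    qed
  qed
qed

end

section \<open>Euler's inequality\<close>

text \<open>The part at the end of the root edge, rooted at the dart that follows the reversed root.
  At a leaf this dart is the reversed root itself, which is deleted, and the part is empty.\<close>

definition left_part :: "rooted_map \<Rightarrow> rooted_map" where
  "left_part m = (let x = rot m (opp m (root_dart m)) in sub (del m) (component (del m) x) x)"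

definition right_part :: "rooted_map \<Rightarrow> rooted_map" where
  "right_part m = (let x = rot m (root_dart m) in sub (del m) (component (del m) x) x)"

context root_edge
begin

abbreviation "C1 \<equiv> component (del m) (rot m s)"
abbreviation "C2 \<equiv> component (del m) (rot m r)"

lemma parts: "left_part m = sub (del m) C1 (rot m s)" "right_part m = sub (del m) C2 (rot m r)"
  by (simp_all add: left_part_def right_part_def Let_def)

lemma C_closed: "closed_in (del m) C1" "closed_in (del m) C2"
  using closed_in_component premap_del by blast+

lemma C_mem:
  assumes "s \<in> Or"
  shows "if rot m s = s then C1 = {} else rot m s \<in> C1"
    "if rot m r = r then C2 = {} else rot m r \<in> C2"
  using bridge_F(1,3)[OF assms] in_component[of "rot m s" "del m"] in_component[of "rot m r" "del m"]
    component_empty[of "rot m s" "del m"] component_empty[of "rot m r" "del m"]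
  by (simp_all del: Diff_iff) auto

text \<open>The darts outside both components avoid \<open>F1\<close> and \<open>F2\<close>, so
  \<open>m\<close> and \<open>del m\<close> have the same face permutation there. They form an
  invariant set of \<open>m\<close> without \<open>r\<close>, which must be empty.\<close>

lemma C_Un:
  assumes br: "s \<in> Or" and c: "connected_map m"
  shows "C1 \<union> C2 = E"
proof -
  define B where "B = E - (C1 \<union> C2)"
  have "closed_in (del m) (E - C1)"
    using closed_in_Diff[OF premap_del closed_in_darts[OF premap_del] C_closed(1)] by simp
  then have "closed_in (del m) (E - C1 - C2)"
    using closed_in_Diff[OF premap_del _ C_closed(2)] by simp
  moreover have "E - C1 - C2 = B" by (auto simp: B_def)
  ultimately have B: "closed_in (del m) B" by simp
  have BF: "d \<notin> orbit cut_perm s \<union> orbit cut_perm r" if "d \<in> B" for d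
  proof
    assume d: "d \<in> orbit cut_perm s \<union> orbit cut_perm r"
    have drs: "d \<noteq> r" "d \<noteq> s" using that by (auto simp: B_def)
    then have "d \<in> F1 \<or> d \<in> F2" using d by auto
    then show False
    proof
      assume d1: "d \<in> F1"
      then have n: "rot m s \<noteq> s" using bridge_F(2)[OF br] by auto
      then have "F1 \<subseteq> C1"
        using bridge_F(1)[OF br n] C_mem(1)[OF br] closed_in_orbit(1)[OF premap_del C_closed(1), of "rot m s"]
        by simp
      then show False using d1 that by (auto simp: B_def)
    next
      assume d2: "d \<in> F2"
      then have n: "rot m r \<noteq> r" using bridge_F(4)[OF br] by auto
      then have "F2 \<subseteq> C2"
        using bridge_F(3)[OF br n] C_mem(2)[OF br] closed_in_orbit(1)[OF premap_del C_closed(2), of "rot m r"]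
        by simp
      then show False using d2 that by (auto simp: B_def)
    qed
  qed
  have inj: "inj cut_perm" "inj (perm_skip r cut_perm)"
    using cut_perm permutes_inj unfolding perm_skip_def by (auto intro!: inj_compose)
  have "face_perm m d \<in> B \<and> opp m d \<in> B" if d: "d \<in> B" for d
  proof -
    have dE: "d \<in> E" using d by (simp add: B_def)
    have "face_perm (del m) d \<in> B" "opp (del m) d \<in> B"
      using B d closed_in_phi[OF premap_del, of B] by (auto simp del: del_simps)
    moreover have "opp (del m) d = opp m d" using dE by (rule opp_del)
    moreover have "cut_perm d = face_perm m d" using dE by (simp add: psi_phi)
    moreover have "cut_perm d \<noteq> r" "cut_perm d \<noteq> s"
    proof -
      have o: "orbit cut_perm (cut_perm d) = orbit cut_perm d" using orbit_eq[OF fin cut_perm] orbit.base by metis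
      have "d \<in> orbit cut_perm d" by (rule self_psi)
      then have "d \<in> orbit cut_perm (cut_perm d)" using o by simp
      then show "cut_perm d \<noteq> r" "cut_perm d \<noteq> s" using BF[OF d] by auto
    qed
    then have "face_perm (del m) d = cut_perm d"
      using dE inj by (simp add: phi_del perm_skip_apply)
    ultimately show ?thesis by simp
  qed
  moreover have "B \<subseteq> D" by (auto simp: B_def)
  ultimately have "closed_in m B" using closed_in_phi[OF pm] by blast
  then have "B = {} \<or> B = D" using c by (simp add: connected_map_def)
  moreover have "r \<notin> B" by (simp add: B_def)
  ultimately have "B = {}" using rD by auto
  moreover have "C1 \<subseteq> E" "C2 \<subseteq> E" using C_closed by (simp_all add: closed_in_def)
  ultimately show ?thesis by (auto simp: B_def)
qed

lemma bridge_splits: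
  assumes br: "s \<in> Or" and c: "connected_map m" and dj: "C1 \<inter> C2 = {}"
  shows "splits C1 C2"
  using C_closed C_mem[OF br] C_Un[OF br c] dj unfolding splits_def by blast

text \<open>The case of positive genus: the edge has one face on both sides, yet its deletion does
  not disconnect. The root face then splits into the root face \<open>F1\<close> and a new inner
  face \<open>F2\<close>.\<close>

lemma bridge_overlap:
  assumes br: "s \<in> Or" and c: "connected_map m" and ov: "C1 \<inter> C2 \<noteq> {}"
  shows "cmap (del m)" "num_vertices (del m) = num_vertices m" "num_faces (del m) = num_faces m + 1"
proof -
  have "C1 \<subseteq> C2" "C2 \<subseteq> C1"
    using component_disjoint_or_eq[OF premap_del] ov by (simp_all add: Int_commute)
  then have C: "C1 = E" "C2 = E" using C_Un[OF br c] by auto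
  have E: "E \<noteq> {}" using ov C by auto
  then have n: "rot m s \<noteq> s" "rot m r \<noteq> r" using C_mem[OF br] C by (auto split: if_splits)
  have root: "root_dart (del m) = rot m s" using bridge_skip[OF br] by simp
  have "connected_map (sub (del m) E (rot m s))"
    using conn_sub_component[OF premap_del, of "rot m s" "rot m s"] C by simp
  then have "connected_map (del m)"
    unfolding connected_map_def closed_in_sub sub_simps del_simps(1) by (auto simp: closed_in_def)
  then show "cmap (del m)"
    using premap_del bridge_F(1)[OF br n(1)] root by (simp add: cmap_def rooted_def)
  have "card (map_vertices m) = card (map_vertices (del m))"
    using bridge_vertices[OF br] n by simp
  then show "num_vertices (del m) = num_vertices m" using E rD by (auto simp: num_vertices_def)
  have F: "F1 \<noteq> {}" "F2 \<noteq> {}" using bridge_F(1,3)[OF br] n by auto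
  let ?c = "cyc (face_perm (del m)) E"
  have "inner_faces (del m) = ?c - {F1}"
    unfolding inner_faces_def map_faces_cyc root_face_orbit root del_simps(1)
    using bridge_F(1)[OF br n(1)] by simp
  also have "\<dots> = insert F2 (?c - {F1, F2})"
    using bridge_inner(2-4)[OF br] F by auto
  also have "\<dots> = insert F2 (inner_faces m)" using bridge_inner(1)[OF br] by simp
  finally have "inner_faces (del m) = insert F2 (inner_faces m)" .
  moreover have "F2 \<notin> inner_faces m" "finite (inner_faces m)"
    using bridge_inner(1)[OF br] fin by simp_all
  ultimately show "num_faces (del m) = num_faces m + 1" by (simp add: num_faces_def)
qed

end

lemma cmap_empty:
  assumes "darts m = {}" shows "num_vertices m = 1" "num_faces m = 1" "perim m = 0" "map_weight q m = 1" "connected_map m" "rooted m"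
  using assms by (auto simp: num_vertices_def num_faces_def inner_faces_def map_faces_def perim_def map_weight_def
    connected_map_def closed_in_def rooted_def)

lemma root_edgeI: "cmap m \<Longrightarrow> darts m \<noteq> {} \<Longrightarrow> root_edge m"
  by (simp add: root_edge_def cmap_def rooted_def)

text \<open>Induction on the number of darts by deleting the root edge. A chord lowers both sides by
  2, and two parts add up exactly; only an overlap makes the inequality strict.\<close>

lemma genus:
  assumes "cmap m"
  shows "2 * (num_vertices m + num_faces m) \<le> card (darts m) + 4"
  using assms
proof (induction "card (darts m)" arbitrary: m rule: less_induct)
  case less
  show ?case
  proof (cases "darts m = {}")
    case True
    then show ?thesis using cmap_empty[OF True] by simp
  next
    case False
    interpret root_edge m using less.prems False by (rule root_edgeI)
    have c: "connected_map m" using less.prems by (simp add: cmap_def)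
    show ?thesis
    proof (cases "s \<in> root_face m")
      case br: True
      then have br': "s \<in> Or" by (simp add: root_face_orbit)
      show ?thesis
      proof (cases "C1 \<inter> C2 = {}")
        case True
        note b = bridge[OF br bridge_splits[OF br' c True], folded parts]
        have "cmap (left_part m)" "cmap (right_part m)"
          using b conn_sub_component[OF premap_del] by (simp_all add: cmap_def parts)
        moreover have "card (darts (left_part m)) = card C1" "card (darts (right_part m)) = card C2"
          by (simp_all add: parts)
        ultimately have "2 * (num_vertices (left_part m) + num_faces (left_part m)) \<le> card C1 + 4"
          "2 * (num_vertices (right_part m) + num_faces (right_part m)) \<le> card C2 + 4"
          using less.hyps[of "left_part m"] less.hyps[of "right_part m"] b(7) by simp_all
        then show ?thesis using b(5,6,7) by simp
      next
        case False
        note o = bridge_overlap[OF br' c False]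
        have "2 * (num_vertices (del m) + num_faces (del m)) \<le> card (darts (del m)) + 4"
          using o(1) card_D by (intro less.hyps) auto
        then show ?thesis using o card_D by simp
      qed
    next
      case nb: False
      then have nb': "s \<notin> Or" by (simp add: root_face_orbit)
      note ne = chord_root_del[OF nb' c]
      have "cmap (del m)"
        using premap_del chord(1)[OF nb ne] chord_conn_del[OF nb' c] by (simp add: cmap_def)
      then have "2 * (num_vertices (del m) + num_faces (del m)) \<le> card (darts (del m)) + 4"
        using card_D by (intro less.hyps) auto
      then show ?thesis using chord(2)[OF nb ne] chord_num_vertices[OF nb ne] card_D by simp
    qed
  qed
qed

lemma sphere_chord:
  assumes m: "sphere m" "darts m \<noteq> {}" and nb: "opp m (root_dart m) \<notin> root_face m"
  shows "sphere (del m)"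
proof -
  interpret root_edge m using m by (intro root_edgeI) (auto simp: sphere_def)
  have c: "connected_map m" using m by (simp add: sphere_def cmap_def)
  have nb': "s \<notin> Or" using nb by (simp add: root_face_orbit)
  note ne = chord_root_del[OF nb' c]
  have "cmap (del m)"
    using premap_del chord(1)[OF nb ne] chord_conn_del[OF nb' c] by (simp add: cmap_def)
  then show ?thesis
    using m(1) chord(2)[OF nb ne] chord_num_vertices[OF nb ne] card_D by (simp add: sphere_def)
qed

lemma sphere_bridge:
  assumes m: "sphere m" "darts m \<noteq> {}" and br: "opp m (root_dart m) \<in> root_face m"
  shows "sphere (left_part m)" "sphere (right_part m)"
    "root_edge.splits m (darts (left_part m)) (darts (right_part m))"
proof -
  interpret root_edge m using m by (intro root_edgeI) (auto simp: sphere_def)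
  have c: "connected_map m" using m by (simp add: sphere_def cmap_def)
  have br': "s \<in> Or" using br by (simp add: root_face_orbit)
  have dj: "C1 \<inter> C2 = {}"
  proof (rule ccontr)
    assume "C1 \<inter> C2 \<noteq> {}"
    note o = bridge_overlap[OF br' c this]
    \<comment> \<open>After an overlap, twice the number of vertices and faces has grown by 2 while
      the number of darts has dropped by 2; starting from equality this violates
      \<open>genus\<close>.\<close>
    then show False using genus[OF o(1)] m(1) card_D by (simp add: sphere_def)
  qed
  note sp = bridge_splits[OF br' c dj]
  then show "splits (darts (left_part m)) (darts (right_part m))" by (simp add: parts)
  note b = bridge[OF br sp, folded parts]
  have cm: "cmap (left_part m)" "cmap (right_part m)"
    using b conn_sub_component[OF premap_del] by (simp_all add: cmap_def parts)
  have d: "darts (left_part m) = C1" "darts (right_part m) = C2" by (simp_all add: parts)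
  \<comment> \<open>Equality for \<open>m\<close> makes the sum of the two inequalities an equality,
    so each of them is one.\<close>
  show "sphere (left_part m)" "sphere (right_part m)"
    using cm genus[OF cm(1)] genus[OF cm(2)] b(5,6,7) m(1) d by (auto simp: sphere_def)
qed

section \<open>Encoding maps by trees\<close>

text \<open>\<open>Chord p t\<close>: the root edge separates two faces, the root face having degree \<open>p\<close>. \<open>Bridge t u\<close>:
  the root edge has the root face on both sides and joins two maps.\<close>

datatype mtree = Vertex | Chord nat mtree | Bridge mtree mtree

primrec tree_perimeter :: "mtree \<Rightarrow> nat" where
  "tree_perimeter Vertex = 0"
| "tree_perimeter (Chord p t) = p"
| "tree_perimeter (Bridge t u) = tree_perimeter t + tree_perimeter u + 2"

text \<open>The upper bound on \<open>p\<close> says that the face cut off has degree at least 1,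
  and makes the subtraction in \<open>tree_weight\<close> exact.\<close>

primrec tree_valid :: "mtree \<Rightarrow> bool" where
  "tree_valid Vertex = True"
| "tree_valid (Chord p t) = (tree_valid t \<and> 1 \<le> p \<and> p \<le> tree_perimeter t + 1)"
| "tree_valid (Bridge t u) = (tree_valid t \<and> tree_valid u)"

primrec tree_vertices :: "mtree \<Rightarrow> nat" where
  "tree_vertices Vertex = 1"
| "tree_vertices (Chord p t) = tree_vertices t"
| "tree_vertices (Bridge t u) = tree_vertices t + tree_vertices u"

primrec tree_weight :: "(nat \<Rightarrow> real) \<Rightarrow> mtree \<Rightarrow> real" where
  "tree_weight q Vertex = 1"
| "tree_weight q (Chord p t) = q (tree_perimeter t + 2 - p) * tree_weight q t"
| "tree_weight q (Bridge t u) = tree_weight q t * tree_weight q u"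

text \<open>A relation, because the deletion recursion is well-founded only on maps with finitely
  many darts. Existence for spheres is \<open>sphere_codes\<close>, uniqueness is
  \<open>codes_unique\<close>.\<close>

inductive codes :: "rooted_map \<Rightarrow> mtree \<Rightarrow> bool" where
  codes_Vertex: "darts m = {} \<Longrightarrow> codes m Vertex"
| codes_Chord: "darts m \<noteq> {} \<Longrightarrow> opp m (root_dart m) \<notin> root_face m \<Longrightarrow> codes (del m) t \<Longrightarrow>
    codes m (Chord (perimeter m) t)"
| codes_Bridge: "darts m \<noteq> {} \<Longrightarrow> opp m (root_dart m) \<in> root_face m \<Longrightarrow> codes (left_part m) t \<Longrightarrow>
    codes (right_part m) u \<Longrightarrow> codes m (Bridge t u)"

inductive_cases codes_VertexE: "codes m Vertex"
inductive_cases codes_ChordE: "codes m (Chord p t)"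
inductive_cases codes_BridgeE: "codes m (Bridge t u)"

lemma codes_empty_iff: "codes m t \<Longrightarrow> darts m = {} \<longleftrightarrow> t = Vertex"
  by (auto elim: codes.cases)

lemma codes_unique: "codes m t \<Longrightarrow> codes m t' \<Longrightarrow> t = t'"
proof (induction arbitrary: t' rule: codes.induct)
  case (codes_Vertex m)
  then show ?case using codes_empty_iff[of m t'] by simp
next
  case (codes_Chord m t)
  note IH = codes_Chord.IH and hyps = codes_Chord.hyps
  from codes_Chord.prems show ?case
  proof (cases rule: codes.cases)
    case (codes_Chord t2)
    then show ?thesis using IH[of t2] by simp
  qed (use hyps in simp_all)
next
  case (codes_Bridge m t u)
  note IH = codes_Bridge.IH and hyps = codes_Bridge.hyps
  from codes_Bridge.prems show ?case
  proof (cases rule: codes.cases)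
    case (codes_Bridge t2 u2)
    then show ?thesis using IH(1)[of t2] IH(2)[of u2] by simp
  qed (use hyps in simp_all)
qed

lemma sphere_root_edge: "sphere m \<Longrightarrow> darts m \<noteq> {} \<Longrightarrow> root_edge m"
  by (intro root_edgeI) (auto simp: sphere_def)

lemma sphere_conn: "sphere m \<Longrightarrow> connected_map m"
  by (simp add: sphere_def cmap_def)

lemma sphere_premap: "sphere m \<Longrightarrow> premap m"
  by (simp add: sphere_def cmap_def)

lemma sphere_codes:
  assumes "sphere m"
  shows "\<exists>t. codes m t \<and> tree_valid t \<and> tree_perimeter t = perim m \<and> tree_vertices t = num_vertices m \<and> (\<forall>q. tree_weight q t = map_weight q m)"
  using assms
proof (induction "card (darts m)" arbitrary: m rule: less_induct)
  case less
  show ?case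
  proof (cases "darts m = {}")
    case True
    then show ?thesis
      using cmap_empty[OF True] by (intro exI[of _ Vertex]) (auto intro: codes_Vertex)
  next
    case False
    interpret root_edge m using less.prems False by (rule sphere_root_edge)
    show ?thesis
    proof (cases "s \<in> root_face m")
      case br: True
      note sp = sphere_bridge[OF less.prems False br]
      have ca: "card (darts (left_part m)) < card (darts m)" "card (darts (right_part m)) < card (darts m)"
        using bridge(7)[OF br sp(3)] by simp_all
      obtain t where t: "codes (left_part m) t" "tree_valid t" "tree_perimeter t = perim (left_part m)"
        "tree_vertices t = num_vertices (left_part m)" "\<And>q. tree_weight q t = map_weight q (left_part m)"
        using less.hyps[OF ca(1) sp(1)] by blast
      obtain u where u: "codes (right_part m) u" "tree_valid u" "tree_perimeter u = perim (right_part m)"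
        "tree_vertices u = num_vertices (right_part m)" "\<And>q. tree_weight q u = map_weight q (right_part m)"
        using less.hyps[OF ca(2) sp(2)] by blast
      have d: "darts (left_part m) = C1" "darts (right_part m) = C2" by (simp_all add: parts)
      note b = bridge[OF br sp(3), unfolded d, folded parts]
      have "codes m (Bridge t u)" by (rule codes_Bridge[OF False br t(1) u(1)])
      then show ?thesis using t u b(5,8,9) False
        by (intro exI[of _ "Bridge t u"]) (auto simp: perim_def)
    next
      case nb: False
      then have nb': "s \<notin> Or" by (simp add: root_face_orbit)
      note ne = chord_root_del[OF nb' sphere_conn[OF less.prems]]
      obtain t where t: "codes (del m) t" "tree_valid t" "tree_perimeter t = perim (del m)"
        "tree_vertices t = num_vertices (del m)" "\<And>q. tree_weight q t = map_weight q (del m)"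
        using less.hyps[OF _ sphere_chord[OF less.prems False nb]] card_D by auto
      have "codes m (Chord (perimeter m) t)" by (rule codes_Chord[OF False nb t(1)])
      then show ?thesis using t chord[OF nb ne] chord_num_vertices[OF nb ne] False
        by (intro exI[of _ "Chord (perimeter m) t"]) (auto simp: perim_def)
    qed
  qed
qed

lemma codes_sphere:
  assumes "sphere m" "codes m t"
  shows "tree_valid t" "tree_perimeter t = perim m" "tree_vertices t = num_vertices m" "tree_weight q t = map_weight q m"
  using sphere_codes[OF assms(1)] codes_unique[OF assms(2)] by blast+

section \<open>Invariance of the code under isomorphism\<close>

lemma perm_skip_conj:
  assumes "inj f" "inj g" "inj_on h D" "x \<in> D" "d \<in> D" "\<And>e. e \<in> D \<Longrightarrow> f e \<in> D"
    "\<And>e. e \<in> D \<Longrightarrow> h (f e) = g (h e)"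
  shows "h (perm_skip x f d) = perm_skip (h x) g (h d)"
proof (cases "d = x")
  case False
  have "f d = x \<longleftrightarrow> g (h d) = h x"
    using assms inj_onD[OF assms(3), of "f d" x] by metis
  moreover have "h d \<noteq> h x" using False assms inj_onD by metis
  ultimately show ?thesis
    using False assms(4-7) by (simp add: perm_skip_apply[OF assms(1)] perm_skip_apply[OF assms(2)])
qed simp

lemma perm_skip_undo:
  assumes "inj f" "d \<noteq> x"
  shows "f d = (if perm_skip x f d = f x then x else perm_skip x f d)"
  using assms by (auto simp: perm_skip_apply inj_eq)

text \<open>A permutation is determined by \<open>perm_skip x f\<close> and the single value
  \<open>f x\<close>, the place where \<open>x\<close> has to be put back; hence a conjugation of
  these data conjugates the permutations.\<close>

lemma perm_skip_conj_back:
  assumes "inj f" "inj g" "inj_on h D" "x \<in> D" "d \<in> D" "\<And>e. e \<in> D \<Longrightarrow> f e \<in> D"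
    "h (perm_skip x f d) = perm_skip (h x) g (h d)" "h (f x) = g (h x)" "perm_skip x f d \<in> D"
  shows "h (f d) = g (h d)"
proof (cases "d = x")
  case False
  then have "h d \<noteq> h x" using assms inj_onD by metis
  moreover have "perm_skip x f d = f x \<longleftrightarrow> perm_skip (h x) g (h d) = g (h x)"
    using assms inj_onD[OF assms(3), of "perm_skip x f d" "f x"] by metis
  ultimately show ?thesis
    using perm_skip_undo[OF assms(1) False] perm_skip_undo[OF assms(2), of "h d" "h x"] assms(7) by simp
qed (use assms in simp)

lemma premap_closed:
  assumes "premap m" "d \<in> darts m"
  shows "rot m d \<in> darts m" "opp m d \<in> darts m" "face_perm m d \<in> darts m"
  using assms by (auto simp: premap_def face_perm_def permutes_in_image)

lemma map_iso_inj:
  assumes "map_iso h m m'"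
  shows "inj_on h (darts m)" "h ` darts m = darts m'" "h (root_dart m) = root_dart m'"
    "\<And>d. d \<in> darts m \<Longrightarrow> h (rot m d) = rot m' (h d)"
    "\<And>d. d \<in> darts m \<Longrightarrow> h (opp m d) = opp m' (h d)"
  using assms by (auto simp: map_iso_def bij_betw_def)

lemma map_iso_phi:
  assumes "map_iso h m m'" "premap m" "d \<in> darts m"
  shows "h (face_perm m d) = face_perm m' (h d)"
  using map_iso_inj[OF assms(1)] premap_closed[OF assms(2)] assms(3) by (simp add: face_perm_def)

lemma map_iso_root_face:
  assumes "map_iso h m m'" "premap m" "root_dart m \<in> darts m"
  shows "h ` root_face m = root_face m'" "root_face m \<subseteq> darts m"
proof -
  note o = orbit_image_conj[of "darts m" "face_perm m" h "face_perm m'" "root_dart m"]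
  show "h ` root_face m = root_face m'" "root_face m \<subseteq> darts m"
    unfolding root_face_orbit
    using o premap_closed(3)[OF assms(2)] map_iso_phi[OF assms(1,2)] map_iso_inj(3)[OF assms(1)] assms(3)
    by auto
qed

lemma map_iso_perimeter:
  assumes "map_iso h m m'" "premap m" "root_dart m \<in> darts m"
  shows "perimeter m' = perimeter m"
    "opp m' (root_dart m') \<in> root_face m' \<longleftrightarrow> opp m (root_dart m) \<in> root_face m"
proof -
  note rf = map_iso_root_face[OF assms]
  have inj: "inj_on h (root_face m)" using rf(2) map_iso_inj(1)[OF assms(1)] inj_on_subset by blast
  show "perimeter m' = perimeter m" unfolding perimeter_def rf(1)[symmetric] by (rule card_image[OF inj])
  have "opp m' (root_dart m') = h (opp m (root_dart m))"
    using map_iso_inj[OF assms(1)] assms(3) by simp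
  then show "opp m' (root_dart m') \<in> root_face m' \<longleftrightarrow> opp m (root_dart m) \<in> root_face m"
    using rf inj_on_image_mem_iff[OF map_iso_inj(1)[OF assms(1)] premap_closed(2)[OF assms(2,3)] rf(2)]
    by simp
qed

lemma map_iso_del:
  assumes h: "map_iso h m m'" and m: "root_edge m" and m': "root_edge m'"
  shows "map_iso h (del m) (del m')"
proof -
  interpret A: root_edge m by fact
  interpret B: root_edge m' by fact
  note i = map_iso_inj[OF h]
  have s: "h A.s = B.s" using i(3) i(5)[OF A.rD] by simp
  have ri: "inj (rot m)" "inj (rot m')" using A.rot B.rot permutes_inj by blast+
  have 1: "h (perm_skip A.r (rot m) d) = perm_skip B.r (rot m') (h d)" if "d \<in> A.D" for d
    using perm_skip_conj[OF ri i(1) A.rD that A.rot_D i(4)] i(3) by simp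
  have ri2: "inj (perm_skip A.r (rot m))" "inj (perm_skip B.r (rot m'))"
    using ri unfolding perm_skip_def by (auto intro!: inj_compose)
  have cl: "perm_skip A.r (rot m) d \<in> A.D" if "d \<in> A.D" for d
    using that A.rot_D A.rD ri(1) by (cases "d = A.r") (auto simp: perm_skip_apply)
  have 2: "h (perm_skip A.s (perm_skip A.r (rot m)) d) = perm_skip B.s (perm_skip B.r (rot m')) (h d)" if "d \<in> A.D" for d
    using perm_skip_conj[OF ri2 i(1) A.sD that cl 1] s by simp
  have E: "h ` A.E = B.E"
    using inj_on_image_set_diff[OF i(1), of A.D "{A.r, A.s}"] i(2,3) s A.rD A.sD by simp
  have "h (opp (del m) d) = opp (del m') (h d)" if "d \<in> A.E" for d
  proof -
    have "h d \<in> B.E" using E that by blast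
    then show ?thesis using A.opp_del[OF that] B.opp_del i(5)[of d] that by simp
  qed
  moreover have "inj_on h A.E" using i(1) inj_on_subset by blast
  ultimately show ?thesis
    unfolding map_iso_def bij_betw_def A.del_simps(1,2,4) B.del_simps(1,2,4)
    using E 2 1[OF A.sD] s by auto
qed

lemma map_iso_component:
  assumes h: "map_iso h m m'" and m: "premap m" and x: "x \<in> darts m"
  shows "h ` component m x = component m' (h x)"
proof -
  note i = map_iso_inj[OF h]
  have img: "closed_in m' (h ` A)" if A: "closed_in m A" for A
    using A i unfolding closed_in_def by (auto simp: subset_iff) (metis image_eqI)+
  have pre: "closed_in m {d \<in> darts m. h d \<in> B}" if "closed_in m' B" for B
    using that i(4,5) premap_closed[OF m] unfolding closed_in_def by auto
  show ?thesis
  proof (intro equalityI subsetI)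
    fix e assume "e \<in> h ` component m x"
    then obtain d where d: "d \<in> component m x" "e = h d" by blast
    have "e \<in> B" if "closed_in m' B" "h x \<in> B" for B
      using component_minimal[OF pre[OF that(1)], of x] that(2) x d by auto
    moreover have "e \<in> darts m'" "h x \<in> darts m'" using d i(2) x by (auto simp: component_def)
    ultimately show "e \<in> component m' (h x)" by (auto simp: component_def)
  next
    fix e assume e: "e \<in> component m' (h x)"
    then have "e \<in> darts m'" by (simp add: component_def)
    then obtain d where d: "d \<in> darts m" "e = h d" using i(2) by blast
    have "d \<in> A" if A: "closed_in m A" "x \<in> A" for A
    proof -
      have "h d \<in> h ` A" using component_minimal[OF img[OF A(1)], of "h x"] A(2) e d by auto
      then show ?thesis
        using inj_on_image_mem_iff[OF i(1) d(1)] A(1) by (simp add: closed_in_def)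
    qed
    then show "e \<in> h ` component m x" using d x by (auto simp: component_def)
  qed
qed

lemma map_iso_sub:
  assumes h: "map_iso h m m'" and A: "closed_in m A"
  shows "map_iso h (sub m A x) (sub m' (h ` A) (h x))"
  using map_iso_inj[OF h] A inj_on_subset[of h "darts m" A]
  by (auto simp: map_iso_def bij_betw_def perm_restrict_def closed_in_def subset_iff)

lemma map_iso_parts:
  assumes h: "map_iso h m m'" and m: "root_edge m" and m': "root_edge m'"
  shows "map_iso h (left_part m) (left_part m')" "map_iso h (right_part m) (right_part m')"
proof -
  interpret A: root_edge m by fact
  interpret B: root_edge m' by fact
  note i = map_iso_inj[OF h] and d = map_iso_del[OF h m m']
  have s: "h A.s = B.s" using i(3) i(5)[OF A.rD] by simp
  have *: "map_iso h (sub (del m) (component (del m) x) x) (sub (del m') (component (del m') (h x)) (h x))"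
    if x: "x \<in> A.D" for x
  proof -
    have "h ` component (del m) x = component (del m') (h x)"
    proof (cases "x \<in> A.E")
      case True
      then show ?thesis using map_iso_component[OF d A.premap_del, of x] by simp
    next
      case False
      then have "h x \<notin> B.E" using x i(3) s by auto
      then have "component (del m) x = {}" "component (del m') (h x) = {}"
        using False by (auto intro!: component_empty)
      then show ?thesis by simp
    qed
    then show ?thesis using map_iso_sub[OF d closed_in_component[OF A.premap_del], of x x] by simp
  qed
  have "h (rot m A.s) = rot m' B.s" "h (rot m A.r) = rot m' B.r"
    using i(3) i(4)[OF A.sD] i(4)[OF A.rD] s by simp_all
  then show "map_iso h (left_part m) (left_part m')" "map_iso h (right_part m) (right_part m')"
    using *[OF A.rot_D[OF A.sD]] *[OF A.rot_D[OF A.rD]] by (simp_all only: A.parts B.parts)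
qed

lemma codes_iso:
  assumes "codes m t" "sphere m" "sphere m'" "map_iso h m m'"
  shows "codes m' t"
  using assms
proof (induction arbitrary: m' rule: codes.induct)
  case (codes_Vertex m)
  then have "darts m' = {}" using map_iso_inj(2) by blast
  then show ?case by (rule codes.codes_Vertex)
next
  case (codes_Chord m t)
  have ne': "darts m' \<noteq> {}" using codes_Chord map_iso_inj(2) by blast
  have re: "root_edge m" "root_edge m'" using codes_Chord ne' sphere_root_edge by blast+
  note p = map_iso_perimeter[OF codes_Chord.prems(3) sphere_premap[OF codes_Chord.prems(1)] root_edge.rD[OF re(1)]]
  have nb': "opp m' (root_dart m') \<notin> root_face m'" using p codes_Chord by blast
  have "codes (del m') t"
    using codes_Chord.IH sphere_chord[OF codes_Chord.prems(1) codes_Chord.hyps(1,2)]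
      sphere_chord[OF codes_Chord.prems(2) ne' nb'] map_iso_del[OF codes_Chord.prems(3) re] by blast
  then show ?case using codes.codes_Chord[OF ne' nb'] p(1) by simp
next
  case (codes_Bridge m t u)
  have ne': "darts m' \<noteq> {}" using codes_Bridge map_iso_inj(2) by blast
  have re: "root_edge m" "root_edge m'" using codes_Bridge ne' sphere_root_edge by blast+
  note p = map_iso_perimeter[OF codes_Bridge.prems(3) sphere_premap[OF codes_Bridge.prems(1)] root_edge.rD[OF re(1)]]
  have br': "opp m' (root_dart m') \<in> root_face m'" using p codes_Bridge by blast
  note sp = sphere_bridge[OF codes_Bridge.prems(1) codes_Bridge.hyps(1,2)]
    and sp' = sphere_bridge[OF codes_Bridge.prems(2) ne' br']
    and mp = map_iso_parts[OF codes_Bridge.prems(3) re]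
  show ?case
    by (rule codes.codes_Bridge[OF ne' br'])
      (rule codes_Bridge.IH(1)[OF sp(1) sp'(1) mp(1)] codes_Bridge.IH(2)[OF sp(2) sp'(2) mp(2)])+
qed

section \<open>Maps with the same code are isomorphic\<close>

lemma funpow_skip:
  assumes "inj f" "\<And>i. i < n \<Longrightarrow> (f ^^ i) a \<noteq> x" "i < n"
  shows "(perm_skip x f ^^ i) a = (f ^^ i) a"
  using assms(3)
proof (induction i)
  case (Suc i)
  then show ?case using assms(2)[of i] assms(2)[of "Suc i"] by (simp add: perm_skip_apply[OF assms(1)])
qed simp

lemma funpow_skip_hit:
  assumes "inj f" "\<And>i. i < n \<Longrightarrow> (f ^^ i) a \<noteq> x" "(f ^^ n) a = x" "0 < n"
  shows "(perm_skip x f ^^ n) a = f x"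
proof -
  obtain k where n: "n = Suc k" using assms(4) gr0_implies_Suc by blast
  have "(perm_skip x f ^^ k) a = (f ^^ k) a" using n by (intro funpow_skip[OF assms(1,2)]) auto
  then show ?thesis using n assms(2)[of k] assms(3) by (simp add: perm_skip_apply[OF assms(1)])
qed

context root_edge
begin

text \<open>The perimeter stored in a \<open>Chord\<close> node locates the root: after deletion of
  \<open>r\<close> alone, \<open>perimeter m\<close> steps along the face from the half-edge
  \<open>s\<close> lead to the dart before which \<open>r\<close> was inserted.\<close>

lemma chord_rot_root:
  assumes nb: "s \<notin> Or"
  shows "rot m r = ((perm_skip r (rot m) \<circ> opp (del m)) ^^ perimeter m) s"
proof -
  have rs': "r \<in> orbit cut_perm s" using chord_psi(2)[OF nb] self_phi[of r] by simp
  let ?n = "funpow_dist1 cut_perm s r"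
  \<comment> \<open>Read backwards, the root edge splits the merged face of \<open>cut_perm\<close>.
    The stretch after \<open>s\<close> up to \<open>r\<close> is the root face, so its length is the
    perimeter.\<close>
  have "cut_perm \<circ> Transposition.transpose s r = face_perm m"
    using phi_psi by (simp add: transpose_commute)
  then have "card Or = ?n" using orbit_split(3)[OF fin cut_perm rs'] rs by simp
  then have n: "perimeter m = ?n" by (simp add: perimeter_def root_face_orbit)
  have "inj cut_perm" using cut_perm permutes_inj by blast
  moreover have "(cut_perm ^^ i) s \<noteq> r" if "i < ?n" for i
    using that rs funpow_dist1_least[of i cut_perm s r] by (cases "i = 0") auto
  ultimately have "(perm_skip r cut_perm ^^ ?n) s = cut_perm r"
    using funpow_dist1_prop[OF rs'] by (intro funpow_skip_hit) auto
  then show ?thesis using n leg_psi psi_rs by simp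
qed

lemma leg_closed:
  assumes "d \<in> D" shows "perm_skip r (rot m) d \<in> D" "perm_skip s (perm_skip r (rot m)) d \<in> D"
proof -
  have ri: "inj (rot m)" "inj (perm_skip r (rot m))"
    using rot permutes_inj unfolding perm_skip_def by (auto intro!: inj_compose)
  have *: "perm_skip r (rot m) d \<in> D" if "d \<in> D" for d
    using that rot_D rD ri(1) by (cases "d = r") (auto simp: perm_skip_apply)
  then show "perm_skip r (rot m) d \<in> D" using assms by simp
  show "perm_skip s (perm_skip r (rot m)) d \<in> D"
    using * assms sD ri(2) by (cases "d = s") (auto simp: perm_skip_apply)
qed

end

text \<open>Two insertions are undone in turn by \<open>perm_skip_conj_back\<close>:
  \<open>root\<close> fixes the position of \<open>s\<close>, and the last assumption, in the third
  claim, that of \<open>r\<close>. The first two claims treat the stage with \<open>s\<close> only,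
  as this is where the last assumption gets proved in the chord case.\<close>

lemma map_iso_extend:
  assumes m: "root_edge m" and m': "root_edge m'"
    and bij: "bij_betw h (darts (del m)) (darts (del m'))"
    and hrot: "\<forall>d \<in> darts (del m). h (rot (del m) d) = rot (del m') (h d)"
    and hopp: "\<forall>d \<in> darts (del m). h (opp m d) = opp m' (h d)"
    and H: "H = h(root_dart m := root_dart m', opp m (root_dart m) := opp m' (root_dart m'))"
    and root: "H (root_dart (del m)) = root_dart (del m')"
  shows "\<And>d. d \<in> darts m \<Longrightarrow> H (perm_skip (root_dart m) (rot m) d) = perm_skip (root_dart m') (rot m') (H d)"
    and "\<And>d. d \<in> darts m \<Longrightarrow> H (opp (del m) d) = opp (del m') (H d)"
    and "H (rot m (root_dart m)) = rot m' (root_dart m') \<Longrightarrow> map_iso H m m'"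
proof -
  interpret A: root_edge m by fact
  interpret B: root_edge m' by fact
  have Hr: "H A.r = B.r" and Hs: "H A.s = B.s" using H A.rs by auto
  have HE: "H d = h d" if "d \<in> A.E" for d using that H by auto
  have E: "h ` A.E = B.E" and injE: "inj_on h A.E" using bij by (auto simp: bij_betw_def)
  have hE: "h d \<in> B.E" if "d \<in> A.E" for d using E that by blast
  have HD: "H ` A.D = B.D"
  proof -
    have "H ` A.E = B.E" using image_cong[OF refl HE, of A.E] E by simp
    then have "H ` ({A.r, A.s} \<union> A.E) = {B.r, B.s} \<union> B.E"
      by (simp only: image_Un image_insert image_empty Hr Hs)
    moreover have "{A.r, A.s} \<union> A.E = A.D" "{B.r, B.s} \<union> B.E = B.D"
      using A.rD A.sD B.rD B.sD by auto
    ultimately show ?thesis by metis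
  qed
  have inj: "inj_on H A.D"
  proof (rule inj_onI)
    fix a b assume ab: "a \<in> A.D" "b \<in> A.D" "H a = H b"
    have c: "d = A.r \<and> H d = B.r \<or> d = A.s \<and> H d = B.s \<or> d \<in> A.E \<and> H d = h d \<and> h d \<in> B.E"
      if dD: "d \<in> A.D" for d using that Hr Hs HE hE by auto
    show "a = b" using c[OF ab(1)] c[OF ab(2)] ab(3) B.rs inj_onD[OF injE, of a b] by auto
  qed
  have ri: "inj (rot m)" "inj (rot m')" using A.rot B.rot permutes_inj by blast+
  have ri2: "inj (perm_skip A.r (rot m))" "inj (perm_skip B.r (rot m'))"
    using ri unfolding perm_skip_def by (auto intro!: inj_compose)
  have rotE: "rot (del m) d \<in> A.E" if "d \<in> A.E" for d
    using premap_closed(1)[OF A.premap_del, of d] that by (simp only: A.del_simps(1))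
  have rs_fix: "rot (del m) A.r = A.r" "rot (del m') B.r = B.r"
    using A.premap_del B.premap_del permutes_not_in[of "rot (del m)" A.E A.r]
      permutes_not_in[of "rot (del m')" B.E B.r] unfolding premap_def A.del_simps(1) B.del_simps(1) by auto
  have 0: "H (rot (del m) d) = rot (del m') (H d)" if dD: "d \<in> A.D" for d
  proof -
    consider "d = A.r" | "d = A.s" | "d \<in> A.E" using dD by blast
    then show ?thesis
    proof cases
      case 1 then show ?thesis using rs_fix Hr by simp
    next
      case 2 then show ?thesis using Hs by simp
    next
      case 3 then show ?thesis using HE[OF 3] HE[OF rotE[OF 3]] hrot 3 by simp
    qed
  qed
  show 1: "H (perm_skip A.r (rot m) d) = perm_skip B.r (rot m') (H d)" if dD: "d \<in> A.D" for d
  proof (rule perm_skip_conj_back[OF ri2 inj A.sD dD A.leg_closed(1)])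
    show "H (perm_skip A.s (perm_skip A.r (rot m)) d) = perm_skip (H A.s) (perm_skip B.r (rot m')) (H d)"
      using 0[OF dD] Hs by simp
    show "H (perm_skip A.r (rot m) A.s) = perm_skip B.r (rot m') (H A.s)" using root Hs by simp
    show "perm_skip A.s (perm_skip A.r (rot m)) d \<in> A.D" by (rule A.leg_closed(2)[OF dD])
  qed
  show 2: "H (opp (del m) d) = opp (del m') (H d)" if dD: "d \<in> A.D" for d
  proof -
    consider "d = A.r" | "d = A.s" | "d \<in> A.E" using dD by blast
    then show ?thesis
    proof cases
      case 1 then show ?thesis using A.opp_del_rs B.opp_del_rs Hr by simp
    next
      case 2 then show ?thesis using A.opp_del_rs B.opp_del_rs Hs by simp
    next
      case 3
      then show ?thesis using A.opp_del[OF 3] B.opp_del[OF hE[OF 3]] HE[OF 3] HE[OF A.opp_E[OF 3]] hopp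
        by simp
    qed
  qed
  have opp: "H (opp m d) = opp m' (H d)" if dD: "d \<in> A.D" for d
  proof -
    consider "d = A.r" | "d = A.s" | "d \<in> A.E" using dD by blast
    then show ?thesis
    proof cases
      case 1 then show ?thesis using Hr Hs by simp
    next
      case 2 then show ?thesis using Hr Hs A.opps B.opps by simp
    next
      case 3
      then show ?thesis using HE[OF 3] HE[OF A.opp_E[OF 3]] hopp by simp
    qed
  qed
  assume rr: "H (rot m A.r) = rot m' B.r"
  have rot: "H (rot m d) = rot m' (H d)" if dD: "d \<in> A.D" for d
  proof (rule perm_skip_conj_back[OF ri inj A.rD dD A.rot_D])
    show "H (perm_skip A.r (rot m) d) = perm_skip (H A.r) (rot m') (H d)" using 1[OF dD] Hr by simp
    show "H (rot m A.r) = rot m' (H A.r)" using rr Hr by simp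
    show "perm_skip A.r (rot m) d \<in> A.D" by (rule A.leg_closed(1)[OF dD])
  qed
  show "map_iso H m m'"
    using inj HD rot opp Hr by (auto simp: map_iso_def bij_betw_def)
qed

lemma funpow_conj:
  assumes "\<And>d. d \<in> D \<Longrightarrow> h (f d) = g (h d)" "\<And>d. d \<in> D \<Longrightarrow> f d \<in> D" "a \<in> D"
  shows "h ((f ^^ n) a) = (g ^^ n) (h a)"
proof -
  have "(f ^^ n) a \<in> D \<and> h ((f ^^ n) a) = (g ^^ n) (h a)"
    by (induction n) (use assms in auto)
  then show ?thesis by simp
qed

lemma codes_imp_iso:
  assumes "codes m t" "codes m' t" "sphere m" "sphere m'"
  shows "\<exists>h. map_iso h m m'"
  using assms
proof (induction arbitrary: m' rule: codes.induct)
  case (codes_Vertex m)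
  then have "map_iso (\<lambda>_. root_dart m') m m'"
    using codes_empty_iff[of m' Vertex] by (simp add: map_iso_def bij_betw_def)
  then show ?case by blast
next
  case (codes_Chord m t)
  have ne': "darts m' \<noteq> {}" and nb': "opp m' (root_dart m') \<notin> root_face m'"
    and cd: "codes (del m') t" and p: "perimeter m' = perimeter m"
    using codes_Chord.prems(1) by (auto elim: codes_ChordE)
  interpret A: root_edge m using codes_Chord.prems(2) codes_Chord.hyps(1) by (rule sphere_root_edge)
  interpret B: root_edge m' using codes_Chord.prems(3) ne' by (rule sphere_root_edge)
  have nA: "A.s \<notin> A.Or" and nB: "B.s \<notin> B.Or"
    using codes_Chord.hyps(2) nb' by (simp_all add: root_face_orbit)
  obtain h where h: "map_iso h (del m) (del m')"
    using codes_Chord.IH[OF cd sphere_chord[OF codes_Chord.prems(2) codes_Chord.hyps(1,2)]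
        sphere_chord[OF codes_Chord.prems(3) ne' nb']] by blast
  note i = map_iso_inj[OF h]
  define H where "H = h(A.r := B.r, A.s := B.s)"
  have Hs: "H A.s = B.s" by (simp add: H_def)
  have root: "H (root_dart (del m)) = root_dart (del m')"
  proof (cases "A.E = {}")
    case True
    then have BE: "B.E = {}" using i(2) by (simp only: A.del_simps(1) B.del_simps(1) image_empty)
    have "rot m A.r = A.s" "rot m A.s = A.r" "rot m' B.r = B.s" "rot m' B.s = B.r"
      by (rule A.chord_empty(4,5)[OF nA True] B.chord_empty(4,5)[OF nB BE])+
    then have "root_dart (del m) = A.s" "root_dart (del m') = B.s"
      by (simp_all add: perm_skip_def)
    then show ?thesis using Hs by simp
  next
    case False
    then have "root_dart (del m) \<in> A.E"
      using A.root_del_orbit(1) A.chord_root_del[OF nA sphere_conn[OF codes_Chord.prems(2)]] by simp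
    then show ?thesis using i(3) by (auto simp: H_def)
  qed
  have ho: "\<forall>d \<in> darts (del m). h (opp m d) = opp m' (h d)"
  proof
    fix d assume that: "d \<in> darts (del m)"
    have "h d \<in> B.E" using that i(2) by auto
    then show "h (opp m d) = opp m' (h d)" using i(5)[OF that] that A.opp_del[of d] B.opp_del[of "h d"] by (simp only: A.del_simps(1))
  qed
  have bij: "bij_betw h (darts (del m)) (darts (del m'))" using h by (simp add: map_iso_def)
  have hr: "\<forall>d \<in> darts (del m). h (rot (del m) d) = rot (del m') (h d)" using i(4) by blast
  note ex = map_iso_extend[OF A.root_edge_axioms B.root_edge_axioms bij hr ho H_def root]
  \<comment> \<open>Both walks of \<open>chord_rot_root\<close> start at corresponding half-edges
    and, as the codes agree, have the same length. Since \<open>H\<close> conjugates them, they end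
    at corresponding darts.\<close>
  let ?f = "perm_skip A.r (rot m) \<circ> opp (del m)" and ?g = "perm_skip B.r (rot m') \<circ> opp (del m')"
  have oD: "opp (del m) d \<in> A.D" if "d \<in> A.D" for d
    using that A.opp_del_rs A.opp_del[of d] A.oppD[of d] A.rD A.sD by (cases "d \<in> A.E") auto
  have "H ((?f ^^ perimeter m) A.s) = (?g ^^ perimeter m) (H A.s)"
  proof (rule funpow_conj[of A.D])
    show "H (?f d) = ?g (H d)" if "d \<in> A.D" for d using ex(1)[OF oD[OF that]] ex(2)[OF that] by simp
    show "?f d \<in> A.D" if "d \<in> A.D" for d using A.leg_closed(1)[OF oD[OF that]] by simp
  qed (rule A.sD)
  then have "H (rot m A.r) = rot m' B.r"
    using A.chord_rot_root[OF nA] B.chord_rot_root[OF nB] p Hs by simp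
  then show ?case using ex(3) by blast
next
  case (codes_Bridge m t u)
  have ne': "darts m' \<noteq> {}" and br': "opp m' (root_dart m') \<in> root_face m'"
    and cd: "codes (left_part m') t" "codes (right_part m') u"
    using codes_Bridge.prems(1) by (auto elim: codes_BridgeE)
  interpret A: root_edge m using codes_Bridge.prems(2) codes_Bridge.hyps(1) by (rule sphere_root_edge)
  interpret B: root_edge m' using codes_Bridge.prems(3) ne' by (rule sphere_root_edge)
  have bA: "A.s \<in> A.Or" and bB: "B.s \<in> B.Or"
    using codes_Bridge.hyps(2) br' by (simp_all add: root_face_orbit)
  note sA = sphere_bridge[OF codes_Bridge.prems(2) codes_Bridge.hyps(1,2)]
    and sB = sphere_bridge[OF codes_Bridge.prems(3) ne' br']
  obtain h1 where h1: "map_iso h1 (left_part m) (left_part m')"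
    using codes_Bridge.IH(1)[OF cd(1) sA(1) sB(1)] by blast
  obtain h2 where h2: "map_iso h2 (right_part m) (right_part m')"
    using codes_Bridge.IH(2)[OF cd(2) sA(2) sB(2)] by blast
  note i1 = map_iso_inj[OF h1, unfolded A.parts B.parts sub_simps]
    and i2 = map_iso_inj[OF h2, unfolded A.parts B.parts sub_simps]
  have spA: "A.C1 \<inter> A.C2 = {}" "A.C1 \<union> A.C2 = A.E"
    "if rot m A.s = A.s then A.C1 = {} else rot m A.s \<in> A.C1"
    "if rot m A.r = A.r then A.C2 = {} else rot m A.r \<in> A.C2"
    using sA(3) unfolding A.splits_def A.parts sub_simps by blast+
  have spB: "B.C1 \<inter> B.C2 = {}" "B.C1 \<union> B.C2 = B.E"
    "if rot m' B.s = B.s then B.C1 = {} else rot m' B.s \<in> B.C1"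
    "if rot m' B.r = B.r then B.C2 = {} else rot m' B.r \<in> B.C2"
    using sB(3) unfolding B.splits_def B.parts sub_simps by blast+
  define h where "h d = (if d \<in> A.C1 then h1 d else h2 d)" for d
  have hC: "d \<in> A.C1 \<Longrightarrow> h d = h1 d" "d \<in> A.C2 \<Longrightarrow> h d = h2 d" for d
    using spA(1) by (auto simp: h_def)
  have bij: "bij_betw h (darts (del m)) (darts (del m'))"
  proof -
    have "bij_betw h A.C1 B.C1" "bij_betw h A.C2 B.C2"
      using i1(1,2) i2(1,2) hC bij_betw_cong[of A.C1 h h1 B.C1] bij_betw_cong[of A.C2 h h2 B.C2]
      by (simp_all add: bij_betw_def)
    then have "bij_betw h (A.C1 \<union> A.C2) (B.C1 \<union> B.C2)" using spB(1) by (rule bij_betw_combine)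
    then show ?thesis using spA(2) spB(2) by simp
  qed
  have hrot: "h (rot (del m) d) = rot (del m') (h d) \<and> h (opp (del m) d) = opp (del m') (h d)"
    if "d \<in> darts (del m)" for d
  proof -
    have "d \<in> A.C1 \<or> d \<in> A.C2" using that spA(2) by auto
    then show ?thesis
    proof
      assume d: "d \<in> A.C1"
      then have "rot (del m) d \<in> A.C1" "opp (del m) d \<in> A.C1"
        using A.C_closed(1) by (auto simp: closed_in_def simp del: A.del_simps)
      moreover have "h1 d \<in> B.C1" using d i1(2) by blast
      ultimately show ?thesis using d i1(4,5)[OF d] hC
        by (simp add: perm_restrict_simps del: A.del_simps B.del_simps)
    next
      assume d: "d \<in> A.C2"
      then have "rot (del m) d \<in> A.C2" "opp (del m) d \<in> A.C2"
        using A.C_closed(2) by (auto simp: closed_in_def simp del: A.del_simps)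
      moreover have "h2 d \<in> B.C2" using d i2(2) by blast
      ultimately show ?thesis using d i2(4,5)[OF d] hC
        by (simp add: perm_restrict_simps del: A.del_simps B.del_simps)
    qed
  qed
  have ho: "\<forall>d \<in> darts (del m). h (opp m d) = opp m' (h d)"
  proof
    fix d assume that: "d \<in> darts (del m)"
    have "h d \<in> B.E" using that bij by (auto simp: bij_betw_def)
    then show "h (opp m d) = opp m' (h d)" using hrot[OF that] that A.opp_del[of d] B.opp_del[of "h d"] by (simp only: A.del_simps(1))
  qed
  define H where "H = h(A.r := B.r, A.s := B.s)"
  have Hs: "H A.s = B.s" "H A.r = B.r" using A.rs by (simp_all add: H_def)
  have HE: "H d = h d" if "d \<in> A.E" for d using that by (auto simp: H_def)
  have "H (rot m A.s) = rot m' B.s"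
  proof (cases "rot m A.s = A.s")
    case True
    then have "A.C1 = {}" using spA(3) by simp
    then have "B.C1 = {}" using i1(2) by simp
    then show ?thesis using True spB(3) Hs by (auto split: if_splits)
  next
    case False
    then have d: "rot m A.s \<in> A.C1" using spA(3) by simp
    then have "rot m A.s \<in> A.E" using spA(2) by blast
    then show ?thesis using HE hC(1)[OF d] i1(3) by simp
  qed
  then have root: "H (root_dart (del m)) = root_dart (del m')"
    using A.bridge_skip[OF bA] B.bridge_skip[OF bB] by simp
  have "H (rot m A.r) = rot m' B.r"
  proof (cases "rot m A.r = A.r")
    case True
    then have "A.C2 = {}" using spA(4) by simp
    then have "B.C2 = {}" using i2(2) by simp
    then show ?thesis using True spB(4) Hs by (auto split: if_splits)
  next
    case False
    then have d: "rot m A.r \<in> A.C2" using spA(4) by simp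
    then have "rot m A.r \<in> A.E" using spA(2) by blast
    then show ?thesis using HE hC(2)[OF d] i2(3) by simp
  qed
  moreover have hr: "\<forall>d \<in> darts (del m). h (rot (del m) d) = rot (del m') (h d)" using hrot by blast
  ultimately show ?case
    using map_iso_extend(3)[OF A.root_edge_axioms B.root_edge_axioms bij hr ho H_def root]
    by blast
qed

section \<open>Every valid tree is the code of a map\<close>

text \<open>In the rotation around vertices, \<open>s\<close> is inserted before \<open>x\<close>, and then \<open>r\<close> before \<open>y\<close>; the
  choices \<open>x = s\<close> and \<open>y = r\<close> create a new vertex.\<close>

definition glue :: "rooted_map \<Rightarrow> nat \<Rightarrow> nat \<Rightarrow> nat \<Rightarrow> nat \<Rightarrow> rooted_map" where
  "glue n r s x y = \<lparr>darts = insert r (insert s (darts n)),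
     rot = Transposition.transpose r y \<circ> (Transposition.transpose s x \<circ> rot n), opp = Transposition.transpose r s \<circ> opp n, root_dart = r\<rparr>"

lemma glue_simps [simp]:
  "darts (glue n r s x y) = insert r (insert s (darts n))"
  "rot (glue n r s x y) = Transposition.transpose r y \<circ> (Transposition.transpose s x \<circ> rot n)"
  "opp (glue n r s x y) = Transposition.transpose r s \<circ> opp n" "root_dart (glue n r s x y) = r"
  by (simp_all add: glue_def)

lemma glue:
  assumes n: "premap n" and rs: "r \<notin> darts n" "s \<notin> darts n" "r \<noteq> s"
    and x: "x \<in> insert s (darts n)" and y: "y \<in> insert r (insert s (darts n))"
  shows "root_edge (glue n r s x y)" "del (glue n r s x y) = n\<lparr>root_dart := x\<rparr>"
    "rot (glue n r s x y) r = y" "opp (glue n r s x y) r = s"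
    "perm_skip r (rot (glue n r s x y)) = Transposition.transpose s x \<circ> rot n"
proof -
  let ?D = "insert r (insert s (darts n))"
  have fx: "rot n r = r" "rot n s = s" "opp n r = r" "opp n s = s"
    using n rs permutes_not_in by (auto simp: premap_def)
  have r: "(Transposition.transpose s x \<circ> rot n) r = r" using rs x fx by (auto simp: Transposition.transpose_def)
  have s: "(Transposition.transpose s x \<circ> rot n) s = x" using fx by simp
  have perm: "rot n permutes ?D" "opp n permutes ?D"
    using n permutes_subset by (auto simp: premap_def intro: permutes_subset)
  then have "rot (glue n r s x y) permutes ?D" "opp (glue n r s x y) permutes ?D"
    using x y by (auto intro!: permutes_compose permutes_swap_id simp del: comp_apply)
  moreover have "opp (glue n r s x y) d \<noteq> d \<and> opp (glue n r s x y) (opp (glue n r s x y) d) = d"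
    if "d \<in> ?D" for d
  proof -
    consider "d = r" | "d = s" | "d \<in> darts n" using \<open>d \<in> ?D\<close> by blast
    then show ?thesis
    proof cases
      case 3
      then have "opp n d \<in> darts n" "opp n d \<noteq> d" "opp n (opp n d) = d"
        using n by (auto simp: premap_def permutes_in_image)
      then show ?thesis using rs 3 by (auto simp: Transposition.transpose_def)
    qed (use rs fx in \<open>auto simp: Transposition.transpose_def\<close>)
  qed
  ultimately have pm: "premap (glue n r s x y)"
    using n unfolding premap_def glue_simps(1) by simp
  then show re: "root_edge (glue n r s x y)" by (simp add: root_edge_def)
  show o: "opp (glue n r s x y) r = s" using fx by simp
  show yr: "rot (glue n r s x y) r = y" using r by simp
  show leg: "perm_skip r (rot (glue n r s x y)) = Transposition.transpose s x \<circ> rot n"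
    unfolding perm_skip_def[of r] yr by (simp add: fun_eq_iff)
  have "perm_skip s (perm_skip r (rot (glue n r s x y))) = rot n"
    unfolding leg perm_skip_def[of s] s by (simp add: fun_eq_iff)
  moreover have "Transposition.transpose r s \<circ> opp (glue n r s x y) = opp n" by (simp add: fun_eq_iff)
  moreover have "perm_skip r (rot (glue n r s x y)) s = x" unfolding leg using s by simp
  moreover have "?D - {r, s} = darts n" using rs by auto
  ultimately show "del (glue n r s x y) = n\<lparr>root_dart := x\<rparr>"
    unfolding del_def Let_def glue_simps(4) o by (simp del: glue_simps add: glue_simps(1))
qed

lemma glue_psi:
  assumes n: "premap n" and rs: "r \<notin> darts n" "s \<notin> darts n" "r \<noteq> s"
    and x: "x \<in> insert s (darts n)" and y: "y \<in> insert r (insert s (darts n))"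
  shows "root_edge.cut_perm (glue n r s x y) = Transposition.transpose r y \<circ> (Transposition.transpose s x \<circ> face_perm n)"
  unfolding root_edge.cut_perm_def[OF glue(1)[OF assms]] glue(2)[OF assms]
  by (simp add: face_perm_def fun_eq_iff)

lemma funpow_distinct:
  assumes "inj f" "i < j" "(f ^^ i) a = (f ^^ j) a"
  shows "(f ^^ (j - i)) a = a"
proof -
  have "(f ^^ i) ((f ^^ (j - i)) a) = (f ^^ i) a"
    using assms funpow_add[of i "j - i" f] by simp
  then show ?thesis using inj_fn[OF assms(1)] by (meson injD)
qed

lemma orbit_card_least:
  assumes "inj f" "a \<in> orbit f a" "0 < i" "i < card (orbit f a)"
  shows "(f ^^ i) a \<noteq> a"
proof
  assume a: "(f ^^ i) a = a"
  have "orbit f a = (\<lambda>m. (f ^^ m) a) ` {..<i}"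
    using orbit_altdef_bounded[OF a assms(3)] by auto
  then have "card (orbit f a) \<le> card {..<i}" by (metis card_image_le finite_lessThan)
  then show False using assms(4) by simp
qed

lemma funpow_closed:
  assumes "\<And>d. d \<in> D \<Longrightarrow> f d \<in> D" "a \<in> D"
  shows "(f ^^ i) a \<in> D"
  by (induction i) (use assms in auto)

text \<open>The recipe of \<open>chord_rot_root\<close> in reverse: \<open>s\<close> is attached as
  a half-edge before the root dart, and \<open>r\<close> at the corner reached after
  \<open>p\<close> steps along the root face. With the half-edge this face has length
  \<open>perim n + 1\<close>, which explains the range of \<open>p\<close>. The default
  \<open>x = s\<close> serves the one-vertex map.\<close>

lemma glue_chord:
  assumes n: "sphere n" and fr: "r \<notin> darts n" "s \<notin> darts n" "r \<noteq> s"
    and p: "1 \<le> p" "p \<le> perim n + 1"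
  defines "x \<equiv> if darts n = {} then s else root_dart n"
  defines "y \<equiv> ((Transposition.transpose s x \<circ> face_perm n) ^^ p) s"
  shows "sphere (glue n r s x y)" "perimeter (glue n r s x y) = p"
    "s \<notin> root_face (glue n r s x y)"
proof -
  let ?m = "glue n r s x y"
  define g where "g = Transposition.transpose s x \<circ> face_perm n"
  have pmn: "premap n" by (rule sphere_premap[OF n])
  have rx: "darts n \<noteq> {} \<Longrightarrow> x \<in> darts n" using n by (simp add: x_def sphere_def cmap_def rooted_def)
  have x: "x \<in> insert s (darts n)" using rx by (auto simp: x_def)
  have fing: "finite (insert s (darts n))" using pmn by (simp add: premap_def)
  have pphi: "face_perm n permutes darts n" by (rule premap_phi[OF pmn])
  have "face_perm n permutes insert s (darts n)" using pphi by (rule permutes_subset) auto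
  then have g: "g permutes insert s (darts n)"
    unfolding g_def using x by (intro permutes_compose permutes_swap_id) auto
  then have injg: "inj g" using permutes_inj by blast
  have gD: "(g ^^ i) s \<in> insert s (darts n)" for i
    by (rule funpow_closed) (use permutes_in_image[OF g] in auto)
  then have y: "y \<in> insert r (insert s (darts n))" unfolding y_def g_def[symmetric] by blast
  have yg: "y = (g ^^ p) s" by (simp add: y_def g_def)
  have ry: "y \<noteq> r" using gD[of p] fr unfolding yg by auto
  note G = glue[OF pmn fr x y]
  have pm': "premap ?m" using G(1) by (simp add: root_edge_def)
  interpret root_edge ?m by (rule G(1))
  have ss: "s \<in> orbit g s" by (rule self_in_orbit[OF fing g])
  have phis: "face_perm n s = s" using pphi fr(2) permutes_not_in by metis
  have gs: "g s = x" using phis by (simp add: g_def)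
  then have "perm_skip s g = face_perm n"
    unfolding perm_skip_def gs by (simp add: g_def fun_eq_iff)
  have cg: "card (orbit g s) = perim n + 1"
  proof (cases "darts n = {}")
    case True
    then have "g s = s" using gs by (simp add: x_def)
    then have "orbit g s = {s}" by (simp add: orbit_eq_singleton_iff)
    then have "card (orbit g s) = 1" by simp
    then show ?thesis using True by (simp add: perim_def)
  next
    case False
    then have xs: "x \<noteq> s" "x \<in> darts n" using rx fr by auto
    have "x \<in> orbit g s" using gs orbit.base[of g s] by simp
    then have "orbit g x = orbit g s" by (rule orbit_eq[OF fing g])
    then have "orbit (face_perm n) x = orbit g s - {s}"
      using orbit_skip[OF injg xs(1)] \<open>perm_skip s g = face_perm n\<close> by simp
    moreover have "x = root_dart n" using False by (simp add: x_def)
    ultimately have "perim n = card (orbit g s - {s})"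
      using False by (simp add: perim_def perimeter_def root_face_orbit)
    then show ?thesis using card_Suc_Diff1[OF finite_orbit[OF ss] ss] by simp
  qed
  have ps: "cut_perm = Transposition.transpose r y \<circ> g" using glue_psi[OF pmn fr x y] by (simp add: g_def)
  \<comment> \<open>The insertion of \<open>r\<close> disturbs \<open>g\<close> only where it would
    reach \<open>y\<close>. This does not happen before step \<open>p\<close>, since
    \<open>p\<close> is at most the length of the cycle of \<open>s\<close>.\<close>
  have it: "(cut_perm ^^ i) s = (g ^^ i) s" if "i < p" for i
    using that
  proof (induction i)
    case (Suc i)
    have "(g ^^ Suc i) s \<noteq> y"
    proof
      assume "(g ^^ Suc i) s = y"
      then have "(g ^^ (p - Suc i)) s = s"
        using funpow_distinct[OF injg Suc.prems] yg by metis
      then show False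
        using orbit_card_least[OF injg ss, of "p - Suc i"] Suc.prems p cg by simp
    qed
    moreover have "(g ^^ Suc i) s \<noteq> r" using gD[of "Suc i"] fr by auto
    ultimately show ?case using Suc ps by (simp add: Transposition.transpose_def)
  qed simp
  obtain k where k: "p = Suc k" using p by (metis One_nat_def Suc_le_D)
  have hit: "(cut_perm ^^ p) s = r" using it[of k] k ps yg by simp
  have before: "(cut_perm ^^ i) s \<noteq> r" if "i < p" for i
    using it[OF that] gD[of i] fr by auto
  have rs': "r \<in> orbit cut_perm s" using hit p unfolding orbit_altdef by (auto intro!: exI[of _ p])
  have fd: "funpow_dist1 cut_perm s r = p"
  proof (rule antisym)
    show "funpow_dist1 cut_perm s r \<le> p"
    proof (rule ccontr)
      assume "\<not> funpow_dist1 cut_perm s r \<le> p"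
      then show False using funpow_dist1_least[of p cut_perm s r] hit p by simp
    qed
    show "p \<le> funpow_dist1 cut_perm s r"
      using before funpow_dist1_prop[OF rs'] by (meson not_le)
  qed
  have s_eq: "opp ?m (root_dart ?m) = s" using G(4) by simp
  have sr: "s \<noteq> r" using fr by simp
  have pt: "cut_perm \<circ> Transposition.transpose s r = face_perm ?m"
    using phi_psi s_eq by (simp add: transpose_commute)
  show nb: "s \<notin> root_face ?m"
    using orbit_split(2)[OF _ cut_perm rs' sr] pt fin by (simp add: root_face_orbit)
  show "perimeter ?m = p"
    using orbit_split(3)[OF _ cut_perm rs' sr] pt fin fd by (simp add: root_face_orbit perimeter_def)
  have nb': "opp ?m (root_dart ?m) \<notin> root_face ?m" using nb s_eq by simp
  have d: "del ?m = n\<lparr>root_dart := x\<rparr>" by (rule G(2))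
  have rem: "perm_skip (root_dart ?m) (rot ?m) s = x"
    using d del_simps(4) s_eq by (metis rooted_map.select_convs(4) rooted_map.surjective rooted_map.update_convs(4))
  have dn: "darts (del ?m) = darts n" unfolding d by simp
  have sd: "sphere (del ?m)"
  proof (cases "darts n = {}")
    case True
    then have "darts (del ?m) = {}" using dn by simp
    note e = cmap_empty[OF this]
    then show ?thesis using premap_del dn True by (simp add: sphere_def cmap_def del: del_simps)
  next
    case False
    then show ?thesis using d n by (simp add: x_def)
  qed
  have ne: "E = {} \<or> perm_skip (root_dart ?m) (rot ?m) (opp ?m (root_dart ?m)) \<noteq> opp ?m (root_dart ?m)"
    using dn rem rx fr(2) unfolding s_eq del_simps(1) by metis
  note c = chord[OF nb' ne] and v = chord_num_vertices[OF nb' ne]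
  have "connected_map ?m"
    using chord_conn[OF _ ne sphere_conn[OF sd]] nb' by (simp add: root_face_orbit)
  then have "cmap ?m" using pm' rD by (simp add: cmap_def rooted_def)
  then show "sphere ?m"
    using sd c(2) v card_D unfolding sphere_def del_simps(1) by simp
qed

text \<open>A permutation of a map is the identity off its darts, so for disjoint sets of darts the
  composition acts on each side as the permutation of that side.\<close>

definition disjoint_union :: "rooted_map \<Rightarrow> rooted_map \<Rightarrow> rooted_map" where
  "disjoint_union m1 m2 = \<lparr>darts = darts m1 \<union> darts m2, rot = rot m1 \<circ> rot m2,
     opp = opp m1 \<circ> opp m2, root_dart = root_dart m1\<rparr>"

lemma disjoint_union:
  assumes m1: "premap m1" and m2: "premap m2" and dj: "darts m1 \<inter> darts m2 = {}"
  defines "n \<equiv> disjoint_union m1 m2"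
  shows "darts n = darts m1 \<union> darts m2" "premap n" "closed_in n (darts m1)" "closed_in n (darts m2)"
    "sub n (darts m1) (root_dart m1) = m1" "sub n (darts m2) (root_dart m2) = m2"
proof -
  show D: "darts n = darts m1 \<union> darts m2" by (simp add: n_def disjoint_union_def)
  have p: "rot m1 permutes darts m1" "opp m1 permutes darts m1"
    "rot m2 permutes darts m2" "opp m2 permutes darts m2"
    using m1 m2 by (auto simp: premap_def)
  have s1: "rot n d = rot m1 d \<and> opp n d = opp m1 d" if d: "d \<in> darts m1" for d
  proof -
    have "d \<notin> darts m2" using d dj by blast
    then show ?thesis using permutes_not_in[OF p(3)] permutes_not_in[OF p(4)]
      by (simp add: n_def disjoint_union_def)
  qed
  have s2: "rot n d = rot m2 d \<and> opp n d = opp m2 d" if d: "d \<in> darts m2" for d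
  proof -
    have "rot m2 d \<in> darts m2" "opp m2 d \<in> darts m2" using d premap_closed[OF m2] by auto
    then have "rot m2 d \<notin> darts m1" "opp m2 d \<notin> darts m1" using dj by auto
    then show ?thesis using permutes_not_in[OF p(1)] permutes_not_in[OF p(2)]
      by (simp add: n_def disjoint_union_def)
  qed
  show "closed_in n (darts m1)" "closed_in n (darts m2)"
    using s1 s2 premap_closed[OF m1] premap_closed[OF m2] D by (auto simp: closed_in_def)
  have q: "rot n permutes darts n" "opp n permutes darts n"
  proof -
    have "rot m1 \<circ> rot m2 permutes darts m1 \<union> darts m2" "opp m1 \<circ> opp m2 permutes darts m1 \<union> darts m2"
      by (rule permutes_compose; rule permutes_subset, rule p, blast)+
    then show "rot n permutes darts n" "opp n permutes darts n"
      by (simp_all add: n_def disjoint_union_def)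
  qed
  have "opp n d \<noteq> d \<and> opp n (opp n d) = d" if "d \<in> darts n" for d
  proof (cases "d \<in> darts m1")
    case True
    then show ?thesis using s1 premap_closed(2)[OF m1 True] m1 by (simp add: premap_def)
  next
    case False
    then have d: "d \<in> darts m2" using that D by simp
    then show ?thesis using s2 premap_closed(2)[OF m2 d] m2 by (simp add: premap_def)
  qed
  then show "premap n" using q m1 m2 D unfolding premap_def by simp
  show "sub n (darts m1) (root_dart m1) = m1"
  proof (rule rooted_map.equality)
    show "rot (sub n (darts m1) (root_dart m1)) = rot m1"
      using s1 permutes_not_in[OF p(1)] by (auto simp: perm_restrict_def fun_eq_iff)
    show "opp (sub n (darts m1) (root_dart m1)) = opp m1"
      using s1 permutes_not_in[OF p(2)] by (auto simp: perm_restrict_def fun_eq_iff)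
  qed simp_all
  show "sub n (darts m2) (root_dart m2) = m2"
  proof (rule rooted_map.equality)
    show "rot (sub n (darts m2) (root_dart m2)) = rot m2"
      using s2 permutes_not_in[OF p(3)] by (auto simp: perm_restrict_def fun_eq_iff)
    show "opp (sub n (darts m2) (root_dart m2)) = opp m2"
      using s2 permutes_not_in[OF p(4)] by (auto simp: perm_restrict_def fun_eq_iff)
  qed simp_all
qed

lemma component_eqI:
  assumes "premap n" "closed_in n A" "connected_map (sub n A y)" "x \<in> A"
  shows "component n x = A"
proof -
  have s: "component n x \<subseteq> A" using assms by (intro component_minimal)
  have "closed_in (sub n A y) (component n x)"
    using s closed_in_component[OF assms(1), of x] unfolding closed_in_sub by (auto simp: closed_in_def)
  moreover have "x \<in> component n x" using assms by (intro in_component) (auto simp: closed_in_def)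
  ultimately show ?thesis using assms(3) unfolding connected_map_def by auto
qed

lemma glue_bridge:
  assumes m1: "sphere m1" and m2: "sphere m2" and dj: "darts m1 \<inter> darts m2 = {}"
    and fr: "r \<notin> darts m1 \<union> darts m2" "s \<notin> darts m1 \<union> darts m2" "r \<noteq> s"
    and c1: "codes m1 t" and c2: "codes m2 u"
  defines "x \<equiv> if darts m1 = {} then s else root_dart m1"
    and "y \<equiv> if darts m2 = {} then r else root_dart m2"
  shows "sphere (glue (disjoint_union m1 m2) r s x y)"
    "codes (glue (disjoint_union m1 m2) r s x y) (Bridge t u)"
proof -
  let ?n = "disjoint_union m1 m2"
  let ?m = "glue ?n r s x y"
  have pm1: "premap m1" and pm2: "premap m2" using m1 m2 sphere_premap by auto
  note n = disjoint_union[OF pm1 pm2 dj]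
  have rt: "darts m1 \<noteq> {} \<Longrightarrow> root_dart m1 \<in> darts m1" "darts m2 \<noteq> {} \<Longrightarrow> root_dart m2 \<in> darts m2"
    using m1 m2 by (auto simp: sphere_def cmap_def rooted_def)
  have frn: "r \<notin> darts ?n" "s \<notin> darts ?n" using fr n(1) by auto
  have x: "x \<in> insert s (darts ?n)" and y: "y \<in> insert r (insert s (darts ?n))"
    using rt n(1) by (auto simp: x_def y_def)
  have x1: "x \<in> insert s (darts m1)" and y2: "y \<in> insert r (darts m2)"
    using rt by (auto simp: x_def y_def)
  have xy: "x \<noteq> r" "x \<noteq> y" "y \<noteq> s" using x1 y2 fr dj by auto
  note G = glue[OF n(2) frn fr(3) x y]
  interpret root_edge ?m by (rule G(1))
  have s_eq: "opp ?m (root_dart ?m) = s" using G(4) by simp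
  have r_eq: "root_dart ?m = r" by simp
  have ns: "rot ?n s = s" using n(2) frn permutes_not_in by (auto simp: premap_def)
  have rs_m: "rot ?m r = y" by (rule G(3))
  have ss_m: "rot ?m s = x" using ns xy by (simp add: Transposition.transpose_def)
  have dl: "del ?m = ?n\<lparr>root_dart := x\<rparr>" by (rule G(2))
  have cl: "closed_in (del ?m) A \<longleftrightarrow> closed_in ?n A" for A
    unfolding dl by (simp add: closed_in_def)
  have sb: "sub (del ?m) A z = sub ?n A z" for A z unfolding dl by (simp add: sub_def)
  have dd: "darts (del ?m) = darts m1 \<union> darts m2" unfolding dl using n(1) by simp
  have p1: "face_perm ?n d \<in> darts m1" if "d \<in> darts m1" for d
    using sub_phi(2)[OF n(3) that] .
  have ps: "cut_perm = Transposition.transpose r y \<circ> (Transposition.transpose s x \<circ> face_perm ?n)" using glue_psi[OF n(2) frn fr(3) x y] .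
  have phis: "face_perm ?n s = s" using premap_phi[OF n(2)] frn permutes_not_in by metis
  have "cut_perm d \<in> insert s (darts m1)" if d: "d \<in> insert s (darts m1)" for d
  proof -
    have "face_perm ?n d \<in> insert s (darts m1)" using d p1 phis by auto
    then have "(Transposition.transpose s x \<circ> face_perm ?n) d \<in> insert s (darts m1)" using x1 by (auto simp: Transposition.transpose_def)
    moreover from this have "(Transposition.transpose s x \<circ> face_perm ?n) d \<noteq> r" "(Transposition.transpose s x \<circ> face_perm ?n) d \<noteq> y"
      using fr y2 dj by auto
    ultimately show ?thesis unfolding ps by (simp add: Transposition.transpose_def)
  qed
  \<comment> \<open>The face of \<open>s\<close> in the cut map stays on the side of
    \<open>m1\<close> and so misses \<open>r\<close>; restoring the edge merges the faces of
    \<open>r\<close> and \<open>s\<close>, which gives the root face on both sides.\<close>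
  then have o: "orbit cut_perm s \<subseteq> insert s (darts m1)" by (intro orbit_sub) auto
  have "s \<notin> orbit cut_perm r"
  proof
    assume "s \<in> orbit cut_perm r"
    then have "orbit cut_perm s = orbit cut_perm r" by (rule orbit_eq[OF fin cut_perm])
    then show False using o self_psi[of r] fr by auto
  qed
  then have "orbit (cut_perm \<circ> Transposition.transpose r s) r = orbit cut_perm r \<union> orbit cut_perm s"
    by (rule orbit_merge(1)[OF fin cut_perm])
  then have br: "s \<in> root_face ?m"
    using phi_psi s_eq self_psi[of s] by (simp add: root_face_orbit)
  then have br': "opp ?m (root_dart ?m) \<in> root_face ?m" using s_eq by simp
  have EE: "E = darts m1 \<union> darts m2" using dd unfolding del_simps(1) .
  have X: "if rot ?m (opp ?m (root_dart ?m)) = opp ?m (root_dart ?m) then darts m1 = {}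
    else rot ?m (opp ?m (root_dart ?m)) \<in> darts m1"
    unfolding s_eq ss_m using rt(1) fr by (auto simp: x_def)
  have Y: "if rot ?m (root_dart ?m) = root_dart ?m then darts m2 = {}
    else rot ?m (root_dart ?m) \<in> darts m2"
    unfolding r_eq rs_m using rt(2) fr by (auto simp: y_def)
  have sp: "splits (darts m1) (darts m2)"
    unfolding splits_def cl by (intro conjI n(3,4) dj EE[symmetric] X Y)
  note b = bridge[OF br' sp, unfolded s_eq r_eq G(4) rs_m ss_m]
  define n1 n2 where "n1 = sub (del ?m) (darts m1) x" and "n2 = sub (del ?m) (darts m2) y"
  have e1: "darts m1 \<noteq> {} \<Longrightarrow> n1 = m1" and e2: "darts m2 \<noteq> {} \<Longrightarrow> n2 = m2"
    unfolding n1_def n2_def sb using n(5,6) by (simp_all add: x_def y_def)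
  have d12: "darts n1 = darts m1" "darts n2 = darts m2" by (simp_all add: n1_def n2_def)
  have empt: "sphere k" if "darts k = {}" "premap k" for k
    using that cmap_empty[OF that(1)] by (simp add: sphere_def cmap_def)
  have s1: "sphere n1" and s2: "sphere n2"
    using e1 e2 d12 m1 m2 empt[of n1] empt[of n2] b(1,2) by (metis n1_def n2_def)+
  have k1: "codes n1 t"
  proof (cases "darts m1 = {}")
    case True
    then have "t = Vertex" using codes_empty_iff[OF c1] by simp
    then show ?thesis using True d12 by (auto intro: codes_Vertex)
  qed (use e1 c1 in simp)
  have k2: "codes n2 u"
  proof (cases "darts m2 = {}")
    case True
    then have "u = Vertex" using codes_empty_iff[OF c2] by simp
    then show ?thesis using True d12 by (auto intro: codes_Vertex)
  qed (use e2 c2 in simp)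
  have "component (del ?m) x = darts m1"
  proof (cases "darts m1 = {}")
    case True
    then show ?thesis using frn dd n(1) by (intro trans[OF component_empty]) (auto simp: x_def)
  next
    case False
    then have "x \<in> darts m1" using rt(1) by (simp add: x_def)
    then show ?thesis
      using component_eqI[OF premap_del _ sphere_conn[OF s1[unfolded n1_def]]] n(3) cl by blast
  qed
  then have l: "left_part ?m = n1" unfolding parts s_eq ss_m n1_def by simp
  have "component (del ?m) y = darts m2"
  proof (cases "darts m2 = {}")
    case True
    then show ?thesis using frn dd n(1) by (intro trans[OF component_empty]) (auto simp: y_def)
  next
    case False
    then have "y \<in> darts m2" using rt(2) by (simp add: y_def)
    then show ?thesis
      using component_eqI[OF premap_del _ sphere_conn[OF s2[unfolded n2_def]]] n(4) cl by blast
  qed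
  then have rr: "right_part ?m = n2" unfolding parts r_eq rs_m n2_def by simp
  have ne: "darts ?m \<noteq> {}" by simp
  show "codes ?m (Bridge t u)"
    by (rule codes_Bridge[OF ne br']) (simp_all only: l rr k1 k2)
  have "connected_map ?m" using b(10) sphere_conn[OF s1] sphere_conn[OF s2] by (simp add: n1_def n2_def)
  then have "cmap ?m" using pm rD by (simp add: cmap_def rooted_def)
  moreover have "num_vertices ?m = num_vertices n1 + num_vertices n2" "num_faces ?m + 1 = num_faces n1 + num_faces n2"
    "card (darts ?m) = card (darts n1) + card (darts n2) + 2"
    using b(5-7) unfolding d12 by (simp_all only: n1_def n2_def)
  ultimately show "sphere ?m" using s1 s2 by (simp add: sphere_def)
qed

text \<open>The set \<open>X\<close> of forbidden labels is what lets the induction realise the two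
  subtrees of a \<open>Bridge\<close> on disjoint sets of darts.\<close>

lemma codes_exists:
  assumes "tree_valid t" "finite X"
  shows "\<exists>m. sphere m \<and> codes m t \<and> darts m \<inter> X = {}"
  using assms
proof (induction t arbitrary: X)
  case Vertex
  define m where "m = \<lparr>darts = {}, rot = id, opp = id, root_dart = 0\<rparr>"
  have "darts m = {}" by (simp add: m_def)
  moreover from cmap_empty[OF this] have "sphere m"
    using calculation by (simp add: sphere_def cmap_def premap_def m_def permutes_id)
  ultimately show ?case using codes_Vertex by blast
next
  case (Chord p t)
  then obtain n where n: "sphere n" "codes n t" "darts n \<inter> X = {}" by auto
  have f: "finite (darts n \<union> X)" using n(1) Chord.prems by (simp add: sphere_def cmap_def premap_def)
  obtain r where r: "r \<notin> darts n \<union> X" using ex_new_if_finite[OF infinite_UNIV_nat f] by blast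
  have f': "finite (insert r (darts n \<union> X))" using f by simp
  obtain s where s: "s \<notin> insert r (darts n \<union> X)"
    using ex_new_if_finite[OF infinite_UNIV_nat f'] by blast
  have p: "1 \<le> p" "p \<le> perim n + 1" using Chord.prems codes_sphere(2)[OF n(1,2)] by auto
  have fr: "r \<notin> darts n" "s \<notin> darts n" "r \<noteq> s" using r s by auto
  define x where "x = (if darts n = {} then s else root_dart n)"
  define m where "m = glue n r s x (((Transposition.transpose s x \<circ> face_perm n) ^^ p) s)"
  note g = glue_chord[OF n(1) fr p, folded x_def, folded m_def]
  have o: "opp m (root_dart m) = s"
    using n(1) fr permutes_not_in[of "opp n" "darts n" r] by (simp add: m_def sphere_def cmap_def premap_def)
  have d: "del m = n\<lparr>root_dart := x\<rparr>"
    unfolding m_def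
  proof (rule glue(2)[OF sphere_premap[OF n(1)] fr])
    show x: "x \<in> insert s (darts n)" using n(1) by (auto simp: x_def sphere_def cmap_def rooted_def)
    have "(Transposition.transpose s x \<circ> face_perm n) permutes insert s (darts n)"
      using x premap_phi[OF sphere_premap[OF n(1)]]
      by (intro permutes_compose permutes_swap_id) (auto intro: permutes_subset)
    then have "((Transposition.transpose s x \<circ> face_perm n) ^^ p) s \<in> insert s (darts n)"
      by (intro funpow_closed) (simp_all only: permutes_in_image insertI1)
    then show "((Transposition.transpose s x \<circ> face_perm n) ^^ p) s \<in> insert r (insert s (darts n))" by blast
  qed
  have "codes (del m) t"
  proof (cases "darts n = {}")
    case True
    then have "t = Vertex" using codes_empty_iff[OF n(2)] by simp
    then show ?thesis using True d by (auto intro: codes_Vertex)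
  next
    case False
    then show ?thesis using d n(2) by (simp add: x_def)
  qed
  then have "codes m (Chord (perimeter m) t)"
    using g(3) o by (intro codes_Chord) (auto simp: m_def)
  moreover have "darts m \<inter> X = {}" using r s n(3) by (auto simp: m_def)
  ultimately show ?case using g by auto
next
  case (Bridge t u)
  obtain m1 where m1: "sphere m1" "codes m1 t" "darts m1 \<inter> X = {}" using Bridge.IH(1)[OF _ Bridge.prems(2)] Bridge.prems(1) by auto
  have f1: "finite (darts m1 \<union> X)" using m1(1) Bridge.prems by (simp add: sphere_def cmap_def premap_def)
  obtain m2 where m2: "sphere m2" "codes m2 u" "darts m2 \<inter> (darts m1 \<union> X) = {}"
    using Bridge.IH(2)[OF _ f1] Bridge.prems by auto
  have f2: "finite (darts m1 \<union> darts m2 \<union> X)"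
    using f1 m2(1) by (simp add: sphere_def cmap_def premap_def)
  obtain r where r: "r \<notin> darts m1 \<union> darts m2 \<union> X"
    using ex_new_if_finite[OF infinite_UNIV_nat f2] by blast
  have f3: "finite (insert r (darts m1 \<union> darts m2 \<union> X))" using f2 by simp
  obtain s where s: "s \<notin> insert r (darts m1 \<union> darts m2 \<union> X)"
    using ex_new_if_finite[OF infinite_UNIV_nat f3] by blast
  have dj: "darts m1 \<inter> darts m2 = {}" using m2(3) by auto
  have fr: "r \<notin> darts m1 \<union> darts m2" "s \<notin> darts m1 \<union> darts m2" "r \<noteq> s" using r s by auto
  note g = glue_bridge[OF m1(1) m2(1) dj fr m1(2) m2(2)]
  have "darts (glue (disjoint_union m1 m2) r s x y) \<inter> X = {}" for x y
    using r s m1(3) m2(3) by (auto simp: disjoint_union_def)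
  then show ?case by (intro exI conjI) (rule g)+
qed

section \<open>Generating functions of trees\<close>

text \<open>The bound \<open>N\<close>, on the height and on the degrees of inner faces, keeps all sums finite.\<close>

primrec trees :: "nat \<Rightarrow> nat \<Rightarrow> mtree set" where
  "trees 0 p = (if p = 0 then {Vertex} else {})"
| "trees (Suc N) p = (if p = 0 then {Vertex} else
     (\<Union>k\<in>{1..N}. Chord p ` trees N (p + k - 2)) \<union>
     (\<Union>i\<in>{..<p - 1}. (\<lambda>(t, u). Bridge t u) ` (trees N i \<times> trees N (p - 2 - i))))"

lemma trees_0: "trees N 0 = {Vertex}"
  by (cases N) auto

lemma finite_trees [simp]: "finite (trees N p)"
  by (induction N arbitrary: p) auto

lemma trees_valid: "t \<in> trees N p \<Longrightarrow> tree_valid t \<and> tree_perimeter t = p"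
proof (induction N arbitrary: p t)
  case (Suc N)
  show ?case
  proof (cases "p = 0")
    case False
    from Suc.prems False consider k t' where "k \<in> {1..N}" "t' \<in> trees N (p + k - 2)" "t = Chord p t'"
      | i t1 t2 where "i < p - 1" "t1 \<in> trees N i" "t2 \<in> trees N (p - 2 - i)" "t = Bridge t1 t2"
      by auto
    then show ?thesis
    proof cases
      case 1
      then show ?thesis using Suc.IH[OF 1(2)] False by auto
    next
      case 2
      then show ?thesis using Suc.IH[OF 2(2)] Suc.IH[OF 2(3)] by auto
    qed
  qed (use Suc in auto)
qed (auto split: if_splits)

lemma trees_Suc_mono: "trees N p \<subseteq> trees (Suc N) p"
proof (induction N arbitrary: p)
  case (Suc N)
  show ?case
  proof (cases "p = 0")
    case False
    show ?thesis
    proof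
      fix t assume "t \<in> trees (Suc N) p"
      with False consider k t' where "k \<in> {1..N}" "t' \<in> trees N (p + k - 2)" "t = Chord p t'"
        | i t1 t2 where "i < p - 1" "t1 \<in> trees N i" "t2 \<in> trees N (p - 2 - i)" "t = Bridge t1 t2"
        by auto
      then show "t \<in> trees (Suc (Suc N)) p"
      proof cases
        case 1
        then have "k \<in> {1..Suc N}" "t' \<in> trees (Suc N) (p + k - 2)"
          using Suc.IH by (auto simp del: trees.simps)
        then show ?thesis using 1(3) False by (subst trees.simps) (auto simp del: trees.simps)
      next
        case 2
        then have "t1 \<in> trees (Suc N) i" "t2 \<in> trees (Suc N) (p - 2 - i)" using Suc.IH by blast+
        then show ?thesis using 2(1,4) False by (subst trees.simps) (auto simp del: trees.simps)
      qed
    qed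
  qed simp
qed simp

lemma trees_mono: "N \<le> M \<Longrightarrow> trees N p \<subseteq> trees M p"
  by (induction M rule: dec_induct) (use trees_Suc_mono in blast)+

lemma trees_exhaust: "tree_valid t \<Longrightarrow> \<exists>N. \<forall>M\<ge>N. t \<in> trees M (tree_perimeter t)"
proof (induction t)
  case Vertex
  then show ?case using trees_0 by auto
next
  case (Chord p t)
  then obtain N where N: "\<And>M. M \<ge> N \<Longrightarrow> t \<in> trees M (tree_perimeter t)" by auto
  define k where "k = tree_perimeter t + 2 - p"
  have k: "1 \<le> k" "p + k - 2 = tree_perimeter t" "p \<noteq> 0" using Chord.prems by (auto simp: k_def)
  have "Chord p t \<in> trees M p" if M: "M \<ge> Suc (max N k)" for M
  proof -
    obtain M' where M': "M = Suc M'" "M' \<ge> N" "M' \<ge> k" using M by (cases M) auto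
    then have "\<exists>j\<in>{1..M'}. t \<in> trees M' (p + j - 2)"
      using k N[OF M'(2)] by (intro bexI[of _ k]) auto
    then show ?thesis using k(3) unfolding M'(1) trees.simps(2) by (auto simp del: trees.simps)
  qed
  then show ?case by auto
next
  case (Bridge t u)
  then obtain N1 N2 where N: "\<And>M. M \<ge> N1 \<Longrightarrow> t \<in> trees M (tree_perimeter t)" "\<And>M. M \<ge> N2 \<Longrightarrow> u \<in> trees M (tree_perimeter u)"
    by auto
  have "Bridge t u \<in> trees M (tree_perimeter t + tree_perimeter u + 2)" if M: "M \<ge> Suc (max N1 N2)" for M
  proof -
    obtain M' where M': "M = Suc M'" "M' \<ge> N1" "M' \<ge> N2" using M by (cases M) auto
    have "(t, u) \<in> trees M' (tree_perimeter t) \<times> trees M' (tree_perimeter t + tree_perimeter u + 2 - 2 - tree_perimeter t)"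
      using N M' by simp
    then have "\<exists>i\<in>{..<tree_perimeter t + tree_perimeter u + 2 - 1}. (t, u) \<in> trees M' i \<times> trees M' (tree_perimeter t + tree_perimeter u + 2 - 2 - i)"
      by (intro bexI[of _ "tree_perimeter t"]) simp_all
    then show ?thesis unfolding M'(1) trees.simps(2) by (auto simp del: trees.simps)
  qed
  then show ?case by auto
qed

lemma sum_trees_Suc:
  fixes f :: "mtree \<Rightarrow> real"
  assumes "p \<ge> 1"
  shows "(\<Sum>t\<in>trees (Suc N) p. f t) =
    (\<Sum>k=1..N. \<Sum>t\<in>trees N (p + k - 2). f (Chord p t)) +
    (\<Sum>i<p - 1. \<Sum>t\<in>trees N i. \<Sum>u\<in>trees N (p - 2 - i). f (Bridge t u))"
proof -
  let ?A = "\<Union>k\<in>{1..N}. Chord p ` trees N (p + k - 2)"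
  let ?B = "\<Union>i\<in>{..<p - 1}. (\<lambda>(t, u). Bridge t u) ` (trees N i \<times> trees N (p - 2 - i))"
  have "trees (Suc N) p = ?A \<union> ?B" using assms by simp
  moreover have "sum f (?A \<union> ?B) = sum f ?A + sum f ?B"
    by (rule sum.union_disjoint) auto
  moreover have "sum f ?A = (\<Sum>k=1..N. sum f (Chord p ` trees N (p + k - 2)))"
  proof (rule sum.UNION_disjoint)
    show "\<forall>i\<in>{1..N}. \<forall>j\<in>{1..N}. i \<noteq> j \<longrightarrow>
      Chord p ` trees N (p + i - 2) \<inter> Chord p ` trees N (p + j - 2) = {}"
    proof (intro ballI impI)
      fix i j assume ij: "i \<in> {1..N}" "j \<in> {1..N}" "i \<noteq> j"
      \<comment> \<open>The perimeter of a subtree determines the degree of the face cut off; this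
        is injective because \<open>p\<close> and the degrees are at least 1.\<close>
      have False if "t \<in> trees N (p + i - 2)" "t \<in> trees N (p + j - 2)" for t
        using trees_valid[OF that(1)] trees_valid[OF that(2)] ij assms by auto
      then show "Chord p ` trees N (p + i - 2) \<inter> Chord p ` trees N (p + j - 2) = {}" by blast
    qed
  qed auto
  moreover have "sum f (Chord p ` trees N j) = (\<Sum>t\<in>trees N j. f (Chord p t))" for j
    by (subst sum.reindex) (auto simp: inj_on_def)
  moreover have "sum f ?B = (\<Sum>i<p - 1. sum f ((\<lambda>(t, u). Bridge t u) ` (trees N i \<times> trees N (p - 2 - i))))"
  proof (rule sum.UNION_disjoint)
    show "\<forall>i\<in>{..<p - 1}. \<forall>j\<in>{..<p - 1}. i \<noteq> j \<longrightarrow>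
      (\<lambda>(t, u). Bridge t u) ` (trees N i \<times> trees N (p - 2 - i)) \<inter>
      (\<lambda>(t, u). Bridge t u) ` (trees N j \<times> trees N (p - 2 - j)) = {}"
    proof (intro ballI impI)
      fix i j :: nat assume ij: "i \<noteq> j"
      have False if "t \<in> trees N i" "t \<in> trees N j" for t
        using trees_valid[OF that(1)] trees_valid[OF that(2)] ij by auto
      then show "(\<lambda>(t, u). Bridge t u) ` (trees N i \<times> trees N (p - 2 - i)) \<inter>
        (\<lambda>(t, u). Bridge t u) ` (trees N j \<times> trees N (p - 2 - j)) = {}" by auto
    qed
  qed auto
  moreover have "sum f ((\<lambda>(t, u). Bridge t u) ` (trees N i \<times> trees N j))
    = (\<Sum>t\<in>trees N i. \<Sum>u\<in>trees N j. f (Bridge t u))" for i j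
  proof -
    have "sum f ((\<lambda>(t, u). Bridge t u) ` (trees N i \<times> trees N j))
      = (\<Sum>x\<in>trees N i \<times> trees N j. f (case x of (t, u) \<Rightarrow> Bridge t u))"
      by (subst sum.reindex) (auto simp: inj_on_def)
    also have "\<dots> = (\<Sum>(t, u)\<in>trees N i \<times> trees N j. f (Bridge t u))"
      by (intro sum.cong) auto
    finally show ?thesis by (simp add: sum.cartesian_product)
  qed
  ultimately show ?thesis by simp
qed

definition total :: "(nat \<Rightarrow> real) \<Rightarrow> real \<Rightarrow> nat \<Rightarrow> nat \<Rightarrow> real" where
  "total q u N p = (\<Sum>t\<in>trees N p. tree_weight q t * u ^ tree_vertices t)"

text \<open>This is \<open>u\<close> times the derivative of \<open>total\<close> in
  \<open>u\<close>: marking a vertex multiplies each term by the number of vertices.\<close>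

definition ptotal :: "(nat \<Rightarrow> real) \<Rightarrow> real \<Rightarrow> nat \<Rightarrow> nat \<Rightarrow> real" where
  "ptotal q u N p = (\<Sum>t\<in>trees N p. real (tree_vertices t) * tree_weight q t * u ^ tree_vertices t)"

lemma ptotal_0: "ptotal q u N 0 = u"
  by (simp add: ptotal_def trees_0)

lemma tree_weight_Chord: "t \<in> trees N (p + k - 2) \<Longrightarrow> p \<ge> 1 \<Longrightarrow> k \<ge> 1 \<Longrightarrow> tree_weight q (Chord p t) = q k * tree_weight q t"
proof -
  assume t: "t \<in> trees N (p + k - 2)" and pk: "p \<ge> 1" "k \<ge> 1"
  have "p + k - 2 + 2 - p = k" using pk by simp
  then show ?thesis using trees_valid[OF t] by simp
qed

lemma total_Suc:
  assumes "p \<ge> 1"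
  shows "total q u (Suc N) p = (\<Sum>k=1..N. q k * total q u N (p + k - 2)) +
    (\<Sum>i<p - 1. total q u N i * total q u N (p - 2 - i))"
proof -
  have "(\<Sum>t\<in>trees N (p + k - 2). tree_weight q (Chord p t) * u ^ tree_vertices (Chord p t)) = q k * total q u N (p + k - 2)"
    if "k \<ge> 1" for k
    unfolding total_def sum_distrib_left
    by (intro sum.cong refl) (simp only: tree_weight_Chord[OF _ assms that] tree_vertices.simps mult.assoc)
  moreover have "(\<Sum>t\<in>A. \<Sum>v\<in>B. tree_weight q (Bridge t v) * u ^ tree_vertices (Bridge t v))
    = (\<Sum>t\<in>A. tree_weight q t * u ^ tree_vertices t) * (\<Sum>t\<in>B. tree_weight q t * u ^ tree_vertices t)" for A B
    unfolding sum_product by (intro sum.cong refl) (simp add: power_add)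
  ultimately show ?thesis
    unfolding total_def[of q u "Suc N"] sum_trees_Suc[OF assms] by (simp add: total_def)
qed

text \<open>Product rule for the two parts of a bridge: the marked vertex lies in one of them.
  Reversing the order of summation identifies both contributions, whence the factor 2.\<close>

lemma ptotal_Suc:
  assumes "p \<ge> 1"
  shows "ptotal q u (Suc N) p = (\<Sum>k=1..N. q k * ptotal q u N (p + k - 2)) +
    2 * (\<Sum>i<p - 1. total q u N i * ptotal q u N (p - 2 - i))"
proof -
  have 1: "(\<Sum>t\<in>trees N (p + k - 2). real (tree_vertices (Chord p t)) * tree_weight q (Chord p t) * u ^ tree_vertices (Chord p t))
    = q k * ptotal q u N (p + k - 2)" if "k \<ge> 1" for k
    unfolding ptotal_def sum_distrib_left
    by (intro sum.cong refl) (simp only: tree_weight_Chord[OF _ assms that] tree_vertices.simps, simp)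
  have 2: "(\<Sum>t\<in>trees N i. \<Sum>v\<in>trees N j. real (tree_vertices (Bridge t v)) * tree_weight q (Bridge t v) * u ^ tree_vertices (Bridge t v))
    = ptotal q u N i * total q u N j + total q u N i * ptotal q u N j" for i j
    unfolding ptotal_def total_def sum_product sum.distrib[symmetric]
    by (intro sum.cong refl) (simp add: power_add algebra_simps)
  have S1: "(\<Sum>k=1..N. \<Sum>t\<in>trees N (p + k - 2).
      real (tree_vertices (Chord p t)) * tree_weight q (Chord p t) * u ^ tree_vertices (Chord p t))
    = (\<Sum>k=1..N. q k * ptotal q u N (p + k - 2))"
    by (intro sum.cong refl 1) simp
  have "(\<Sum>i<p - 1. ptotal q u N i * total q u N (p - 2 - i))
    = (\<Sum>i<p - 1. total q u N i * ptotal q u N (p - 2 - i))"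
    (is "?L = ?R")
  proof -
    define n where "n = p - 1"
    have n: "p - 2 - i = n - Suc i" for i using assms by (simp add: n_def)
    have "?R = (\<Sum>i<n. (\<lambda>j. ptotal q u N j * total q u N (n - Suc j)) (n - Suc i))"
      unfolding n n_def[symmetric] by (intro sum.cong) auto
    also have "\<dots> = ?L" unfolding n n_def[symmetric] by (rule sum.nat_diff_reindex)
    finally show ?thesis by simp
  qed
  then show ?thesis
    unfolding ptotal_def[of q u "Suc N"] sum_trees_Suc[OF assms] S1 2 sum.distrib by simp
qed

section \<open>Bounds for nonnegative weights\<close>

context
  fixes q :: "nat \<Rightarrow> real"
  assumes q: "\<And>k. k \<ge> 1 \<Longrightarrow> q k \<ge> 0"
begin

lemma tree_weight_nonneg: "tree_valid t \<Longrightarrow> tree_weight q t \<ge> 0"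
  by (induction t) (auto intro!: mult_nonneg_nonneg q)

lemma term_nonneg:
  assumes "t \<in> trees N p" "u \<ge> 0"
  shows "tree_weight q t * u ^ tree_vertices t \<ge> 0" "real (tree_vertices t) * tree_weight q t * u ^ tree_vertices t \<ge> 0"
  using tree_weight_nonneg trees_valid[OF assms(1)] assms(2) by auto

lemma total_nonneg: "u \<ge> 0 \<Longrightarrow> total q u N p \<ge> 0" "u \<ge> 0 \<Longrightarrow> ptotal q u N p \<ge> 0"
  unfolding total_def ptotal_def using term_nonneg by (auto intro!: sum_nonneg)

lemma total_mono: 
  assumes "u \<ge> 0" "N \<le> M"
  shows "total q u N p \<le> total q u M p" "ptotal q u N p \<le> ptotal q u M p"
  unfolding total_def ptotal_def
  using trees_mono[OF assms(2)] term_nonneg assms(1) by (auto intro!: sum_mono2)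

text \<open>The recursion for pointed totals is translation invariant in the perimeter, so a descent
  from \<open>p + p'\<close> to \<open>p'\<close> followed by one from \<open>p'\<close> to \<open>0\<close> contributes to the total for \<open>p + p'\<close>.\<close>

lemma ptotal_mult:
  assumes u: "u \<ge> 0"
  shows "ptotal q u N p * ptotal q u M p' \<le> u * ptotal q u (N + M) (p + p')"
proof (induction N arbitrary: p)
  case 0
  then show ?case
    using u total_nonneg by (cases "p = 0") (simp_all add: ptotal_0, simp add: ptotal_def)
next
  case (Suc N)
  show ?case
  proof (cases "p = 0")
    case True
    then show ?thesis
      using total_mono(2)[OF u, of M "Suc N + M" p'] u by (simp add: ptotal_0 mult_left_mono)
  next
    case False
    then have p: "p \<ge> 1" "p + p' \<ge> 1" by auto
    let ?K = "N + M" let ?Y = "ptotal q u M p'"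
    note nn = total_nonneg[OF u]
    have "ptotal q u (Suc N) p * ?Y = (\<Sum>k=1..N. q k * (ptotal q u N (p + k - 2) * ?Y)) +
      2 * (\<Sum>i<p - 1. total q u N i * (ptotal q u N (p - 2 - i) * ?Y))"
      unfolding ptotal_Suc[OF p(1)] by (simp add: distrib_right sum_distrib_right mult.assoc)
    also have "\<dots> \<le> (\<Sum>k=1..N. q k * (u * ptotal q u ?K (p + k - 2 + p'))) +
      2 * (\<Sum>i<p - 1. total q u ?K i * (u * ptotal q u ?K (p - 2 - i + p')))"
    proof -
      have "(\<Sum>k=1..N. q k * (ptotal q u N (p + k - 2) * ?Y))
        \<le> (\<Sum>k=1..N. q k * (u * ptotal q u ?K (p + k - 2 + p')))"
        using q by (intro sum_mono mult_left_mono Suc.IH) auto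
      moreover have "(\<Sum>i<p - 1. total q u N i * (ptotal q u N (p - 2 - i) * ?Y))
        \<le> (\<Sum>i<p - 1. total q u ?K i * (u * ptotal q u ?K (p - 2 - i + p')))"
        by (rule sum_mono, rule mult_mono[OF total_mono(1)[OF u] Suc.IH])
          (simp_all add: nn)
      ultimately show ?thesis by linarith
    qed
    also have "\<dots> = (\<Sum>k=1..N. q k * (u * ptotal q u ?K (p + p' + k - 2))) +
      2 * (\<Sum>i<p - 1. total q u ?K i * (u * ptotal q u ?K (p + p' - 2 - i)))"
    proof (intro arg_cong2[of _ _ _ _ "(+)"] arg_cong[of _ _ "(*) 2"] sum.cong refl)
      fix k assume "k \<in> {1..N}"
      then have "p + k - 2 + p' = p + p' + k - 2" using p by auto
      then show "q k * (u * ptotal q u ?K (p + k - 2 + p')) = q k * (u * ptotal q u ?K (p + p' + k - 2))"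
        by simp
    next
      fix i assume "i \<in> {..<p - 1}"
      then have "p - 2 - i + p' = p + p' - 2 - i" by auto
      then show "total q u ?K i * (u * ptotal q u ?K (p - 2 - i + p'))
        = total q u ?K i * (u * ptotal q u ?K (p + p' - 2 - i))" by simp
    qed
    \<comment> \<open>The added terms are nonnegative: faces of degree above \<open>N\<close>, and
      downward steps with \<open>p - 1 \<le> i\<close>, which jump across height \<open>p'\<close>
      without visiting it.\<close>
    also have "\<dots> \<le> (\<Sum>k=1..?K. q k * (u * ptotal q u ?K (p + p' + k - 2))) +
      2 * (\<Sum>i<p + p' - 1. total q u ?K i * (u * ptotal q u ?K (p + p' - 2 - i)))"
      using q nn u by (intro add_mono mult_left_mono sum_mono2) (auto intro!: mult_nonneg_nonneg)
    also have "\<dots> = u * ptotal q u (Suc ?K) (p + p')"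
      unfolding ptotal_Suc[OF p(2)] by (simp add: sum_distrib_left algebra_simps)
    finally show ?thesis by simp
  qed
qed

text \<open>The case \<open>n = 0\<close> is set apart because \<open>ptotal q u 0 0 = u\<close> may
  be smaller than 1.\<close>

lemma ptotal_power:
  assumes u: "0 \<le> u" "u \<le> 1"
  shows "ptotal q u N p ^ n \<le> ptotal q u (n * N) (n * p) \<or> n = 0"
proof (induction n)
  case (Suc n)
  show ?case
  proof (cases "n = 0")
    case False
    then have "ptotal q u N p ^ Suc n \<le> ptotal q u N p * ptotal q u (n * N) (n * p)"
      using Suc total_nonneg[OF u(1)] by (auto intro!: mult_left_mono)
    also have "\<dots> \<le> u * ptotal q u (N + n * N) (p + n * p)" by (rule ptotal_mult[OF u(1)])
    also have "\<dots> \<le> 1 * ptotal q u (N + n * N) (p + n * p)"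
      using u total_nonneg[OF u(1)] by (intro mult_right_mono) auto
    finally show ?thesis by simp
  qed simp
qed simp

lemma ptotal_le_total:
  assumes u: "0 \<le> u" "u < 1"
  shows "ptotal q u N p \<le> total q 1 N p / (1 - u)"
proof -
  have "real n * u ^ n \<le> 1 / (1 - u)" for n
  proof -
    have "real n * u ^ n \<le> (\<Sum>i<n. u ^ i)"
      using sum_bounded_below[of "{..<n}" "u ^ n" "\<lambda>i. u ^ i"] u by (simp add: power_decreasing)
    also have "\<dots> = (1 - u ^ n) / (1 - u)" using u by (simp add: sum_gp_strict)
    also have "\<dots> \<le> 1 / (1 - u)" using u by (intro divide_right_mono) auto
    finally show ?thesis .
  qed
  then have "tree_weight q t * (real (tree_vertices t) * u ^ tree_vertices t) \<le> tree_weight q t * (1 / (1 - u))" if "t \<in> trees N p" for t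
    using tree_weight_nonneg trees_valid[OF that] by (intro mult_left_mono) auto
  then have "ptotal q u N p \<le> (\<Sum>t\<in>trees N p. tree_weight q t * (1 / (1 - u)))"
    unfolding ptotal_def by (intro sum_mono) (simp add: algebra_simps)
  then show ?thesis by (simp add: total_def sum_divide_distrib)
qed

lemma total_Chord:
  assumes "k \<ge> 1" "p \<ge> 1" "u \<ge> 0"
  shows "q k * total q u N (p + k - 2) \<le> total q u (Suc (max N k)) p"
proof -
  let ?M = "max N k"
  have "q k * total q u N (p + k - 2) \<le> q k * total q u ?M (p + k - 2)"
    using q assms total_mono by (intro mult_left_mono) auto
  also have "\<dots> \<le> (\<Sum>j=1..?M. q j * total q u ?M (p + j - 2))"
    using q assms total_nonneg by (intro member_le_sum) auto
  also have "\<dots> \<le> total q u (Suc ?M) p"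
    unfolding total_Suc[OF assms(2)] using total_nonneg assms(3) by (auto intro!: sum_nonneg)
  finally show ?thesis .
qed

text \<open>Each use of \<open>total_Chord\<close> with a face of degree \<open>k\<close> lowers the
  perimeter by \<open>k - 2\<close> and costs \<open>q k\<close>. The height grows on the way, which
  is harmless because \<open>B\<close> bounds all truncations.\<close>

lemma total_growth:
  assumes k: "k \<ge> 2" and B: "\<And>N. total q 1 N 2 \<le> B"
  shows "q k ^ j * total q 1 N (2 + j * (k - 2)) \<le> B"
proof (induction j arbitrary: N)
  case 0
  then show ?case using B by simp
next
  case (Suc j)
  let ?p = "2 + j * (k - 2)"
  have "q k * total q 1 N (?p + k - 2) \<le> total q 1 (Suc (max N k)) ?p"
    using k by (intro total_Chord) auto
  then have "q k ^ j * (q k * total q 1 N (?p + k - 2)) \<le> q k ^ j * total q 1 (Suc (max N k)) ?p"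
    using q k by (intro mult_left_mono) auto
  also have "\<dots> \<le> B" by (rule Suc)
  also have "?p + k - 2 = 2 + Suc j * (k - 2)" using k by simp
  finally show ?case by (simp add: mult.assoc mult.left_commute)
qed

lemma ptotal_bound:
  assumes k: "k \<ge> 3" "q k > 0" and B: "\<And>N. total q 1 N 2 \<le> B" and u: "0 \<le> u" "u < 1"
  shows "ptotal q u N 2 \<le> max 1 (1 / q k ^ 2)"
proof (rule ccontr)
  let ?y = "ptotal q u N 2"
  assume "\<not> ?y \<le> max 1 (1 / q k ^ 2)"
  then have y: "?y > 1" "?y > 1 / q k ^ 2" by auto
  \<comment> \<open>The quantity whose powers are bounded below by \<open>B / (1 - u)\<close>. As
    \<open>k - 2 \<ge> 1\<close> and \<open>?y > 1\<close>, the assumed violation of the bound makes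
    it exceed 1.\<close>
  define z where "z = q k ^ 2 * ?y ^ (k - 2)"
  have "?y \<le> ?y ^ (k - 2)" using y k self_le_power[of ?y "k - 2"] by simp
  then have "1 / q k ^ 2 < ?y ^ (k - 2)" using y by simp
  then have z: "z > 1" using k by (simp add: z_def field_simps)
  have "z ^ i \<le> B / (1 - u)" for i
  proof -
    \<comment> \<open>Chosen so that the perimeter \<open>?n * 2\<close> equals
      \<open>2 + (2 * i) * (k - 2)\<close> and is reached by \<open>2 * i\<close> steps of
      \<open>total_growth\<close>; hence the square of \<open>q k\<close>.\<close>
    let ?n = "1 + i * (k - 2)"
    have "?y ^ (i * (k - 2)) \<le> ?y ^ ?n" using y by (intro power_increasing) auto
    also have "\<dots> \<le> ptotal q u (?n * N) (?n * 2)" using ptotal_power[of u N 2 ?n] u by auto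
    also have "\<dots> \<le> total q 1 (?n * N) (?n * 2) / (1 - u)" by (rule ptotal_le_total[OF u])
    finally have "q k ^ (2 * i) * ?y ^ (i * (k - 2)) \<le> q k ^ (2 * i) * (total q 1 (?n * N) (?n * 2) / (1 - u))"
      using k by (intro mult_left_mono) auto
    also have "\<dots> = (q k ^ (2 * i) * total q 1 (?n * N) (2 + (2 * i) * (k - 2))) / (1 - u)"
      by (simp add: algebra_simps)
    also have "\<dots> \<le> B / (1 - u)"
      using total_growth[OF _ B] k u by (intro divide_right_mono) auto
    also have "q k ^ (2 * i) * ?y ^ (i * (k - 2)) = z ^ i"
      by (simp add: z_def power_mult_distrib mult.commute flip: power_mult)
    finally show ?thesis .
  qed
  moreover obtain i where "B / (1 - u) < z ^ i" using real_arch_pow[OF z] by blast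
  ultimately show False by (meson not_le)
qed

text \<open>For fixed \<open>N\<close> the truncated total is a polynomial in \<open>u\<close>,
  hence continuous at 1, and the bound does not involve \<open>u\<close>.\<close>

lemma ptotal_bound_1:
  assumes k: "k \<ge> 3" "q k > 0" and B: "\<And>N. total q 1 N 2 \<le> B"
  shows "ptotal q 1 N 2 \<le> max 1 (1 / q k ^ 2)"
proof (rule tendsto_upperbound)
  show "((\<lambda>u. ptotal q u N 2) \<longlongrightarrow> ptotal q 1 N 2) (at_left 1)"
    unfolding ptotal_def by (intro tendsto_intros)
  show "\<forall>\<^sub>F u in at_left 1. ptotal q u N 2 \<le> max 1 (1 / q k ^ 2)"
    using ptotal_bound[OF k B] eventually_at_left_real[of 0 "1::real"]
    by (auto elim!: eventually_mono)
qed simp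

end

section \<open>Boltzmann weights of maps\<close>

lemma origin_self:
  assumes "premap m" shows "d \<in> origin m d"
  using self_in_orbit[of "darts m" "rot m"] assms by (simp add: premap_def origin_def)

text \<open>A path in the graph starting at a dart of an invariant set \<open>A\<close> only meets
  vertices contained in \<open>A\<close>. Conversely, the darts whose origin can be reached from a
  given vertex form an invariant set.\<close>

lemma connected_iff_conn:
  assumes m: "premap m" and ne: "darts m \<noteq> {}"
  shows "Digraph_Component.connected (map_graph m) \<longleftrightarrow> connected_map m"
proof
  let ?R = "rtrancl_on (map_vertices m) ((arcs_ends (map_graph m))\<^sup>s)"
  have arcs: "arcs_ends (map_graph m) = (\<lambda>d. (origin m d, origin m (opp m d))) ` darts m"
    by (simp add: arcs_ends_def arc_to_ends_def map_graph_def)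
  have verts: "verts (map_graph m) = map_vertices m" by (simp add: map_graph_def)
  {
    assume con: "Digraph_Component.connected (map_graph m)"
    show "connected_map m"
      unfolding connected_map_def
    proof (intro allI impI)
      fix A assume A: "closed_in m A"
      have sub: "origin m d \<subseteq> A" if "d \<in> A" for d
        using closed_in_orbit(2)[OF m A that] by (simp add: origin_def)
      show "A = {} \<or> A = darts m"
      proof (cases "A = {}")
        case False
        then obtain a where a: "a \<in> A" by blast
        have "v \<subseteq> A" if "(origin m a, v) \<in> ?R" for v
          using that
        proof (induction rule: rtrancl_on_induct)
          case base
          show ?case by (rule sub[OF a])
        next
          case (step y z)
          then obtain d where d: "d \<in> darts m"
            "y = origin m d \<and> z = origin m (opp m d) \<or> z = origin m d \<and> y = origin m (opp m d)"
            by (auto simp: symcl_def arcs)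
          from d(2) show ?case
          proof (elim disjE conjE)
            assume e: "y = origin m d" "z = origin m (opp m d)"
            then have "d \<in> A" using step origin_self[OF m, of d] by auto
            then show ?thesis using sub[of "opp m d"] e A by (simp add: closed_in_def)
          next
            assume e: "z = origin m d" "y = origin m (opp m d)"
            then have "opp m d \<in> A" using step origin_self[OF m, of "opp m d"] by auto
            then have "d \<in> A" by (rule closed_in_back(2)[OF m A])
            then show ?thesis using sub[of d] e by simp
          qed
        qed
        moreover have "(origin m a, origin m d) \<in> ?R" if "d \<in> darts m" for d
          using con that a A unfolding connected_conv verts by (auto simp: map_vertices_def closed_in_def)
        ultimately have "d \<in> A" if "d \<in> darts m" for d using that origin_self[OF m, of d] by blast
        then show ?thesis using A by (auto simp: closed_in_def)
      qed simp
    qed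
  next
    assume con: "connected_map m"
    show "Digraph_Component.connected (map_graph m)"
      unfolding connected_conv verts
    proof (intro conjI ballI)
      show "map_vertices m \<noteq> {}" using ne by (simp add: map_vertices_def)
      fix v w assume v: "v \<in> map_vertices m" and w: "w \<in> map_vertices m"
      define A where "A = {d \<in> darts m. (v, origin m d) \<in> ?R}"
      have "closed_in m A"
        unfolding closed_in_def
      proof (intro conjI ballI)
        show "A \<subseteq> darts m" by (auto simp: A_def)
        fix d assume d: "d \<in> A"
        then have dD: "d \<in> darts m" and R: "(v, origin m d) \<in> ?R" by (auto simp: A_def)
        have "origin m (rot m d) = origin m d"
          using m orbit_eq[of "darts m" "rot m" "rot m d" d] orbit.base[of "rot m" d]
          by (simp add: origin_def premap_def)
        then show "rot m d \<in> A" using premap_closed[OF m dD] R by (simp add: A_def)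
        have "(origin m d, origin m (opp m d)) \<in> (arcs_ends (map_graph m))\<^sup>s"
          using dD by (auto simp: symcl_def arcs)
        moreover have "origin m (opp m d) \<in> map_vertices m"
          using premap_closed[OF m dD] by (simp add: map_vertices_def)
        ultimately have "(v, origin m (opp m d)) \<in> ?R" using R by (rule rtrancl_on_into_rtrancl_on[rotated])
        then show "opp m d \<in> A" using premap_closed[OF m dD] by (simp add: A_def)
      qed
      moreover obtain a where "a \<in> darts m" "v = origin m a" using v by (auto simp: map_vertices_def)
      then have "a \<in> A" using v by (auto simp: A_def)
      ultimately have "A = darts m" using con unfolding connected_map_def by blast
      then show "(v, w) \<in> ?R" using w by (auto simp: map_vertices_def A_def)
    qed
  }
qed

lemma card_map_edges:
  assumes "premap m" shows "2 * card (map_edges m) = card (darts m)"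
proof -
  have D: "\<And>d. d \<in> darts m \<Longrightarrow> opp m d \<in> darts m \<and> opp m d \<noteq> d \<and> opp m (opp m d) = d"
    using assms premap_closed[OF assms] by (simp add: premap_def)
  have fin: "finite (darts m)" using assms by (simp add: premap_def)
  have un: "\<Union>(map_edges m) = darts m" using D by (auto simp: map_edges_def)
  have "2 * card (map_edges m) = card (\<Union>(map_edges m))"
  proof (rule card_partition)
    show "finite (map_edges m)" "finite (\<Union>(map_edges m))" using fin un by (auto simp: map_edges_def)
    show "card c = 2" if "c \<in> map_edges m" for c
      using that D by (auto simp: map_edges_def card_2_iff)
    show "c1 \<inter> c2 = {}" if "c1 \<in> map_edges m" "c2 \<in> map_edges m" "c1 \<noteq> c2" for c1 c2
    proof -
      obtain d e where "d \<in> darts m" "e \<in> darts m" "c1 = {d, opp m d}" "c2 = {e, opp m e}"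
        using \<open>c1 \<in> map_edges m\<close> \<open>c2 \<in> map_edges m\<close> by (auto simp: map_edges_def)
      then show ?thesis using \<open>c1 \<noteq> c2\<close> D[of d] D[of e] by auto
    qed
  qed
  then show ?thesis using un by simp
qed

lemma planar_map_iff: "planar_map m \<longleftrightarrow> sphere m \<and> darts m \<noteq> {}"
proof (cases "premap m \<and> root_dart m \<in> darts m")
  case True
  then have m: "premap m" and r: "root_dart m \<in> darts m" by auto
  then have ne: "darts m \<noteq> {}" by auto
  have "root_face m \<in> map_faces m" using r by (simp add: root_face_def map_faces_def)
  moreover have "finite (map_faces m)" using m by (simp add: map_faces_def premap_def)
  ultimately have "num_faces m = card (map_faces m)"
    unfolding num_faces_def inner_faces_def by (simp add: card_Suc_Diff1 del: card_Diff_insert)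
  moreover have "num_vertices m = card (map_vertices m)" using ne by (simp add: num_vertices_def)
  ultimately have "2 * (num_vertices m + num_faces m) = card (darts m) + 4 \<longleftrightarrow>
      card (map_vertices m) + card (map_faces m) = card (map_edges m) + 2"
    using card_map_edges[OF m] by auto
  then show ?thesis
    using m r ne connected_iff_conn[OF m ne]
    by (auto simp: planar_map_def sphere_def cmap_def rooted_def premap_def)
next
  case False
  then show ?thesis by (auto simp: planar_map_def sphere_def cmap_def rooted_def premap_def)
qed

lemma sphere_perimeter_pos:
  assumes "sphere m" "darts m \<noteq> {}" shows "perimeter m \<ge> 1" "perim m = perimeter m"
proof -
  interpret root_edge m using assms by (rule sphere_root_edge)
  have "finite Or" using orbit_D(1) fin by (rule finite_subset)
  moreover have "Or \<noteq> {}" by (rule orbit_nonempty)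
  ultimately show "perimeter m \<ge> 1" by (simp add: perimeter_def root_face_orbit Suc_le_eq card_gt_0_iff)
  show "perim m = perimeter m" using assms by (simp add: perim_def)
qed

definition tree_map :: "mtree \<Rightarrow> rooted_map" where
  "tree_map t = (SOME m. sphere m \<and> codes m t)"

lemma tree_map:
  assumes "tree_valid t" "tree_perimeter t \<ge> 1"
  shows "sphere (tree_map t)" "codes (tree_map t) t" "planar_map (tree_map t)"
    "perimeter (tree_map t) = tree_perimeter t" "card (map_vertices (tree_map t)) = tree_vertices t"
    "map_weight q (tree_map t) = tree_weight q t"
proof -
  have "\<exists>m. sphere m \<and> codes m t" using codes_exists[OF assms(1), of "{}"] by auto
  then have *: "sphere (tree_map t) \<and> codes (tree_map t) t" unfolding tree_map_def by (rule someI_ex)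
  then show s: "sphere (tree_map t)" "codes (tree_map t) t" by auto
  note c = codes_sphere[OF s]
  have ne: "darts (tree_map t) \<noteq> {}" using codes_empty_iff[OF s(2)] assms(2) by auto
  then show "planar_map (tree_map t)" using s planar_map_iff by simp
  show "perimeter (tree_map t) = tree_perimeter t" using c(2) ne by (simp add: perim_def)
  show "card (map_vertices (tree_map t)) = tree_vertices t" using c(3) ne by (simp add: num_vertices_def)
  show "map_weight q (tree_map t) = tree_weight q t" using c(4) by simp
qed

section \<open>Sums over trees against sums over isomorphism classes\<close>

lemma sum_le_infsum_ennreal:
  fixes f :: "'a \<Rightarrow> ennreal"
  assumes "finite F" "F \<subseteq> A" shows "sum f F \<le> infsum f A"
  using assms by (subst nonneg_infsum_complete) (auto intro!: SUP_upper)

lemma infsum_ennreal_le: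
  fixes f :: "'a \<Rightarrow> ennreal"
  assumes "\<And>F. finite F \<Longrightarrow> F \<subseteq> A \<Longrightarrow> sum f F \<le> C" shows "infsum f A \<le> C"
  using assms by (subst nonneg_infsum_complete) (auto intro!: SUP_least)

text \<open>Trees inject into isomorphism classes: if the chosen maps of two trees are isomorphic,
  \<open>codes_iso\<close> gives one map both codes, and \<open>codes_unique\<close> makes them
  equal.\<close>

lemma sum_trees_le_W:
  assumes q: "\<And>k. k \<ge> 1 \<Longrightarrow> q k \<ge> 0" and p: "p \<ge> 1"
  shows "ennreal (total q 1 N p) \<le> W q p"
proof -
  let ?cl = "\<lambda>t. map_iso_rel `` {tree_map t}"
  let ?f = "\<lambda>X. ennreal (the_elem (map_weight q ` X))"
  have v: "tree_valid t" "tree_perimeter t = p" "tree_perimeter t \<ge> 1" if "t \<in> trees N p" for t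
    using trees_valid[OF that] p by auto
  have inj: "inj_on ?cl (trees N p)"
  proof (rule inj_onI)
    fix t u assume t: "t \<in> trees N p" and u: "u \<in> trees N p" and eq: "?cl t = ?cl u"
    note T = tree_map[OF v(1,3)[OF t]] and U = tree_map[OF v(1,3)[OF u]]
    have "(tree_map t, tree_map u) \<in> map_iso_rel"
      using eq equiv_map_iso_rel T(3) U(3) eq_equiv_class by (metis mem_Collect_eq)
    then obtain h where "map_iso h (tree_map t) (tree_map u)" by (auto simp: map_iso_rel_def)
    then have "codes (tree_map u) t" using codes_iso T U by blast
    then show "t = u" using codes_unique U(2) by blast
  qed
  have "ennreal (total q 1 N p) = (\<Sum>t\<in>trees N p. ennreal (tree_weight q t))"
    unfolding total_def using tree_weight_nonneg[OF q] v(1) by (simp add: sum_ennreal)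
  also have "\<dots> = (\<Sum>t\<in>trees N p. ?f (?cl t))"
    using tree_map(3,6)[OF v(1,3)] by (intro sum.cong refl) (simp add: class_weight)
  also have "\<dots> = sum ?f (?cl ` trees N p)" using inj by (simp add: sum.reindex)
  also have "\<dots> \<le> W q p"
    unfolding W_def
  proof (rule sum_le_infsum_ennreal)
    show "?cl ` trees N p \<subseteq> {m. planar_map m \<and> perimeter m = p} // map_iso_rel"
      using tree_map(3,4)[OF v(1,3)] v(2) by (auto intro!: quotientI)
  qed simp
  finally show ?thesis .
qed

text \<open>Every pointed class is represented by the chosen map of some tree with one of its
  vertices, the marked vertex being carried along the isomorphism from \<open>codes_imp_iso\<close>.
  A choice \<open>g\<close> of such pairs is injective, since the pair determines its class.\<close>

lemma W_ptd_le:
  assumes q: "\<And>k. k \<ge> 1 \<Longrightarrow> q k \<ge> 0" and p: "p \<ge> 1"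
    and C: "\<And>N. ptotal q 1 N p \<le> C"
  shows "W_ptd q p \<le> ennreal C"
  unfolding W_ptd_def
proof (rule infsum_ennreal_le)
  let ?Q = "{(m, v). pointed_map (m, v) \<and> perimeter m = p} // pointed_iso_rel"
  let ?f = "\<lambda>X. ennreal (the_elem ((\<lambda>(m, v). map_weight q m) ` X))"
  let ?cl = "\<lambda>(t, v). pointed_iso_rel `` {(tree_map t, v)}"
  fix F assume F: "finite F" "F \<subseteq> ?Q"
  have ex: "\<exists>tv. tree_valid (fst tv) \<and> tree_perimeter (fst tv) = p \<and> snd tv \<in> map_vertices (tree_map (fst tv)) \<and> ?cl tv = X"
    if X: "X \<in> ?Q" for X
  proof -
    obtain m v where m: "pointed_map (m, v)" "perimeter m = p" "X = pointed_iso_rel `` {(m, v)}"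
      using X by (auto elim!: quotientE)
    then have pl: "planar_map m" and v: "v \<in> map_vertices m" by (auto simp: pointed_map_def)
    then have s: "sphere m" "darts m \<noteq> {}" using planar_map_iff by auto
    obtain t where t: "codes m t" "tree_valid t" "tree_perimeter t = p"
      using sphere_codes[OF s(1)] m(2) sphere_perimeter_pos(2)[OF s] by auto
    then have t1: "tree_perimeter t \<ge> 1" using p by simp
    note T = tree_map[OF t(2) t1]
    obtain h where h: "map_iso h m (tree_map t)" using codes_imp_iso[OF t(1) T(2) s(1) T(1)] by blast
    obtain d where d: "d \<in> darts m" "v = origin m d" using v by (auto simp: map_vertices_def)
    have "h ` v = origin (tree_map t) (h d)" using origin_iso(2)[OF pl h d(1)] d by simp
    moreover have "h d \<in> darts (tree_map t)" using d h by (auto simp: map_iso_def bij_betw_def)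
    ultimately have hv: "h ` v \<in> map_vertices (tree_map t)" by (simp add: map_vertices_def)
    then have "((m, v), (tree_map t, h ` v)) \<in> pointed_iso_rel"
      using m(1) T(3) h by (auto simp: pointed_iso_rel_def pointed_map_def)
    then have "?cl (t, h ` v) = X"
      using m(3) equiv_class_eq[OF equiv_pointed_iso_rel] by simp
    then show ?thesis using t hv by (intro exI[of _ "(t, h ` v)"]) auto
  qed
  have "\<forall>X\<in>?Q. \<exists>tv. tree_valid (fst tv) \<and> tree_perimeter (fst tv) = p \<and>
    snd tv \<in> map_vertices (tree_map (fst tv)) \<and> ?cl tv = X"
    using ex by (rule ballI)
  from bchoice[OF this] obtain g where g0: "\<forall>X\<in>?Q. tree_valid (fst (g X)) \<and> tree_perimeter (fst (g X)) = p \<and>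
    snd (g X) \<in> map_vertices (tree_map (fst (g X))) \<and> ?cl (g X) = X" by (rule exE)
  have g: "tree_valid (fst (g X))" "tree_perimeter (fst (g X)) = p" "snd (g X) \<in> map_vertices (tree_map (fst (g X)))"
    "?cl (g X) = X" if "X \<in> ?Q" for X
    using bspec[OF g0 that] by simp_all
  \<comment> \<open>The family is finite, so one height serves all of its trees, and the bound
    \<open>C\<close> on the truncated totals applies.\<close>
  have "\<exists>N. fst ` g ` F \<subseteq> trees N p"
    using F
  proof (induction F rule: finite_induct)
    case (insert X F)
    then obtain N where N: "fst ` g ` F \<subseteq> trees N p" by auto
    obtain M where M: "\<And>K. K \<ge> M \<Longrightarrow> fst (g X) \<in> trees K p"
      using trees_exhaust[OF g(1)[of X]] g(2)[of X] insert.prems by auto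
    have "fst ` g ` insert X F \<subseteq> trees (max M N) p"
      using M[of "max M N"] N trees_mono[of N "max M N" p] by auto
    then show ?case by blast
  qed simp
  then obtain N where N: "fst ` g ` F \<subseteq> trees N p" by blast
  let ?S = "SIGMA t:trees N p. map_vertices (tree_map t)"
  have v: "tree_valid t" "tree_perimeter t \<ge> 1" if "t \<in> trees N p" for t
    using trees_valid[OF that] p by auto
  have finV: "finite (map_vertices (tree_map t))" if "t \<in> trees N p" for t
    using tree_map(3)[OF v[OF that]] by (simp add: planar_map_def map_vertices_def)
  have gS: "g ` F \<subseteq> ?S"
  proof
    fix x assume "x \<in> g ` F"
    then obtain X where X: "X \<in> F" "x = g X" by blast
    then have "fst x \<in> trees N p" using N by auto
    moreover have "snd x \<in> map_vertices (tree_map (fst x))" using g(3)[of X] X F by auto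
    ultimately show "x \<in> ?S" by (cases x) auto
  qed
  have inj: "inj_on g F"
  proof (rule inj_onI)
    fix X Y assume "X \<in> F" "Y \<in> F" and e: "g X = g Y"
    then have "X \<in> ?Q" "Y \<in> ?Q" using F(2) by blast+
    from g(4)[OF this(1)] g(4)[OF this(2)] e show "X = Y" by metis
  qed
  have "sum ?f F = (\<Sum>X\<in>F. ennreal (tree_weight q (fst (g X))))"
  proof (rule sum.cong[OF refl])
    fix X assume "X \<in> F"
    then have X: "X \<in> ?Q" using F by blast
    obtain t w where tw: "g X = (t, w)" by (cases "g X")
    have t: "tree_valid t" "tree_perimeter t = p" "w \<in> map_vertices (tree_map t)" "X = pointed_iso_rel `` {(tree_map t, w)}"
      using g[OF X] tw by auto
    then have t1: "tree_perimeter t \<ge> 1" using p by simp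
    note T = tree_map[OF t(1) t1]
    have "pointed_map (tree_map t, w)" using T(3) t(3) by (simp add: pointed_map_def)
    then show "?f X = ennreal (tree_weight q (fst (g X)))"
      using pointed_class_weight T(6) t(4) tw by simp
  qed
  also have "\<dots> = (\<Sum>x\<in>g ` F. ennreal (tree_weight q (fst x)))"
    using inj by (simp add: sum.reindex)
  also have "\<dots> \<le> (\<Sum>x\<in>?S. ennreal (tree_weight q (fst x)))"
    using finV gS by (intro sum_mono2) auto
  also have "\<dots> = (\<Sum>t\<in>trees N p. \<Sum>w\<in>map_vertices (tree_map t). ennreal (tree_weight q t))"
    using finV by (subst sum.Sigma) (auto intro!: sum.cong)
  also have "\<dots> = (\<Sum>t\<in>trees N p. ennreal (real (tree_vertices t) * tree_weight q t))"
    using tree_map(5)[OF v] tree_weight_nonneg[OF q v(1)]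
    by (intro sum.cong refl) (simp add: ennreal_mult ennreal_of_nat_eq_real_of_nat)
  also have "\<dots> = ennreal (ptotal q 1 N p)"
    unfolding ptotal_def using tree_weight_nonneg[OF q v(1)] by (simp add: sum_ennreal)
  also have "\<dots> \<le> ennreal C" using C by (rule ennreal_leI)
  finally show "sum ?f F \<le> ennreal C" .
qed

theorem lemmaA1:
  fixes q :: "nat \<Rightarrow> real"
  assumes nonneg: "\<And>k. k \<ge> 1 \<Longrightarrow> q k \<ge> 0"
    and adm: "admissible q"
    and odd_weight: "\<exists>k\<ge>3. odd k \<and> q k > 0"
  shows "ptd_admissible q"
proof -
  obtain k where k: "k \<ge> 3" "q k > 0" using odd_weight by blast
  have "W q 2 < \<infinity>" using adm by (simp add: admissible_def)
  then obtain B where B: "W q 2 = ennreal B" "B \<ge> 0" by (cases "W q 2") auto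
  \<comment> \<open>Admissibility enters through perimeter 2 alone: its finite total bounds all
    truncations at once.\<close>
  have tb: "total q 1 N 2 \<le> B" for N
  proof -
    have "ennreal (total q 1 N 2) \<le> W q 2" by (rule sum_trees_le_W) (use nonneg in auto)
    then show ?thesis using B by (simp add: ennreal_le_iff)
  qed
  have "ptotal q 1 N 2 \<le> max 1 (1 / q k ^ 2)" for N
    using k tb by (intro ptotal_bound_1[where q = q and B = B] nonneg)
  then have "W_ptd q 2 \<le> ennreal (max 1 (1 / q k ^ 2))"
    by (intro W_ptd_le) (use nonneg in auto)
  then show ?thesis
    unfolding ptd_admissible_def by (rule le_less_trans) simp
qed

end
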